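(* A $k$-tuple $T=(T_1,\dots,T_k)\in\mathbf B_\Lambda(\mathcal H)$ admits a characteristic function if and only if $$\Delta_{\mathbf S\otimes I}(I-K_TK_T^* )\ge0,$$ where $K_T$ is the noncommutative Berezin kernel associated with $T$ and $\Delta_{\mathbf S\otimes I}:=(\mathrm{id}-\Phi_{\mathbf S_1\otimes I})\circ\cdots\circ(\mathrm{id}-\Phi_{\mathbf S_k\otimes I})$. If, in addition, $T$ is a pure $k$-tuple in $\mathbf B_\Lambda(\mathcal H)$, then the following statements are equivalent. (i) $T$ admits a characteristic function. (ii) $(K_T\mathcal H)^\perp$ is a Beurling type invariant subspace under all the operators $S_{i,s}\otimes I$. (iii) The $k$-tuple $(\mathbf S\otimes I)|_{(K_T\mathcal H)^\perp}$ is doubly $\Lambda$-commuting. (iv) There is a Beurling type invariant subspace $\mathcal M$ under the operators $S_{i,s}\otimes I_{\mathcal D}$, for some Hilbert space $\mathcal D$, such that, under a unitary identification of $\mathcal H$ with $\mathcal M^\perp$, $T_{i,s}^*=(S_{i,s}^*\otimes I_{\mathcal D})|_{\mathcal M^\perp}$ for all $i\in\{1,\dots,k\}$, $s\in\{1,\dots,n_i\}$, and $$\ell^2(\mathbf F)\otimes\mathcal D=\bigvee_{\boldsymbol\alpha\in\mathbf F}(\mathbf S_{\boldsymbol\alpha}\otimes I_{\mathcal D})\mathcal M^\perp.$$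
   Context: Let $k,n_1,\dots,n_k$ be positive integers. For $i,j\in\{1,\dots,k\}$, $i\ne j$, let $\Lambda_{ij}=[\lambda_{i,j}(s,t)]$ be an $n_i\times n_j$ matrix with entries in $\mathbb T=\{z\in\mathbb C:|z|=1\}$, with $\Lambda_{ji}=\Lambda_{ij}^*$, i.e. $\lambda_{j,i}(t,s)=\overline{\lambda_{i,j}(s,t)}$. Words: $\mathbb F_{n_i}^+$ is the unital free semigroup with generators $g^i_1,\dots,g^i_{n_i}$ and neutral element $g^i_0$. If $X_{i,1},\dots,X_{i,n_i}$ are operators and $\alpha=g^i_{p_1}\cdots g^i_{p_m}$, put $X_{i,\alpha}=X_{i,p_1}\cdots X_{i,p_m}$, and $X_{i,g^i_0}=I$. Set $\mathbf F=\mathbb F_{n_1}^+\times\cdots\times\mathbb F_{n_k}^+$. Universal model $\mathbf S=(\mathbf S_1,\dots,\mathbf S_k)$, $\mathbf S_i=[S_{i,1}\cdots S_{i,n_i}]$: on $\ell^2(\mathbf F)$ with orthonormal basis $\{\chi_{(\alpha_1,\dots,\alpha_k)}\}$, $$S_{i,s}\chi_{(\alpha_1,\dots,\alpha_k)}=\boldsymbol\lambda_{i,1}(s,\alpha_1)\cdots\boldsymbol\lambda_{i,i-1}(s,\alpha_{i-1})\,\chi_{(\alpha_1,\dots,\alpha_{i-1},g^i_s\alpha_i,\alpha_{i+1},\dots,\alpha_k)}$$ (no scalar factor if $i=1$), where $\boldsymbol\lambda_{i,j}(s,\beta)=\prod_{b=1}^q\lambda_{i,j}(s,j_b)$ for $\beta=g^j_{j_1}\cdots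 g^j_{j_q}$ and $\boldsymbol\lambda_{i,j}(s,g^j_0)=1$. For $\boldsymbol\alpha=(\alpha_1,\dots,\alpha_k)\in\mathbf F$, $\mathbf S_{\boldsymbol\alpha}=S_{1,\alpha_1}\cdots S_{k,\alpha_k}$. A $k$-tuple $V=(V_1,\dots,V_k)$ of row isometries $V_i=[V_{i,1}\cdots V_{i,n_i}]$ is doubly $\Lambda$-commuting if $V_{i,s}^*V_{j,t}=\overline{\lambda_{i,j}(s,t)}V_{j,t}V_{i,s}^*$ for all $i\ne j$ and all $s,t$. For a subspace $\mathcal M$ jointly invariant under all $S_{i,s}\otimes I$, $(\mathbf S\otimes I)|_{\mathcal M}$ is the $k$-tuple of row operators with entries $(S_{i,s}\otimes I)|_{\mathcal M}\in B(\mathcal M)$. For a row operator $T_i=[T_{i,1}\cdots T_{i,n_i}]$, $\Phi_{T_i}(X)=\sum_sT_{i,s}XT_{i,s}^*$; $\Phi_{\mathbf S_i\otimes I}(X)=\sum_s(S_{i,s}\otimes I)X(S_{i,s}\otimes I)^*$. Regular $\Lambda$-polyball: $\mathbf B_\Lambda(\mathcal H)$ is the set of $k$-tuples $T=(T_1,\dots,T_k)$ of row contractions $T_i=[T_{i,1}\cdots T_{i,n_i}]$, $T_{i,s}\in B(\mathcal H)$, $\sum_sT_{i,s}T_{i,s}^*\le I$, such that $T_{i,s}T_{j,t}=\lambda_{i,j}(s,t)T_{j,t}T_{i,s}$ for all $i\ne j$ and all $s,t$, and $\Delta_{rT}(I)\ge0$ for all $r\in[0,1)$, where $\Delta_T(I)=(\mathrm{id}-\Phi_{T_k})\circ\cdots\circ(\mathrm{id}-\Phi_{T_1})(I)$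 and $rT$ has entries $rT_{i,s}$; then also $\Delta_T(I)\ge0$. $T$ is pure if $\Phi_{T_i}^p(I)\to0$ (WOT) as $p\to\infty$ for each $i$. Berezin kernel: $\mathcal D(T)=\overline{\Delta_T(I)\mathcal H}$ and $K_T:\mathcal H\to\ell^2(\mathbf F)\otimes\mathcal D(T)$, $K_Th=\sum_{(\beta_1,\dots,\beta_k)\in\mathbf F}\chi_{(\beta_1,\dots,\beta_k)}\otimes\Delta_T(I)^{1/2}T_{k,\beta_k}^*\cdots T_{1,\beta_1}^*h$. Where not specified, $I$ in $S_{i,s}\otimes I$ is the identity of $\mathcal D(T)$. Multi-analytic operators: a bounded operator $A:\ell^2(\mathbf F)\otimes\mathcal E\to\ell^2(\mathbf F)\otimes\mathcal K$ is multi-analytic if $A(S_{i,s}\otimes I_{\mathcal E})=(S_{i,s}\otimes I_{\mathcal K})A$ for all $i,s$; it is inner if it is also a partial isometry. A subspace $\mathcal M\subset\ell^2(\mathbf F)\otimes\mathcal K$ is a Beurling type (jointly) invariant subspace under the $S_{i,s}\otimes I_{\mathcal K}$ if $\mathcal M=\Psi(\ell^2(\mathbf F)\otimes\mathcal L)$ for some Hilbert space $\mathcal L$ and some inner multi-analytic operator $\Psi:\ell^2(\mathbf F)\otimes\mathcal L\to\ell^2(\mathbf F)\otimes\mathcal K$. $T\in\mathbf B_\Lambda(\mathcal H)$ admits (has) a characteristic function if there are a Hilbert space $\mathcal E$ and a multi-analytic operator $\Psi:\ell^2(\mathbf F)\otimes\mathcal E\to\ell^2(\mathbf F)\otimes\mathcal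 D(T)$ with $K_TK_T^*+\Psi\Psi^*=I$. *)

theory Defs
  imports "HOL-Analysis.Analysis" "HOL-Library.Nonpos_Ints"
begin

section \<open>Complex Hilbert spaces\<close>

text \<open>The complex inner product is linear in the first argument; the underlying real inner product,
  and hence norm and topology, are those of \<^class>\<open>real_inner\<close>.\<close>

class complex_inner = real_inner +
  fixes scaleC :: "complex \<Rightarrow> 'a \<Rightarrow> 'a" (infixr "*\<^sub>C" 75)
    and cinner :: "'a \<Rightarrow> 'a \<Rightarrow> complex"
  assumes scaleC_add_right: "c *\<^sub>C (x + y) = c *\<^sub>C x + c *\<^sub>C y"
    and scaleC_add_left: "(c + d) *\<^sub>C x = c *\<^sub>C x + d *\<^sub>C x"
    and scaleC_scaleC: "c *\<^sub>C d *\<^sub>C x = (c * d) *\<^sub>C x"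
    and scaleR_scaleC: "r *\<^sub>R x = complex_of_real r *\<^sub>C x"
    and cinner_commute: "cinner x y = cnj (cinner y x)"
    and cinner_add_left: "cinner (x + y) z = cinner x z + cinner y z"
    and cinner_scaleC_left: "cinner (c *\<^sub>C x) y = c * cinner x y"
    and inner_eq_Re_cinner: "inner x y = Re (cinner x y)"

class chilbert_space = complex_inner + complete_space

instantiation complex :: chilbert_space
begin
definition "scaleC c (x::complex) = c * x"
definition "cinner (x::complex) y = x * cnj y"
instance
  by standard (auto simp: scaleC_complex_def cinner_complex_def algebra_simps scaleR_conv_of_real
      inner_complex_def)
end

instantiation prod :: (complex_inner, complex_inner) complex_inner
begin
definition "scaleC c (x::'a \<times> 'b) = (c *\<^sub>C fst x, c *\<^sub>C snd x)"
definition "cinner (x::'a \<times> 'b) y = cinner (fst x) (fst y) + cinner (snd x) (snd y)"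
instance
proof
  fix x y :: "'a \<times> 'b"
  show "cinner x y = cnj (cinner y x)"
    unfolding cinner_prod_def by (metis cinner_commute complex_cnj_add)
qed (simp_all add: scaleC_prod_def cinner_prod_def scaleC_add_right scaleC_add_left scaleC_scaleC
      cinner_add_left cinner_scaleC_left inner_prod_def inner_eq_Re_cinner scaleR_prod_def
      scaleR_scaleC distrib_left)
end

instance prod :: (chilbert_space, chilbert_space) chilbert_space ..

lemma scaleC_one [simp]: "1 *\<^sub>C x = (x::'a::complex_inner)"
  using scaleR_scaleC[of 1 x] by simp

lemma scaleC_zero_left [simp]: "0 *\<^sub>C x = (0::'a::complex_inner)"
  using scaleR_scaleC[of 0 x] by simp

lemma scaleC_zero_right [simp]: "c *\<^sub>C 0 = (0::'a::complex_inner)"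
  using scaleC_add_right[of c 0 0] by simp

lemma norm_scaleC: "norm (c *\<^sub>C x) = cmod c * norm (x::'a::complex_inner)"
proof -
  have "inner (c *\<^sub>C x) (c *\<^sub>C x) = Re (c * cnj c * cinner x x)"
    by (metis cinner_commute cinner_scaleC_left complex_cnj_mult inner_eq_Re_cinner mult.assoc)
  also have "\<dots> = (cmod c)\<^sup>2 * inner x x"
    by (simp add: complex_norm_square[symmetric] inner_eq_Re_cinner flip: of_real_power)
  finally show ?thesis
    by (simp add: norm_eq_sqrt_inner real_sqrt_mult)
qed

section \<open>Square-summable families of vectors\<close>

text \<open>\<open>('i, 'a) ell2\<close> is the space of square-summable functions from \<open>'i\<close> to \<open>'a\<close>, that is, the
  Hilbert space tensor product of the scalar space of square-summable functions on \<open>'i\<close> with \<open>'a\<close>;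
  the elementary tensor of the basis vector at \<open>i\<close> with \<open>x\<close> is \<open>single i x\<close>.\<close>

typedef (overloaded) ('i, 'a::complex_inner) ell2 =
  "{f :: 'i \<Rightarrow> 'a. (\<lambda>i. (norm (f i))\<^sup>2) summable_on UNIV}"
  morphisms coord Abs_ell2
  by (rule exI[of _ "\<lambda>_. 0"]) simp

setup_lifting type_definition_ell2

lemma sq_sum_add:
  fixes f g :: "'i \<Rightarrow> 'a::real_normed_vector"
  assumes "(\<lambda>i. (norm (f i))\<^sup>2) summable_on A" "(\<lambda>i. (norm (g i))\<^sup>2) summable_on A"
  shows "(\<lambda>i. (norm (f i + g i))\<^sup>2) summable_on A"
proof (rule summable_on_comparison_test)
  show "(\<lambda>i. 2 * ((norm (f i))\<^sup>2 + (norm (g i))\<^sup>2)) summable_on A"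
    by (intro summable_on_cmult_right summable_on_add assms)
  show "(norm (f i + g i))\<^sup>2 \<le> 2 * ((norm (f i))\<^sup>2 + (norm (g i))\<^sup>2)" for i
  proof -
    have "(norm (f i + g i))\<^sup>2 \<le> (norm (f i) + norm (g i))\<^sup>2"
      by (intro power_mono norm_triangle_ineq) auto
    also have "\<dots> \<le> 2 * ((norm (f i))\<^sup>2 + (norm (g i))\<^sup>2)"
      using sum_squares_bound[of "norm (f i)" "norm (g i)"] by (simp add: power2_sum)
    finally show ?thesis .
  qed
qed auto

lemma norm_cinner_le:
  "cmod (cinner x y) \<le> norm x * norm (y::'a::complex_inner)"
proof (cases "cinner x y = 0")
  case False
  define c where "c = cnj (cinner x y) / cmod (cinner x y)"
  have "cmod c = 1" using False by (simp add: c_def norm_divide)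
  have "c * cinner x y = cmod (cinner x y)"
    using False by (simp add: c_def mult.commute[of "cnj _"] complex_norm_square[symmetric]
        power2_eq_square)
  then have "cmod (cinner x y) = inner (c *\<^sub>C x) y"
    by (simp add: inner_eq_Re_cinner cinner_scaleC_left)
  also have "\<dots> \<le> norm (c *\<^sub>C x) * norm y" by (rule norm_cauchy_schwarz)
  finally show ?thesis using \<open>cmod c = 1\<close> by (simp add: norm_scaleC)
qed simp

lemma cinner_summable:
  fixes f g :: "'i \<Rightarrow> 'a::complex_inner"
  assumes "(\<lambda>i. (norm (f i))\<^sup>2) summable_on A" "(\<lambda>i. (norm (g i))\<^sup>2) summable_on A"
  shows "(\<lambda>i. cinner (f i) (g i)) summable_on A"
proof -
  have "(\<lambda>i. norm (cinner (f i) (g i))) summable_on A"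
  proof (rule summable_on_comparison_test)
    show "(\<lambda>i. (norm (f i))\<^sup>2 + (norm (g i))\<^sup>2) summable_on A"
      by (intro summable_on_add assms)
    show "norm (cinner (f i) (g i)) \<le> (norm (f i))\<^sup>2 + (norm (g i))\<^sup>2" for i
      using norm_cinner_le[of "f i" "g i"] sum_squares_bound[of "norm (f i)" "norm (g i)"]
        mult_nonneg_nonneg[OF norm_ge_zero[of "f i"] norm_ge_zero[of "g i"]] by linarith
  qed auto
  then show ?thesis by (rule abs_summable_summable)
qed

lemma coord_summable: "(\<lambda>i. (norm (coord f i))\<^sup>2) summable_on UNIV"
  using coord by auto

lemma coord_cinner_summable: "(\<lambda>i. cinner (coord f i) (coord g i)) summable_on UNIV"
  by (intro cinner_summable coord_summable)

lemma cnj_infsum: "cnj (infsum f A) = infsum (\<lambda>x. cnj (f x)) A"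
  by (rule infsum_cnj[symmetric])

instantiation ell2 :: (type, complex_inner) real_vector
begin

lift_definition zero_ell2 :: "('a, 'b) ell2" is "\<lambda>_. 0" by simp
lift_definition plus_ell2 :: "('a, 'b) ell2 \<Rightarrow> ('a, 'b) ell2 \<Rightarrow> ('a, 'b) ell2"
  is "\<lambda>f g i. f i + g i" by (rule sq_sum_add)
lift_definition uminus_ell2 :: "('a, 'b) ell2 \<Rightarrow> ('a, 'b) ell2" is "\<lambda>f i. - f i" by simp
lift_definition minus_ell2 :: "('a, 'b) ell2 \<Rightarrow> ('a, 'b) ell2 \<Rightarrow> ('a, 'b) ell2"
  is "\<lambda>f g i. f i - g i" using sq_sum_add[of _ _ "\<lambda>i. - (_ i)"] by fastforce
lift_definition scaleR_ell2 :: "real \<Rightarrow> ('a, 'b) ell2 \<Rightarrow> ('a, 'b) ell2"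
  is "\<lambda>r f i. r *\<^sub>R f i" by (simp add: power_mult_distrib summable_on_cmult_right)
instance
  by standard (transfer, simp add: fun_eq_iff algebra_simps)+

end

instantiation ell2 :: (type, complex_inner) complex_inner
begin

lift_definition scaleC_ell2 :: "complex \<Rightarrow> ('a, 'b) ell2 \<Rightarrow> ('a, 'b) ell2"
  is "\<lambda>c f i. c *\<^sub>C f i" by (simp add: norm_scaleC power_mult_distrib summable_on_cmult_right)

definition cinner_ell2 :: "('a, 'b) ell2 \<Rightarrow> ('a, 'b) ell2 \<Rightarrow> complex" where
  "cinner_ell2 f g = (\<Sum>\<^sub>\<infinity>i. cinner (coord f i) (coord g i))"
definition inner_ell2 :: "('a, 'b) ell2 \<Rightarrow> ('a, 'b) ell2 \<Rightarrow> real" where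
  "inner_ell2 f g = Re (cinner f g)"
definition norm_ell2 :: "('a, 'b) ell2 \<Rightarrow> real" where
  "norm_ell2 f = sqrt (inner f f)"
definition dist_ell2 :: "('a, 'b) ell2 \<Rightarrow> ('a, 'b) ell2 \<Rightarrow> real" where
  "dist_ell2 f g = norm (f - g)"
definition sgn_ell2 :: "('a, 'b) ell2 \<Rightarrow> ('a, 'b) ell2" where
  "sgn_ell2 f = scaleR (inverse (norm f)) f"
definition uniformity_ell2 :: "(('a, 'b) ell2 \<times> ('a, 'b) ell2) filter" where
  "uniformity_ell2 = (INF e\<in>{0<..}. principal {(x, y). dist x y < e})"
definition open_ell2 :: "('a, 'b) ell2 set \<Rightarrow> bool" where
  "open_ell2 U = (\<forall>x\<in>U. \<forall>\<^sub>F (x', y) in uniformity. x' = x \<longrightarrow> y \<in> U)"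

lemma inner_ell2_infsum:
  "inner f g = (\<Sum>\<^sub>\<infinity>i. inner (coord f i) (coord (g :: ('a, 'b) ell2) i))"
  unfolding inner_ell2_def cinner_ell2_def
  by (simp add: inner_eq_Re_cinner infsum_Re[OF coord_cinner_summable])

instance
proof
  fix x y z :: "('a, 'b) ell2" and r :: real and c d :: complex
  show "c *\<^sub>C (x + y) = c *\<^sub>C x + c *\<^sub>C y" "(c + d) *\<^sub>C x = c *\<^sub>C x + d *\<^sub>C x"
    "c *\<^sub>C d *\<^sub>C x = (c * d) *\<^sub>C x"
    by (transfer, simp add: fun_eq_iff scaleC_add_right scaleC_add_left scaleC_scaleC)+
  show sc: "r *\<^sub>R x = complex_of_real r *\<^sub>C x" for r and x :: "('a, 'b) ell2"
    by (transfer, simp add: fun_eq_iff scaleR_scaleC)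
  show "sgn x = x /\<^sub>R norm x" by (rule sgn_ell2_def)
  show "dist x y = norm (x - y)" by (rule dist_ell2_def)
  show "uniformity = (INF e\<in>{0<..}. principal {(x, y). dist (x::('a, 'b) ell2) y < e})"
    by (rule uniformity_ell2_def)
  show "open U = (\<forall>x\<in>U. \<forall>\<^sub>F (x', y) in uniformity. x' = x \<longrightarrow> y \<in> U)" for U :: "('a, 'b) ell2 set"
    by (rule open_ell2_def)
  show "norm x = sqrt (inner x x)" by (rule norm_ell2_def)
  show re: "inner x y = Re (cinner x y)" for x y :: "('a, 'b) ell2" by (rule inner_ell2_def)
  show com: "cinner x y = cnj (cinner y x)" for x y :: "('a, 'b) ell2"
    unfolding cinner_ell2_def cnj_infsum
    by (rule infsum_cong) (rule cinner_commute)
  show add: "cinner (x + y) z = cinner x z + cinner y z"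
    unfolding cinner_ell2_def
    by (simp add: plus_ell2.rep_eq cinner_add_left infsum_add coord_cinner_summable)
  show scc: "cinner (c *\<^sub>C x) y = c * cinner x y" for c and x y :: "('a, 'b) ell2"
    unfolding cinner_ell2_def
    by (simp add: scaleC_ell2.rep_eq cinner_scaleC_left infsum_cmult_right coord_cinner_summable)
  show "inner x y = inner y x" using com[of x y] by (simp add: re)
  show "inner (x + y) z = inner x z + inner y z" by (simp add: re add)
  show "inner (r *\<^sub>R x) y = r * inner x y" by (simp add: re sc scc)
  show "0 \<le> inner x x" by (simp add: inner_ell2_infsum infsum_nonneg)
  show "inner x x = 0 \<longleftrightarrow> x = 0"
  proof
    assume "inner x x = 0"
    then have "(\<Sum>\<^sub>\<infinity>i. (norm (coord x i))\<^sup>2) = 0"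
      by (simp add: inner_ell2_infsum power2_norm_eq_inner)
    then have "coord x i = 0" for i
      using nonneg_infsum_le_0D[of "\<lambda>i. (norm (coord x i))\<^sup>2" UNIV i] coord_summable[of x] by simp
    then show "x = 0" by (intro coord_inject[THEN iffD1]) (simp add: fun_eq_iff zero_ell2.rep_eq)
  qed (simp add: inner_ell2_infsum zero_ell2.rep_eq)
qed

end

lemma norm_ell2_infsum: "(norm f)\<^sup>2 = (\<Sum>\<^sub>\<infinity>i. (norm (coord f i))\<^sup>2)"
  by (simp add: power2_norm_eq_inner inner_ell2_infsum)

lemma sum_coord_le: "finite A \<Longrightarrow> (\<Sum>i\<in>A. (norm (coord f i))\<^sup>2) \<le> (norm f)\<^sup>2"
  unfolding norm_ell2_infsum by (rule finite_sum_le_infsum[OF coord_summable]) auto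

lemma norm_coord_le: "norm (coord f i) \<le> norm f"
  by (rule power2_le_imp_le) (use sum_coord_le[of "{i}" f] in simp_all)

instance ell2 :: (type, chilbert_space) chilbert_space
proof
  fix X :: "nat \<Rightarrow> ('a, 'b) ell2"
  assume X: "Cauchy X"
  have "Cauchy (\<lambda>n. coord (X n) i)" for i
  proof (rule CauchyI)
    fix e :: real assume "0 < e"
    then obtain M where M: "\<forall>m\<ge>M. \<forall>n\<ge>M. norm (X m - X n) < e" using CauchyD[OF X] by blast
    have "norm (coord (X m) i - coord (X n) i) \<le> norm (X m - X n)" for m n
      using norm_coord_le[of "X m - X n" i] by (simp add: minus_ell2.rep_eq)
    with M show "\<exists>M. \<forall>m\<ge>M. \<forall>n\<ge>M. norm (coord (X m) i - coord (X n) i) < e"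
      by (meson order_le_less_trans)
  qed
  then have "\<forall>i. \<exists>l. (\<lambda>n. coord (X n) i) \<longlonglongrightarrow> l"
    using Cauchy_convergent convergent_def by blast
  then obtain g where g: "(\<lambda>n. coord (X n) i) \<longlonglongrightarrow> g i" for i
    using choice[of "\<lambda>i l. (\<lambda>n. coord (X n) i) \<longlonglongrightarrow> l"] by blast
  have key: "\<exists>M. \<forall>n\<ge>M. \<forall>A. finite A \<longrightarrow> (\<Sum>i\<in>A. (norm (g i - coord (X n) i))\<^sup>2) \<le> e\<^sup>2"
    if "0 < e" for e
  proof -
    obtain M where M: "\<forall>m\<ge>M. \<forall>n\<ge>M. norm (X m - X n) < e" using CauchyD[OF X \<open>0 < e\<close>] by blast
    have "(\<Sum>i\<in>A. (norm (g i - coord (X n) i))\<^sup>2) \<le> e\<^sup>2" if "n \<ge> M" "finite A" for n A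
    proof (rule LIMSEQ_le_const2)
      show "(\<lambda>m. \<Sum>i\<in>A. (norm (coord (X m) i - coord (X n) i))\<^sup>2)
              \<longlonglongrightarrow> (\<Sum>i\<in>A. (norm (g i - coord (X n) i))\<^sup>2)"
        by (intro tendsto_intros g)
      have "(\<Sum>i\<in>A. (norm (coord (X m) i - coord (X n) i))\<^sup>2) \<le> e\<^sup>2" if "m \<ge> M" for m
      proof -
        have "(\<Sum>i\<in>A. (norm (coord (X m) i - coord (X n) i))\<^sup>2) \<le> (norm (X m - X n))\<^sup>2"
          using sum_coord_le[OF \<open>finite A\<close>, of "X m - X n"] by (simp add: minus_ell2.rep_eq)
        also have "\<dots> \<le> e\<^sup>2" using M \<open>m \<ge> M\<close> \<open>n \<ge> M\<close> by (intro power_mono) (auto simp: less_imp_le)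
        finally show ?thesis .
      qed
      then show "\<exists>N. \<forall>m\<ge>N. (\<Sum>i\<in>A. (norm (coord (X m) i - coord (X n) i))\<^sup>2) \<le> e\<^sup>2" by blast
    qed
    then show ?thesis by blast
  qed
  have diff: "(\<lambda>i. (norm (g i - coord (X n) i))\<^sup>2) summable_on UNIV"
    if "\<forall>A. finite A \<longrightarrow> (\<Sum>i\<in>A. (norm (g i - coord (X n) i))\<^sup>2) \<le> e\<^sup>2" for n e
  proof (rule nonneg_bdd_above_summable_on)
    show "bdd_above (sum (\<lambda>i. (norm (g i - coord (X n) i))\<^sup>2) ` {F. F \<subseteq> UNIV \<and> finite F})"
      by (rule bdd_aboveI2[of _ _ "e\<^sup>2"]) (use that in blast)
  qed simp
  obtain N where "\<forall>A. finite A \<longrightarrow> (\<Sum>i\<in>A. (norm (g i - coord (X N) i))\<^sup>2) \<le> 1\<^sup>2"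
    using key[OF zero_less_one] by blast
  from sq_sum_add[OF diff[OF this] coord_summable[of "X N"]]
  have gs: "(\<lambda>i. (norm (g i))\<^sup>2) summable_on UNIV" by simp
  define G where "G = Abs_ell2 g"
  have G: "coord G = g" unfolding G_def using gs by (simp add: Abs_ell2_inverse)
  have "X \<longlonglongrightarrow> G"
  proof (rule LIMSEQ_I)
    fix e :: real assume "0 < e"
    then obtain M where M: "\<forall>n\<ge>M. \<forall>A. finite A \<longrightarrow>
        (\<Sum>i\<in>A. (norm (g i - coord (X n) i))\<^sup>2) \<le> (e/2)\<^sup>2" using key[of "e/2"] half_gt_zero by blast
    have "norm (X n - G) < e" if "n \<ge> M" for n
    proof -
      have "(norm (G - X n))\<^sup>2 \<le> (e/2)\<^sup>2"
        unfolding norm_ell2_infsum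
      proof (rule infsum_le_finite_sums[OF coord_summable])
        fix A :: "'a set" assume "finite A"
        then show "(\<Sum>i\<in>A. (norm (coord (G - X n) i))\<^sup>2) \<le> (e/2)\<^sup>2"
          using M that by (simp add: minus_ell2.rep_eq G)
      qed
      then have "norm (G - X n) \<le> e/2" by (rule power2_le_imp_le) (use \<open>0 < e\<close> in simp)
      then show ?thesis using \<open>0 < e\<close> by (simp add: norm_minus_commute)
    qed
    then show "\<exists>M. \<forall>n\<ge>M. norm (X n - G) < e" by blast
  qed
  then show "convergent X" by (auto simp: convergent_def)
qed

lift_definition single :: "'i \<Rightarrow> 'a \<Rightarrow> ('i, 'a::complex_inner) ell2" is "\<lambda>i x j. if j = i then x else 0"
proof -
  fix i :: 'i and x :: 'a
  have "(\<lambda>j. (norm (if j = i then x else 0))\<^sup>2) summable_on UNIV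
      \<longleftrightarrow> (\<lambda>j. (norm (if j = i then x else 0))\<^sup>2) summable_on {i}"
    by (rule summable_on_cong_neutral) auto
  then show "(\<lambda>j. (norm (if j = i then x else 0))\<^sup>2) summable_on UNIV" by simp
qed

section \<open>Operators between closed subspaces\<close>

text \<open>A Hilbert space is a closed subspace \<open>M\<close> of a type of class \<^class>\<open>chilbert_space\<close>, possibly
  \<open>UNIV\<close>. An operator is a function on the whole type whose values off its domain are irrelevant, so
  notions that depend on the domain, such as the adjoint, take it as an argument.\<close>

definition csubspace :: "'a::complex_inner set \<Rightarrow> bool" where
  "csubspace M \<longleftrightarrow> 0 \<in> M \<and> (\<forall>x\<in>M. \<forall>y\<in>M. x + y \<in> M) \<and> (\<forall>c. \<forall>x\<in>M. c *\<^sub>C x \<in> M)"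

definition closed_csubspace :: "'a::complex_inner set \<Rightarrow> bool" where
  "closed_csubspace M \<longleftrightarrow> csubspace M \<and> closed M"

definition closed_cspan :: "'a::complex_inner set \<Rightarrow> 'a set" where
  "closed_cspan X = closure (csubspace hull X)"

definition orthocomp_in :: "'a::complex_inner set \<Rightarrow> 'a set \<Rightarrow> 'a set" where
  "orthocomp_in M X = {y \<in> M. \<forall>x\<in>X. cinner y x = 0}"

definition bounded_op :: "'a::complex_inner set \<Rightarrow> 'b::complex_inner set \<Rightarrow> ('a \<Rightarrow> 'b) \<Rightarrow> bool" where
  "bounded_op M N A \<longleftrightarrow> A ` M \<subseteq> N \<and> (\<forall>x\<in>M. \<forall>y\<in>M. A (x + y) = A x + A y) \<and>
     (\<forall>c. \<forall>x\<in>M. A (c *\<^sub>C x) = c *\<^sub>C A x) \<and> (\<exists>C. \<forall>x\<in>M. norm (A x) \<le> C * norm x)"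

definition cadjoint :: "'a::complex_inner set \<Rightarrow> ('a \<Rightarrow> 'b::complex_inner) \<Rightarrow> 'b \<Rightarrow> 'a" where
  "cadjoint M A y = (THE x. x \<in> M \<and> (\<forall>z\<in>M. cinner (A z) y = cinner z x))"

definition positive_op :: "'a::complex_inner set \<Rightarrow> ('a \<Rightarrow> 'a) \<Rightarrow> bool" where
  "positive_op M X \<longleftrightarrow> (\<forall>x\<in>M. cinner (X x) x \<in> \<real>\<^sub>\<ge>\<^sub>0)"

definition positive_sqrt :: "('a::complex_inner \<Rightarrow> 'a) \<Rightarrow> 'a \<Rightarrow> 'a" where
  "positive_sqrt X = (THE R. bounded_op UNIV UNIV R \<and> positive_op UNIV R \<and> R \<circ> R = X)"

definition partial_isometry :: "'a::complex_inner set \<Rightarrow> ('a \<Rightarrow> 'b::complex_inner) \<Rightarrow> bool" where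
  "partial_isometry M A \<longleftrightarrow> (\<forall>x\<in>orthocomp_in M {z \<in> M. A z = 0}. norm (A x) = norm x)"

definition unitary_op :: "'a::complex_inner set \<Rightarrow> 'b::complex_inner set \<Rightarrow> ('a \<Rightarrow> 'b) \<Rightarrow> bool" where
  "unitary_op M N U \<longleftrightarrow> bounded_op M N U \<and> (\<forall>x\<in>M. norm (U x) = norm x) \<and> U ` M = N"

section \<open>Row operators\<close>

text \<open>A row operator on \<open>M\<close> with \<open>m\<close> entries is a family \<open>R\<close> of operators of which only
  \<open>R 1, \<dots>, R m\<close> are relevant; a tuple of row operators is a doubly indexed family \<open>T i s\<close> with
  \<open>i \<in> {1..k}\<close> and \<open>s \<in> {1..n i}\<close>.\<close>

definition cp_map :: "'a::complex_inner set \<Rightarrow> nat \<Rightarrow> (nat \<Rightarrow> 'a \<Rightarrow> 'a) \<Rightarrow> ('a \<Rightarrow> 'a) \<Rightarrow> 'a \<Rightarrow> 'a" where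
  "cp_map M m R X = (\<lambda>x. \<Sum>s=1..m. R s (X (cadjoint M (R s) x)))"

definition id_minus_cp_map ::
    "'a::complex_inner set \<Rightarrow> nat \<Rightarrow> (nat \<Rightarrow> 'a \<Rightarrow> 'a) \<Rightarrow> ('a \<Rightarrow> 'a) \<Rightarrow> 'a \<Rightarrow> 'a" where
  "id_minus_cp_map M m R X = (\<lambda>x. X x - cp_map M m R X x)"

definition row_contraction :: "'a::complex_inner set \<Rightarrow> nat \<Rightarrow> (nat \<Rightarrow> 'a \<Rightarrow> 'a) \<Rightarrow> bool" where
  "row_contraction M m R \<longleftrightarrow>
     (\<forall>s\<in>{1..m}. bounded_op M M (R s)) \<and> positive_op M (id_minus_cp_map M m R id)"

definition row_isometry :: "'a::complex_inner set \<Rightarrow> nat \<Rightarrow> (nat \<Rightarrow> 'a \<Rightarrow> 'a) \<Rightarrow> bool" where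
  "row_isometry M m R \<longleftrightarrow>
     (\<forall>s\<in>{1..m}. bounded_op M M (R s)) \<and>
     (\<forall>x. (\<forall>s\<in>{1..m}. x s \<in> M) \<longrightarrow> (norm (\<Sum>s=1..m. R s (x s)))\<^sup>2 = (\<Sum>s=1..m. (norm (x s))\<^sup>2))"

definition word_op :: "(nat \<Rightarrow> 'a \<Rightarrow> 'a) \<Rightarrow> nat list \<Rightarrow> 'a \<Rightarrow> 'a" where
  "word_op R w = foldr (\<lambda>s A. R s \<circ> A) w id"

definition doubly_commuting :: "nat \<Rightarrow> (nat \<Rightarrow> nat) \<Rightarrow> (nat \<Rightarrow> nat \<Rightarrow> nat \<Rightarrow> nat \<Rightarrow> complex) \<Rightarrow>
    'a::complex_inner set \<Rightarrow> (nat \<Rightarrow> nat \<Rightarrow> 'a \<Rightarrow> 'a) \<Rightarrow> bool" where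
  "doubly_commuting k n lam M V \<longleftrightarrow>
     (\<forall>i\<in>{1..k}. row_isometry M (n i) (V i)) \<and>
     (\<forall>i\<in>{1..k}. \<forall>j\<in>{1..k}. i \<noteq> j \<longrightarrow> (\<forall>s\<in>{1..n i}. \<forall>t\<in>{1..n j}. \<forall>x\<in>M.
        cadjoint M (V i s) (V j t x) = cnj (lam i j s t) *\<^sub>C V j t (cadjoint M (V i s) x)))"

section \<open>The regular polyball\<close>

definition defect :: "nat \<Rightarrow> (nat \<Rightarrow> nat) \<Rightarrow> (nat \<Rightarrow> nat \<Rightarrow> 'h \<Rightarrow> 'h) \<Rightarrow> 'h \<Rightarrow> 'h::complex_inner" where
  "defect k n T = fold (\<lambda>i. id_minus_cp_map UNIV (n i) (T i)) [1..<Suc k] id"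

definition polyball :: "nat \<Rightarrow> (nat \<Rightarrow> nat) \<Rightarrow> (nat \<Rightarrow> nat \<Rightarrow> nat \<Rightarrow> nat \<Rightarrow> complex) \<Rightarrow>
    (nat \<Rightarrow> nat \<Rightarrow> 'h \<Rightarrow> 'h::complex_inner) set" where
  "polyball k n lam = {T.
     (\<forall>i\<in>{1..k}. row_contraction UNIV (n i) (T i)) \<and>
     (\<forall>i\<in>{1..k}. \<forall>j\<in>{1..k}. i \<noteq> j \<longrightarrow> (\<forall>s\<in>{1..n i}. \<forall>t\<in>{1..n j}. \<forall>h.
        T i s (T j t h) = lam i j s t *\<^sub>C T j t (T i s h))) \<and>
     (\<forall>r. 0 \<le> r \<and> r < 1 \<longrightarrow> positive_op UNIV (defect k n (\<lambda>i s h. r *\<^sub>R T i s h)))}"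

definition pure_tuple :: "nat \<Rightarrow> (nat \<Rightarrow> nat) \<Rightarrow> (nat \<Rightarrow> nat \<Rightarrow> 'h \<Rightarrow> 'h::complex_inner) \<Rightarrow> bool" where
  "pure_tuple k n T \<longleftrightarrow>
     (\<forall>i\<in>{1..k}. \<forall>x y. (\<lambda>p. cinner ((cp_map UNIV (n i) (T i) ^^ p) id x) y) \<longlonglongrightarrow> 0)"

section \<open>The universal model\<close>

text \<open>A tuple of words \<open>(\<alpha>\<^sub>1, \<dots>, \<alpha>\<^sub>k)\<close> is a function \<open>\<alpha>\<close> that is empty outside \<open>{1..k}\<close>. The
  tensor product of the square-summable functions on \<open>multiwords k n\<close> with \<open>E\<close> is \<open>fock k n E\<close>.\<close>

type_synonym multiword = "nat \<Rightarrow> nat list"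

definition multiwords :: "nat \<Rightarrow> (nat \<Rightarrow> nat) \<Rightarrow> multiword set" where
  "multiwords k n = {\<alpha>. (\<forall>i\<in>{1..k}. set (\<alpha> i) \<subseteq> {1..n i}) \<and> (\<forall>i. i \<notin> {1..k} \<longrightarrow> \<alpha> i = [])}"

definition fock :: "nat \<Rightarrow> (nat \<Rightarrow> nat) \<Rightarrow> 'e::complex_inner set \<Rightarrow> (multiword, 'e) ell2 set" where
  "fock k n E = {f. \<forall>\<alpha>. (\<alpha> \<in> multiwords k n \<longrightarrow> coord f \<alpha> \<in> E) \<and> (\<alpha> \<notin> multiwords k n \<longrightarrow> coord f \<alpha> = 0)}"

definition word_coeff :: "(nat \<Rightarrow> nat \<Rightarrow> nat \<Rightarrow> nat \<Rightarrow> complex) \<Rightarrow> nat \<Rightarrow> nat \<Rightarrow> nat \<Rightarrow> nat list \<Rightarrow> complex" where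
  "word_coeff lam i j s \<beta> = prod_list (map (lam i j s) \<beta>)"

definition shift_coeff :: "(nat \<Rightarrow> nat \<Rightarrow> nat \<Rightarrow> nat \<Rightarrow> complex) \<Rightarrow> nat \<Rightarrow> nat \<Rightarrow> multiword \<Rightarrow> complex" where
  "shift_coeff lam i s \<alpha> = (\<Prod>j=1..<i. word_coeff lam i j s (\<alpha> j))"

text \<open>\<open>model lam i s\<close> is \<open>S\<^sub>i\<^sub>,\<^sub>s \<otimes> I\<close> in coordinates; lemma \<open>model_single\<close> below gives its action on
  elementary tensors.\<close>

definition model :: "(nat \<Rightarrow> nat \<Rightarrow> nat \<Rightarrow> nat \<Rightarrow> complex) \<Rightarrow> nat \<Rightarrow> nat \<Rightarrow>
    (multiword, 'e) ell2 \<Rightarrow> (multiword, 'e::complex_inner) ell2" where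
  "model lam i s f = Abs_ell2 (\<lambda>\<alpha>. case \<alpha> i of [] \<Rightarrow> 0 | t # \<beta> \<Rightarrow>
     if t = s then shift_coeff lam i s (\<alpha>(i := \<beta>)) *\<^sub>C coord f (\<alpha>(i := \<beta>)) else 0)"

lemma model_single:
  "model lam i s (single \<alpha> x) = single (\<alpha>(i := s # \<alpha> i)) (shift_coeff lam i s \<alpha> *\<^sub>C x)"
proof -
  have "(\<lambda>\<gamma>. case \<gamma> i of [] \<Rightarrow> 0 | t # \<beta> \<Rightarrow>
      if t = s then shift_coeff lam i s (\<gamma>(i := \<beta>)) *\<^sub>C coord (single \<alpha> x) (\<gamma>(i := \<beta>)) else 0)
    = coord (single (\<alpha>(i := s # \<alpha> i)) (shift_coeff lam i s \<alpha> *\<^sub>C x))"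
  proof (rule ext, goal_cases)
    case (1 \<gamma>)
    show ?case
    proof (cases "\<gamma> i")
      case (Cons t \<beta>)
      then have "\<gamma> = \<alpha>(i := s # \<alpha> i) \<longleftrightarrow> t = s \<and> \<gamma>(i := \<beta>) = \<alpha>"
        by (auto simp: fun_eq_iff)
      with Cons show ?thesis by (auto simp: single.rep_eq)
    qed (auto simp: single.rep_eq)
  qed
  then show ?thesis unfolding model_def by (simp add: coord_inverse)
qed

definition multi_model :: "nat \<Rightarrow> (nat \<Rightarrow> nat \<Rightarrow> nat \<Rightarrow> nat \<Rightarrow> complex) \<Rightarrow> multiword \<Rightarrow>
    (multiword, 'e) ell2 \<Rightarrow> (multiword, 'e::complex_inner) ell2" where
  "multi_model k lam \<alpha> f = foldr (\<lambda>i. word_op (model lam i) (\<alpha> i)) [1..<Suc k] f"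

definition model_defect :: "nat \<Rightarrow> (nat \<Rightarrow> nat) \<Rightarrow> (nat \<Rightarrow> nat \<Rightarrow> nat \<Rightarrow> nat \<Rightarrow> complex) \<Rightarrow>
    'e::complex_inner set \<Rightarrow> ((multiword, 'e) ell2 \<Rightarrow> (multiword, 'e) ell2) \<Rightarrow>
    (multiword, 'e) ell2 \<Rightarrow> (multiword, 'e) ell2" where
  "model_defect k n lam E X = foldr (\<lambda>i. id_minus_cp_map (fock k n E) (n i) (model lam i)) [1..<Suc k] X"

section \<open>Berezin kernel, multi-analytic operators, characteristic functions\<close>

definition defect_space :: "nat \<Rightarrow> (nat \<Rightarrow> nat) \<Rightarrow> (nat \<Rightarrow> nat \<Rightarrow> 'h \<Rightarrow> 'h::complex_inner) \<Rightarrow> 'h set" where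
  "defect_space k n T = closure (range (defect k n T))"

definition berezin :: "nat \<Rightarrow> (nat \<Rightarrow> nat) \<Rightarrow> (nat \<Rightarrow> nat \<Rightarrow> 'h \<Rightarrow> 'h) \<Rightarrow>
    'h \<Rightarrow> (multiword, 'h::complex_inner) ell2" where
  "berezin k n T h = (\<Sum>\<^sub>\<infinity>\<beta>\<in>multiwords k n. single \<beta> (positive_sqrt (defect k n T)
     (fold (\<lambda>i. cadjoint UNIV (word_op (T i) (\<beta> i))) [1..<Suc k] h)))"

definition multi_analytic :: "nat \<Rightarrow> (nat \<Rightarrow> nat) \<Rightarrow> (nat \<Rightarrow> nat \<Rightarrow> nat \<Rightarrow> nat \<Rightarrow> complex) \<Rightarrow>
    'e::complex_inner set \<Rightarrow> 'f::complex_inner set \<Rightarrow>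
    ((multiword, 'e) ell2 \<Rightarrow> (multiword, 'f) ell2) \<Rightarrow> bool" where
  "multi_analytic k n lam E K A \<longleftrightarrow> bounded_op (fock k n E) (fock k n K) A \<and>
     (\<forall>i\<in>{1..k}. \<forall>s\<in>{1..n i}. \<forall>f\<in>fock k n E. A (model lam i s f) = model lam i s (A f))"

definition inner_multi_analytic :: "nat \<Rightarrow> (nat \<Rightarrow> nat) \<Rightarrow> (nat \<Rightarrow> nat \<Rightarrow> nat \<Rightarrow> nat \<Rightarrow> complex) \<Rightarrow>
    'e::complex_inner set \<Rightarrow> 'f::complex_inner set \<Rightarrow>
    ((multiword, 'e) ell2 \<Rightarrow> (multiword, 'f) ell2) \<Rightarrow> bool" where
  "inner_multi_analytic k n lam E K A \<longleftrightarrow>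
     multi_analytic k n lam E K A \<and> partial_isometry (fock k n E) A"

text \<open>The type argument of the next two definitions is the type whose closed subspaces the
  existentially quantified auxiliary Hilbert space ranges over.\<close>

definition beurling_type :: "'e::chilbert_space itself \<Rightarrow> nat \<Rightarrow> (nat \<Rightarrow> nat) \<Rightarrow>
    (nat \<Rightarrow> nat \<Rightarrow> nat \<Rightarrow> nat \<Rightarrow> complex) \<Rightarrow> 'f::chilbert_space set \<Rightarrow> (multiword, 'f) ell2 set \<Rightarrow> bool" where
  "beurling_type _ k n lam K M \<longleftrightarrow> (\<exists>(L :: 'e set) \<Psi>. closed_csubspace L \<and>
     inner_multi_analytic k n lam L K \<Psi> \<and> M = \<Psi> ` fock k n L)"

definition admits_characteristic_function :: "'e::chilbert_space itself \<Rightarrow> nat \<Rightarrow> (nat \<Rightarrow> nat) \<Rightarrow>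
    (nat \<Rightarrow> nat \<Rightarrow> nat \<Rightarrow> nat \<Rightarrow> complex) \<Rightarrow> (nat \<Rightarrow> nat \<Rightarrow> 'h \<Rightarrow> 'h::chilbert_space) \<Rightarrow> bool" where
  "admits_characteristic_function _ k n lam T \<longleftrightarrow> (\<exists>(E :: 'e set) \<Psi>. closed_csubspace E \<and>
     multi_analytic k n lam E (defect_space k n T) \<Psi> \<and>
     (\<forall>f\<in>fock k n (defect_space k n T).
        berezin k n T (cadjoint UNIV (berezin k n T) f) + \<Psi> (cadjoint (fock k n E) \<Psi> f) = f))"

text \<open>HOL cannot quantify existentially over types. Auxiliary Hilbert spaces therefore range over
  the closed subspaces of the following type: it contains an arbitrary Hilbert space \<open>'x\<close>,
  so no auxiliary space is excluded by its size, and a copy of the Fock space over \<open>'h\<close>, so it is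
  large enough for the spaces whose existence is asserted about tuples on \<open>'h\<close>.\<close>

type_synonym ('x, 'h) universe = "'x \<times> (multiword, 'h) ell2"

end

theory Submission
  imports Defs
begin

text \<open>Writing \<open>q(x) = \<langle>Xx, x\<rangle>\<close>, the map \<open>X \<mapsto> \<Phi>\<^sub>T(X)\<close> becomes \<open>q \<mapsto> \<Sum>\<^sub>s q(T\<^sub>s\<^sup>* \<cdot>)\<close>, and
  since \<open>\<bar>\<lambda>\<bar> = 1\<close> these operations commute on phase invariant \<open>q\<close>. Telescoping them gives
  \<open>\<Sum>\<^sub>\<beta> \<langle>\<Delta>(X) S\<^sub>\<beta>\<^sup>*f, S\<^sub>\<beta>\<^sup>*f\<rangle> = \<langle>Xf, f\<rangle>\<close> for the (pure) model; with \<open>X = I - K\<^sub>TK\<^sub>T\<^sup>*\<close> and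
  \<open>\<Delta>(X) \<ge> 0\<close> the map \<open>f \<mapsto> (\<Delta>(X)\<^sup>1\<^sup>/\<^sup>2 S\<^sub>\<beta>\<^sup>*f)\<^sub>\<beta>\<close> is then \<open>\<Psi>\<^sup>*\<close> for a characteristic function
  \<open>\<Psi>\<close>, and conversely \<open>\<Delta>(\<Psi>\<Psi>\<^sup>*) = \<Psi>\<Delta>(I)\<Psi>\<^sup>* \<ge> 0\<close>. If \<open>T\<close> is pure, \<open>K\<^sub>T\<close> is an isometry, so \<open>X\<close> is
  the projection onto \<open>(K\<^sub>TH)\<^sup>\<bottom>\<close>: a factorization \<open>X = \<Psi>\<Psi>\<^sup>*\<close> means that \<open>\<Psi>\<close> is inner with this
  range, and for doubly commuting compressions \<open>\<Delta>(X)\<close> is a product of commuting projections. In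
  (iv) the defect of \<open>T\<close> is the compression of the vacuum projection, which identifies \<open>D(T)\<close> with
  a subspace of \<open>D\<close> and \<open>K\<^sub>T\<close> with the given embedding; conversely, for \<open>D = D(T)\<close> a vector
  orthogonal to all \<open>S\<^sub>\<alpha>K\<^sub>TH\<close> has vacuum coefficients along its orbit that are orthogonal to
  \<open>\<Delta>\<^sub>T(I)\<^sup>1\<^sup>/\<^sup>2H\<close>, hence vanishes, which is the span condition.\<close>

section \<open>Closed subspaces of complex Hilbert spaces\<close>

text \<open>Passing from operators to forms loses nothing: over the complex numbers a bounded
  operator with vanishing form is zero (\<open>bounded_op_eq_zero\<close>). Without purity the
  delicate point is convergence of the kernel sums. The sum over words shorter than p is the form of
  the product of the factors id - \<Phi>_i^p. To bound it by the squared norm, every partial product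
  of the id - \<Phi>_i must be positive, not only the full defect. The model is pure, so there
  positivity of \<Delta>(X) alone suffices. The products for \<open>T\<close> and for the model are
  composed in opposite orders, which is reconciled on phase invariant forms. The root of \<Delta>(X)
  takes values in the Fock space over H, so a copy of that space serves as coefficient space of
  \<Psi>; for (iv) a copy of D(T) is enough.\<close>

lemma cinner_zero_left [simp]: "cinner 0 (y::'a::complex_inner) = 0"
  using cinner_scaleC_left[of 0 0 y] by simp

lemma cinner_zero_right [simp]: "cinner (x::'a::complex_inner) 0 = 0"
  using cinner_commute[of x 0] by simp

lemma cinner_add_right: "cinner (x::'a::complex_inner) (y + z) = cinner x y + cinner x z"
  by (metis cinner_add_left cinner_commute complex_cnj_add)

lemma cinner_scaleC_right: "cinner (x::'a::complex_inner) (c *\<^sub>C y) = cnj c * cinner x y"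
  by (metis cinner_scaleC_left cinner_commute complex_cnj_mult)

lemma scaleC_minus_one: "(-1) *\<^sub>C x = - (x::'a::complex_inner)"
  using scaleR_scaleC[of "-1" x] by simp

lemma cinner_minus_left: "cinner (- x) (y::'a::complex_inner) = - cinner x y"
  by (metis cinner_scaleC_left mult_minus1 scaleC_minus_one)

lemma cinner_minus_right: "cinner (x::'a::complex_inner) (- y) = - cinner x y"
  by (metis cinner_commute cinner_minus_left complex_cnj_minus)

lemma cinner_diff_left: "cinner (x - y) (z::'a::complex_inner) = cinner x z - cinner y z"
  by (metis cinner_add_left cinner_minus_left diff_conv_add_uminus)

lemma cinner_diff_right: "cinner (z::'a::complex_inner) (x - y) = cinner z x - cinner z y"
  by (metis cinner_add_right cinner_minus_right diff_conv_add_uminus)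

lemma cinner_sum_left: "cinner (sum f S) (z::'a::complex_inner) = (\<Sum>s\<in>S. cinner (f s) z)"
  by (induction S rule: infinite_finite_induct) (auto simp: cinner_add_left)

lemma cinner_sum_right: "cinner (z::'a::complex_inner) (sum f S) = (\<Sum>s\<in>S. cinner z (f s))"
  by (induction S rule: infinite_finite_induct) (auto simp: cinner_add_right)

lemmas cinner_simps = cinner_add_left cinner_add_right cinner_scaleC_left cinner_scaleC_right
  cinner_minus_left cinner_minus_right cinner_diff_left cinner_diff_right

lemma scaleC_minus_right: "c *\<^sub>C (- x) = - (c *\<^sub>C (x::'a::complex_inner))"
  by (metis add.right_inverse add_eq_0_iff scaleC_add_right scaleC_zero_right)

lemma scaleC_diff_right: "c *\<^sub>C (x - y) = c *\<^sub>C x - c *\<^sub>C (y::'a::complex_inner)"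
  by (metis diff_conv_add_uminus scaleC_add_right scaleC_minus_right)

lemma scaleC_sum_right: "c *\<^sub>C (sum f S) = (\<Sum>s\<in>S. c *\<^sub>C (f s::'a::complex_inner))"
  by (induction S rule: infinite_finite_induct) (auto simp: scaleC_add_right)

lemma cinner_self: "cinner x x = of_real ((norm (x::'a::complex_inner))\<^sup>2)"
proof -
  have "Im (cinner x x) = 0"
    using arg_cong[OF cinner_commute[of x x], of Im] by simp
  moreover have "Re (cinner x x) = (norm x)\<^sup>2"
    by (simp add: inner_eq_Re_cinner[symmetric] power2_norm_eq_inner)
  ultimately show ?thesis by (simp add: complex_eq_iff)
qed

lemma cinner_self_eq_0: "cinner x x = 0 \<longleftrightarrow> (x::'a::complex_inner) = 0"
  by (simp add: cinner_self)

lemma cinner_zero_comm: "cinner x y = 0 \<longleftrightarrow> cinner y (x::'a::complex_inner) = 0"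
  by (metis cinner_commute complex_cnj_zero)

text \<open>The imaginary part of \<open>cinner u v\<close> is the real inner product of
  \<open>u\<close> with \<open>\<i> *\<^sub>C v\<close>, so continuity of \<open>inner\<close>
  settles both parts.\<close>

lemma tendsto_cinner:
  fixes f g :: "'b \<Rightarrow> 'a::complex_inner"
  assumes "(f \<longlongrightarrow> x) F" "(g \<longlongrightarrow> y) F"
  shows "((\<lambda>i. cinner (f i) (g i)) \<longlongrightarrow> cinner x y) F"
proof -
  have eq: "cinner u v = Complex (inner u v) (inner u (\<i> *\<^sub>C v))" for u v :: 'a
    by (simp add: complex_eq_iff inner_eq_Re_cinner cinner_scaleC_right)
  have "((\<lambda>i. \<i> *\<^sub>C g i) \<longlongrightarrow> \<i> *\<^sub>C y) F"
  proof (rule tendstoI)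
    fix e :: real assume "e > 0"
    then show "\<forall>\<^sub>F i in F. dist (\<i> *\<^sub>C g i) (\<i> *\<^sub>C y) < e"
      using tendstoD[OF assms(2)] by (simp add: dist_norm norm_scaleC flip: scaleC_diff_right)
  qed
  then show ?thesis unfolding eq
    by (intro tendsto_Complex tendsto_inner assms)
qed

lemma csubspaceD:
  assumes "csubspace M"
  shows "0 \<in> M" "x \<in> M \<Longrightarrow> y \<in> M \<Longrightarrow> x + y \<in> M" "x \<in> M \<Longrightarrow> c *\<^sub>C x \<in> M"
    "x \<in> M \<Longrightarrow> - x \<in> M" "x \<in> M \<Longrightarrow> y \<in> M \<Longrightarrow> x - y \<in> M"
proof -
  show *: "0 \<in> M" "x \<in> M \<Longrightarrow> y \<in> M \<Longrightarrow> x + y \<in> M" "x \<in> M \<Longrightarrow> c *\<^sub>C x \<in> M" for x y c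
    using assms by (auto simp: csubspace_def)
  show **: "x \<in> M \<Longrightarrow> - x \<in> M" for x using *(3)[of x "-1"] by (simp add: scaleC_minus_one)
  show "x \<in> M \<Longrightarrow> y \<in> M \<Longrightarrow> x - y \<in> M" using *(2)[of x "- y"] ** by simp
qed

lemma csubspace_sum: "csubspace M \<Longrightarrow> (\<And>s. s \<in> S \<Longrightarrow> f s \<in> M) \<Longrightarrow> sum f S \<in> M"
  by (induction S rule: infinite_finite_induct) (auto simp: csubspaceD)

lemma csubspace_UNIV [simp]: "csubspace UNIV" by (simp add: csubspace_def)

lemma closed_csubspace_UNIV [simp]: "closed_csubspace UNIV" by (simp add: closed_csubspace_def)

lemma closed_csubspaceD: "closed_csubspace M \<Longrightarrow> csubspace M" "closed_csubspace M \<Longrightarrow> closed M"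
  by (auto simp: closed_csubspace_def)

lemma continuous_scaleC: "continuous_on UNIV (\<lambda>x::'a::complex_inner. c *\<^sub>C x)"
proof -
  have "bounded_linear (\<lambda>x::'a. c *\<^sub>C x)"
    by (rule bounded_linear_intro[of _ "cmod c"])
      (auto simp: scaleC_add_right scaleR_scaleC scaleC_scaleC mult.commute norm_scaleC)
  then show ?thesis by (simp add: linear_continuous_on)
qed

lemma closed_csubspace_closure:
  fixes M :: "'a::complex_inner set"
  assumes M: "csubspace M" shows "closed_csubspace (closure M)"
  unfolding closed_csubspace_def csubspace_def
proof (intro conjI ballI allI)
  show "0 \<in> closure M" using csubspaceD(1)[OF M] closure_subset by blast
  show "x + y \<in> closure M" if xy: "x \<in> closure M" "y \<in> closure M" for x y
  proof -
    obtain f where "\<forall>n::nat. f n \<in> M" "f \<longlonglongrightarrow> x"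
      using xy(1) unfolding closure_sequential by blast
    moreover obtain g where "\<forall>n::nat. g n \<in> M" "g \<longlonglongrightarrow> y"
      using xy(2) unfolding closure_sequential by blast
    ultimately show ?thesis unfolding closure_sequential
      by (intro exI[of _ "\<lambda>n. f n + g n"] conjI allI tendsto_add csubspaceD[OF M]) auto
  qed
  show "c *\<^sub>C x \<in> closure M" if x: "x \<in> closure M" for x c
  proof -
    obtain f where f: "\<forall>n::nat. f n \<in> M" "f \<longlonglongrightarrow> x"
      using x unfolding closure_sequential by blast
    have "(\<lambda>n. c *\<^sub>C f n) \<longlonglongrightarrow> c *\<^sub>C x"
      using continuous_on_tendsto_compose[OF continuous_scaleC f(2)] by simp
    with f show ?thesis unfolding closure_sequential
      by (intro exI[of _ "\<lambda>n. c *\<^sub>C f n"] conjI allI csubspaceD[OF M]) auto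
  qed
qed simp

lemma closed_csubspace_orthocomp_in:
  assumes "closed_csubspace M"
  shows "closed_csubspace (orthocomp_in M X)"
  unfolding closed_csubspace_def
proof
  show "csubspace (orthocomp_in M X)"
    using closed_csubspaceD(1)[OF assms]
    by (auto simp: csubspace_def orthocomp_in_def cinner_simps)
  show "closed (orthocomp_in M X)"
    unfolding closed_sequential_limits
  proof (intro allI impI, elim conjE)
    fix f l assume f: "\<forall>n. f n \<in> orthocomp_in M X" "f \<longlonglongrightarrow> l"
    have "l \<in> M" using f closed_csubspaceD(2)[OF assms] unfolding orthocomp_in_def closed_sequential_limits
      by blast
    moreover have "cinner l x = 0" if "x \<in> X" for x
    proof (rule LIMSEQ_unique)
      show "(\<lambda>n. cinner (f n) x) \<longlonglongrightarrow> cinner l x" by (intro tendsto_cinner f tendsto_const)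
      show "(\<lambda>n. cinner (f n) x) \<longlonglongrightarrow> 0" using f(1) that by (simp add: orthocomp_in_def)
    qed
    ultimately show "l \<in> orthocomp_in M X" by (simp add: orthocomp_in_def)
  qed
qed

lemma orthocomp_in_closure: "orthocomp_in M (closure X) = orthocomp_in M (X::'a::complex_inner set)"
proof
  show "orthocomp_in M X \<subseteq> orthocomp_in M (closure X)"
  proof
    fix y assume y: "y \<in> orthocomp_in M X"
    have "cinner y x = 0" if "x \<in> closure X" for x
    proof -
      obtain f where f: "\<forall>n::nat. f n \<in> X" "f \<longlonglongrightarrow> x" using \<open>x \<in> closure X\<close>
        unfolding closure_sequential by blast
      have "(\<lambda>n. cinner y (f n)) \<longlonglongrightarrow> cinner y x" by (intro tendsto_cinner f tendsto_const)
      moreover have "(\<lambda>n. cinner y (f n)) \<longlonglongrightarrow> 0" using y f by (simp add: orthocomp_in_def)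
      ultimately show ?thesis by (rule LIMSEQ_unique)
    qed
    with y show "y \<in> orthocomp_in M (closure X)" by (simp add: orthocomp_in_def)
  qed
qed (use closure_subset in \<open>force simp: orthocomp_in_def\<close>)

lemma parallelogram:
  fixes a b :: "'a::real_inner"
  shows "(norm (a + b))\<^sup>2 + (norm (a - b))\<^sup>2 = 2 * (norm a)\<^sup>2 + 2 * (norm b)\<^sup>2"
  by (simp add: power2_norm_eq_inner inner_simps inner_commute)

text \<open>A minimising sequence for the squared distance is Cauchy by the parallelogram law, since
  midpoints of its members stay in \<open>M\<close>. At the minimum the residual has no component
  along \<open>M\<close>.\<close>

theorem orthogonal_projection_exists:
  fixes M :: "'a::chilbert_space set"
  assumes M: "closed_csubspace M"
  shows "\<exists>p\<in>M. \<forall>m\<in>M. cinner (x - p) m = 0"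
proof -
  note sub = csubspaceD[OF closed_csubspaceD(1)[OF M]]
  define d where "d = Inf ((\<lambda>m. (norm (x - m))\<^sup>2) ` M)"
  have bdd: "bdd_below ((\<lambda>m. (norm (x - m))\<^sup>2) ` M)" by (rule bdd_belowI2[of _ 0]) simp
  have ne: "(\<lambda>m. (norm (x - m))\<^sup>2) ` M \<noteq> {}" using sub(1) by blast
  have d_le: "d \<le> (norm (x - m))\<^sup>2" if "m \<in> M" for m
    unfolding d_def by (rule cInf_lower[OF _ bdd]) (use that in blast)
  have "\<exists>m\<in>M. (norm (x - m))\<^sup>2 < d + inverse (Suc i)" for i
  proof -
    have "d < d + inverse (Suc i)" by simp
    then show ?thesis unfolding d_def by (subst (asm) cInf_less_iff[OF ne bdd]) auto
  qed
  then obtain f where f: "\<And>i. f i \<in> M" "\<And>i. (norm (x - f i))\<^sup>2 < d + inverse (Suc i)"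
    by metis
  have fd: "(norm (f i - f j))\<^sup>2 \<le> 2 * inverse (Suc i) + 2 * inverse (Suc j)" for i j
  proof -
    have "d \<le> (norm (x - (1/2) *\<^sub>R (f i + f j)))\<^sup>2"
      by (intro d_le) (auto simp: scaleR_scaleC intro!: sub f)
    also have "x - (1/2) *\<^sub>R (f i + f j) = (1/2) *\<^sub>R ((x - f i) + (x - f j))"
      by (simp add: scaleR_right_distrib scaleR_right_diff_distrib flip: scaleR_left_distrib)
    finally have "4 * d \<le> (norm ((x - f i) + (x - f j)))\<^sup>2" by (simp add: power_mult_distrib power2_eq_square)
    moreover have "(norm ((x - f i) + (x - f j)))\<^sup>2 + (norm ((x - f i) - (x - f j)))\<^sup>2
        = 2 * (norm (x - f i))\<^sup>2 + 2 * (norm (x - f j))\<^sup>2" by (rule parallelogram)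
    moreover have "norm ((x - f i) - (x - f j)) = norm (f i - f j)" by (simp add: norm_minus_commute)
    ultimately show ?thesis using f(2)[of i] f(2)[of j] by simp
  qed
  have "Cauchy f"
  proof (rule CauchyI)
    fix e :: real assume e: "e > 0"
    then obtain N where N: "inverse (Suc N) < e\<^sup>2 / 4" using reals_Archimedean[of "e\<^sup>2/4"] by auto
    have "norm (f i - f j) < e" if "i \<ge> N" "j \<ge> N" for i j
    proof (rule power2_less_imp_less)
      have "inverse (real (Suc i)) \<le> inverse (Suc N)" "inverse (real (Suc j)) \<le> inverse (Suc N)"
        using that by (auto intro!: le_imp_inverse_le)
      then show "(norm (f i - f j))\<^sup>2 < e\<^sup>2" using fd[of i j] N by linarith
    qed (use e in simp)
    then show "\<exists>N. \<forall>m\<ge>N. \<forall>n\<ge>N. norm (f m - f n) < e" by blast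
  qed
  then obtain p where p: "f \<longlonglongrightarrow> p" using Cauchy_convergent convergent_def by blast
  have pM: "p \<in> M" using p f(1) closed_csubspaceD(2)[OF M] by (auto simp: closed_sequential_limits)
  have pd: "(norm (x - p))\<^sup>2 \<le> d"
  proof (rule LIMSEQ_le)
    show "(\<lambda>i. (norm (x - f i))\<^sup>2) \<longlonglongrightarrow> (norm (x - p))\<^sup>2" by (intro tendsto_intros p)
    show "(\<lambda>i. d + inverse (Suc i)) \<longlonglongrightarrow> d" using tendsto_add[OF tendsto_const LIMSEQ_inverse_real_of_nat] by auto
    show "\<exists>N. \<forall>n\<ge>N. (norm (x - f n))\<^sup>2 \<le> d + inverse (Suc n)" using f(2) less_imp_le by blast
  qed
  have "cinner (x - p) m = 0" if m: "m \<in> M" for m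
  proof (rule ccontr)
    assume c: "cinner (x - p) m \<noteq> 0"
    then have m0: "m \<noteq> 0" by auto
    \<comment> \<open>The best multiple of \<open>m\<close>: moving \<open>p\<close> by it lowers
      the squared distance by the squared modulus of the inner product divided by the squared norm
      of \<open>m\<close>.\<close>
    define c where "c = cinner (x - p) m / of_real ((norm m)\<^sup>2)"
    have 1: "d \<le> (norm (x - (p + c *\<^sub>C m)))\<^sup>2" by (intro d_le sub pM m)
    have "complex_of_real ((norm (x - (p + c *\<^sub>C m)))\<^sup>2) = cinner ((x - p) - c *\<^sub>C m) ((x - p) - c *\<^sub>C m)"
      by (simp add: cinner_self algebra_simps)
    also have "\<dots> = of_real ((norm (x - p))\<^sup>2) - cinner (x - p) m * cnj (cinner (x-p) m) / of_real ((norm m)\<^sup>2)"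
    proof -
      have "cinner (u - e *\<^sub>C m) (u - e *\<^sub>C m)
          = of_real ((norm u)\<^sup>2) - cinner u m * cnj (cinner u m) / of_real ((norm m)\<^sup>2)"
        if "e = cinner u m / of_real ((norm m)\<^sup>2)" for u e
      proof -
        have "cinner (u - e *\<^sub>C m) (u - e *\<^sub>C m)
          = cinner u u - cnj e * cinner u m - e * (cnj (cinner u m) - cnj e * cinner m m)"
          by (simp only: cinner_simps cinner_commute[of m u] right_diff_distrib)
            (simp add: algebra_simps)
        then show ?thesis unfolding cinner_self that using m0 by (simp add: field_simps)
      qed
      then show ?thesis using c_def by blast
    qed
    also have "\<dots> = of_real ((norm (x - p))\<^sup>2 - (cmod (cinner (x - p) m))\<^sup>2 / (norm m)\<^sup>2)"
      by (simp add: complex_norm_square[symmetric])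
    finally have "d \<le> (norm (x - p))\<^sup>2 - (cmod (cinner (x - p) m))\<^sup>2 / (norm m)\<^sup>2"
      using 1 by (simp only: of_real_eq_iff)
    moreover have "(cmod (cinner (x - p) m))\<^sup>2 / (norm m)\<^sup>2 > 0" using c m0 by simp
    ultimately show False using pd by linarith
  qed
  with pM show ?thesis by blast
qed

definition proj :: "'a::chilbert_space set \<Rightarrow> 'a \<Rightarrow> 'a" where
  "proj M x = (SOME p. p \<in> M \<and> (\<forall>m\<in>M. cinner (x - p) m = 0))"

lemma proj:
  assumes "closed_csubspace M"
  shows proj_in: "proj M x \<in> M" and proj_orth: "m \<in> M \<Longrightarrow> cinner (x - proj M x) m = 0"
    and proj_orth2: "m \<in> M \<Longrightarrow> cinner m (x - proj M x) = 0"
    and proj_cinner2: "m \<in> M \<Longrightarrow> cinner m (proj M x) = cinner m x"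
proof -
  have *: "proj M x \<in> M \<and> (\<forall>m\<in>M. cinner (x - proj M x) m = 0)"
    unfolding proj_def by (rule someI_ex) (use orthogonal_projection_exists[OF assms, of x] in blast)
  then show "proj M x \<in> M" and a: "m \<in> M \<Longrightarrow> cinner (x - proj M x) m = 0" for m by auto
  show b: "m \<in> M \<Longrightarrow> cinner m (x - proj M x) = 0" for m using a cinner_zero_comm by blast
  show "m \<in> M \<Longrightarrow> cinner m (proj M x) = cinner m x"
    using b[of m] by (simp add: cinner_diff_right)
qed

lemma csubspace_eqI:
  assumes "csubspace M" "x \<in> M" "y \<in> M" "\<And>z. z \<in> M \<Longrightarrow> cinner z x = cinner z y"
  shows "x = (y::'a::complex_inner)"
proof -
  have "cinner (x - y) (x - y) = 0"
    using assms(4)[OF csubspaceD(5)[OF assms(1,2,3)]] by (simp add: cinner_diff_right)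
  then show ?thesis by (simp add: cinner_self_eq_0)
qed

lemma proj_eqI:
  assumes M: "closed_csubspace M" "p \<in> M" "\<And>m. m \<in> M \<Longrightarrow> cinner m p = cinner m x"
  shows "proj M x = p"
  by (rule csubspace_eqI[OF closed_csubspaceD(1)[OF M(1)] proj_in[OF M(1)] M(2)])
    (simp add: proj_cinner2[OF M(1)] M(3))

lemma proj_ident: "closed_csubspace M \<Longrightarrow> x \<in> M \<Longrightarrow> proj M x = x"
  by (rule proj_eqI) auto

lemma proj_add: "closed_csubspace M \<Longrightarrow> proj M (x + y) = proj M x + proj M y"
  by (rule proj_eqI) (auto simp: cinner_add_right proj_cinner2 intro!: csubspaceD proj_in closed_csubspaceD)

lemma proj_scaleC: "closed_csubspace M \<Longrightarrow> proj M (c *\<^sub>C x) = c *\<^sub>C proj M x"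
  by (rule proj_eqI) (auto simp: cinner_scaleC_right proj_cinner2 intro!: csubspaceD proj_in closed_csubspaceD)

lemma pythagoras:
  assumes "cinner x y = 0" shows "(norm (x + y))\<^sup>2 = (norm x)\<^sup>2 + (norm (y::'a::complex_inner))\<^sup>2"
proof -
  have "inner x y = 0" using assms by (simp add: inner_eq_Re_cinner)
  then show ?thesis by (simp add: power2_norm_eq_inner inner_simps inner_commute)
qed

lemma norm_proj_split:
  assumes M: "closed_csubspace M"
  shows "(norm x)\<^sup>2 = (norm (proj M x))\<^sup>2 + (norm (x - proj M x))\<^sup>2"
  using pythagoras[of "proj M x" "x - proj M x"] proj_orth2[OF M proj_in[OF M]] by simp

lemma norm_proj_le: "closed_csubspace M \<Longrightarrow> norm (proj M x) \<le> norm x"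
  by (rule power2_le_imp_le) (simp_all add: norm_proj_split[of M x])

text \<open>The residual \<open>x - proj M x\<close> of a point of \<open>N\<close> stays in
  \<open>N\<close> and is orthogonal to \<open>M\<close>, so the last hypothesis kills it. Density
  statements, including the span condition, are proved through this criterion.\<close>

lemma closed_csubspace_eqI:
  fixes M N :: "'a::chilbert_space set"
  assumes M: "closed_csubspace M" and N: "closed_csubspace N" and "M \<subseteq> N"
    and "\<And>y. y \<in> N \<Longrightarrow> (\<And>m. m \<in> M \<Longrightarrow> cinner y m = 0) \<Longrightarrow> y = 0"
  shows "M = N"
proof -
  have "x \<in> M" if "x \<in> N" for x
  proof -
    have "x - proj M x \<in> N"
      by (intro csubspaceD[OF closed_csubspaceD(1)[OF N]] that) (use proj_in[OF M] assms(3) in blast)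
    then have "x - proj M x = 0" by (rule assms(4)) (rule proj_orth[OF M])
    then show ?thesis using proj_in[OF M, of x] by simp
  qed
  with assms(3) show ?thesis by blast
qed

lemma orthocomp_in_orthocomp_in:
  fixes M N :: "'a::chilbert_space set"
  assumes M: "closed_csubspace M" and N: "closed_csubspace N" and sub: "M \<subseteq> N"
  shows "orthocomp_in N (orthocomp_in N M) = M"
proof (rule closed_csubspace_eqI[symmetric, OF M closed_csubspace_orthocomp_in[OF N]])
  show "M \<subseteq> orthocomp_in N (orthocomp_in N M)"
    using sub by (auto simp: orthocomp_in_def intro: cinner_zero_comm[THEN iffD1])
  fix y assume y: "y \<in> orthocomp_in N (orthocomp_in N M)" "\<And>m. m \<in> M \<Longrightarrow> cinner y m = 0"
  then have "y \<in> orthocomp_in N M" by (auto simp: orthocomp_in_def)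
  with y have "cinner y y = 0" by (auto simp: orthocomp_in_def)
  then show "y = 0" by (simp add: cinner_self_eq_0)
qed

section \<open>Bounded operators and adjoints\<close>

lemma bounded_opI:
  assumes "\<And>x. x \<in> M \<Longrightarrow> A x \<in> N" "\<And>x y. x \<in> M \<Longrightarrow> y \<in> M \<Longrightarrow> A (x + y) = A x + A y"
    "\<And>c x. x \<in> M \<Longrightarrow> A (c *\<^sub>C x) = c *\<^sub>C A x" "\<And>x. x \<in> M \<Longrightarrow> norm (A x) \<le> C * norm x"
  shows "bounded_op M N A"
  using assms unfolding bounded_op_def by blast

lemma bounded_opD:
  assumes "bounded_op M N A"
  shows "x \<in> M \<Longrightarrow> A x \<in> N" "x \<in> M \<Longrightarrow> y \<in> M \<Longrightarrow> A (x + y) = A x + A y"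
    "x \<in> M \<Longrightarrow> A (c *\<^sub>C x) = c *\<^sub>C A x"
  using assms unfolding bounded_op_def by blast+

lemma bounded_op_bound:
  assumes "bounded_op M N A" obtains C where "C > 0" "\<And>x. x \<in> M \<Longrightarrow> norm (A x) \<le> C * norm x"
proof -
  obtain C where C: "\<forall>x\<in>M. norm (A x) \<le> C * norm x" using assms unfolding bounded_op_def by blast
  have "norm (A x) \<le> max C 1 * norm x" if "x \<in> M" for x
    using C that by (meson max.cobounded1 mult_right_mono norm_ge_zero order_trans)
  then show ?thesis by (intro that[of "max C 1"]) auto
qed

lemma bounded_op_zero: "bounded_op M N A \<Longrightarrow> 0 \<in> M \<Longrightarrow> A 0 = 0"
  using bounded_opD(3)[of M N A 0 0] by simp

lemma bounded_op_minus: "bounded_op M N A \<Longrightarrow> x \<in> M \<Longrightarrow> A (- x) = - A x"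
  using bounded_opD(3)[of M N A x "-1"] by (simp add: scaleC_minus_one)

lemma bounded_op_diff:
  "bounded_op M N A \<Longrightarrow> csubspace M \<Longrightarrow> x \<in> M \<Longrightarrow> y \<in> M \<Longrightarrow> A (x - y) = A x - A y"
  using bounded_opD(2)[of M N A x "-y"] by (simp add: bounded_op_minus csubspaceD)

lemma bounded_op_sum:
  assumes "bounded_op M N A" "csubspace M" "\<And>s. s \<in> S \<Longrightarrow> f s \<in> M"
  shows "A (sum f S) = (\<Sum>s\<in>S. A (f s))"
  using assms(3)
  by (induction S rule: infinite_finite_induct)
    (auto simp: bounded_op_zero[OF assms(1)] csubspaceD[OF assms(2)] bounded_opD(2)[OF assms(1)]
      csubspace_sum[OF assms(2)])

lemma bounded_op_comp:
  assumes A: "bounded_op M N A" and B: "bounded_op N K B" shows "bounded_op M K (\<lambda>x. B (A x))"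
proof -
  obtain C where C: "C > 0" "\<And>x. x \<in> M \<Longrightarrow> norm (A x) \<le> C * norm x" using bounded_op_bound[OF A] by blast
  obtain D where D: "D > 0" "\<And>x. x \<in> N \<Longrightarrow> norm (B x) \<le> D * norm x" using bounded_op_bound[OF B] by blast
  have "norm (B (A x)) \<le> (D * C) * norm x" if "x \<in> M" for x
  proof -
    have "norm (B (A x)) \<le> D * norm (A x)" by (intro D bounded_opD[OF A] that)
    also have "\<dots> \<le> D * (C * norm x)" by (intro mult_left_mono C that) (use D in simp)
    finally show ?thesis by (simp add: mult.assoc)
  qed
  then show ?thesis
    by (intro bounded_opI) (auto simp: bounded_opD[OF A] bounded_opD[OF B])
qed

lemma bounded_op_mono: "bounded_op M N A \<Longrightarrow> M' \<subseteq> M \<Longrightarrow> (\<And>x. x \<in> M' \<Longrightarrow> A x \<in> N') \<Longrightarrow> bounded_op M' N' A"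
  unfolding bounded_op_def by blast

lemma bounded_op_diff_op:
  assumes A: "bounded_op M N A" and B: "bounded_op M N B" and N: "csubspace N"
  shows "bounded_op M N (\<lambda>x. A x - B x)"
proof -
  obtain C where C: "\<And>x. x \<in> M \<Longrightarrow> norm (A x) \<le> C * norm x" using bounded_op_bound[OF A] by blast
  obtain D where D: "\<And>x. x \<in> M \<Longrightarrow> norm (B x) \<le> D * norm x" using bounded_op_bound[OF B] by blast
  have "norm (A x - B x) \<le> (C + D) * norm x" if "x \<in> M" for x
    using C[OF that] D[OF that] norm_triangle_ineq4[of "A x" "B x"] by (simp add: distrib_right)
  then show ?thesis
    by (intro bounded_opI)
      (auto simp: bounded_opD[OF A] bounded_opD[OF B] csubspaceD[OF N] scaleC_diff_right)
qed

lemma bounded_op_sum_op: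
  assumes A: "\<And>s. s \<in> S \<Longrightarrow> bounded_op M N (A s)" and N: "csubspace N"
  shows "bounded_op M N (\<lambda>x. \<Sum>s\<in>S. A s x)"
  using A
proof (induction S rule: infinite_finite_induct)
  case (insert s S)
  have "bounded_op M N (\<lambda>x. A s x - (0 - (\<Sum>s\<in>S. A s x)))"
    by (rule bounded_op_diff_op[OF _ bounded_op_diff_op[OF _ _ N] N])
      (use insert N in \<open>auto intro!: bounded_opI[of _ _ _ 0] csubspaceD\<close>)
  then show ?case using insert by simp
qed (use N in \<open>auto intro!: bounded_opI[of _ _ _ 0] csubspaceD\<close>)

lemma bounded_op_tendsto:
  fixes f :: "nat \<Rightarrow> 'a::complex_inner"
  assumes A: "bounded_op M N A" and M: "csubspace M" and f: "\<And>i. f i \<in> M" "f \<longlonglongrightarrow> x" "x \<in> M"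
  shows "(\<lambda>i. A (f i)) \<longlonglongrightarrow> A x"
proof -
  obtain C where C: "C > 0" "\<And>x. x \<in> M \<Longrightarrow> norm (A x) \<le> C * norm x" using bounded_op_bound[OF A] by blast
  have "(\<lambda>i. A (f i) - A x) \<longlonglongrightarrow> 0"
  proof (rule Lim_null_comparison)
    show "\<forall>\<^sub>F i in sequentially. norm (A (f i) - A x) \<le> C * norm (f i - x)"
      by (rule always_eventually)
        (use C(2)[OF csubspaceD(5)[OF M f(1,3)]] bounded_op_diff[OF A M f(1,3)] in simp)
    show "(\<lambda>i. C * norm (f i - x)) \<longlonglongrightarrow> 0"
      using f(2) by (intro tendsto_mult_right_zero) (simp add: LIM_zero tendsto_norm_zero)
  qed
  then show ?thesis by (simp add: LIM_zero_iff)
qed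

text \<open>Polarisation over the complex scalars: testing \<open>x\<close> against
  \<open>Z x\<close> and against \<open>\<i>\<close> times \<open>Z x\<close> gives the sum and the
  difference of \<open>cinner (Z x) (Z x)\<close> and \<open>cinner (Z (Z x)) x\<close>, and both
  vanish. This upgrades equality of forms to equality of operators.\<close>

lemma bounded_op_eq_zero:
  fixes Z :: "'a::complex_inner \<Rightarrow> 'a"
  assumes Z: "bounded_op M M Z" and M: "csubspace M" and 0: "\<And>z. z \<in> M \<Longrightarrow> cinner (Z z) z = 0"
    and x: "x \<in> M"
  shows "Z x = 0"
proof -
  have *: "cinner (Z a) b + cinner (Z b) a = 0" if "a \<in> M" "b \<in> M" for a b
    using 0[OF csubspaceD(2)[OF M that]] 0[OF that(1)] 0[OF that(2)]
    by (simp add: bounded_opD[OF Z] that cinner_simps add.commute)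
  have Zx: "Z x \<in> M" by (intro bounded_opD[OF Z] x)
  have "cinner (Z x) (\<i> *\<^sub>C Z x) + cinner (Z (\<i> *\<^sub>C Z x)) x = 0"
    by (intro * x csubspaceD[OF M] Zx)
  then have "\<i> * (cinner (Z (Z x)) x - cinner (Z x) (Z x)) = 0"
    by (simp add: bounded_opD[OF Z] Zx cinner_simps algebra_simps)
  moreover have "cinner (Z x) (Z x) + cinner (Z (Z x)) x = 0" by (intro * x Zx)
  ultimately have "cinner (Z x) (Z x) = 0" by (simp add: complex_eq_iff)
  then show ?thesis by (simp add: cinner_self_eq_0)
qed

text \<open>The vector representing a functional is found in the orthogonal complement of its kernel.\<close>

theorem adjoint_vector_exists:
  fixes A :: "'a::chilbert_space \<Rightarrow> 'b::complex_inner"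
  assumes A: "bounded_op M N A" and M: "closed_csubspace M"
  shows "\<exists>x\<in>M. \<forall>z\<in>M. cinner (A z) y = cinner z x"
proof -
  note sub = closed_csubspaceD(1)[OF M]
  define K where "K = {z \<in> M. cinner (A z) y = 0}"
  have K: "closed_csubspace K"
    unfolding closed_csubspace_def
  proof
    show "csubspace K" using csubspaceD[OF sub]
      by (auto simp: csubspace_def K_def bounded_opD[OF A] bounded_op_zero[OF A] cinner_simps)
    show "closed K" unfolding closed_sequential_limits
    proof (intro allI impI, elim conjE)
      fix f l assume f: "\<forall>n. f n \<in> K" "f \<longlonglongrightarrow> l"
      have fM: "f n \<in> M" for n using f by (simp add: K_def)
      have l: "l \<in> M" using fM f closed_csubspaceD(2)[OF M] by (auto simp: closed_sequential_limits)
      have "(\<lambda>n. cinner (A (f n)) y) \<longlonglongrightarrow> cinner (A l) y"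
        by (intro tendsto_cinner bounded_op_tendsto[OF A sub] fM f(2) l tendsto_const)
      moreover have "(\<lambda>n. cinner (A (f n)) y) \<longlonglongrightarrow> 0" using f by (simp add: K_def)
      ultimately have "cinner (A l) y = 0" by (rule LIMSEQ_unique)
      with l show "l \<in> K" by (simp add: K_def)
    qed
  qed
  show ?thesis
  proof (cases "K = M")
    case True
    then have "cinner (A z) y = cinner z 0" if "z \<in> M" for z using that by (auto simp: K_def)
    then show ?thesis using csubspaceD(1)[OF sub] by blast
  next
    case False
    then obtain w where w: "w \<in> M" "w \<notin> K" by (auto simp: K_def)
    define u where "u = w - proj K w"
    have pK: "proj K w \<in> K" by (rule proj_in[OF K])
    have uM: "u \<in> M" unfolding u_def using w pK by (auto simp: K_def intro!: csubspaceD[OF sub])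
    have uK: "cinner z u = 0" if "z \<in> K" for z using proj_orth2[OF K that] by (simp add: u_def)
    have "u \<notin> K"
    proof
      assume "u \<in> K"
      then have "u + proj K w \<in> K" using csubspaceD(2)[OF closed_csubspaceD(1)[OF K] _ pK] by blast
      then show False using w by (simp add: u_def)
    qed
    then have ay: "cinner (A u) y \<noteq> 0" using uM by (simp add: K_def)
    then have u0: "cinner u u \<noteq> 0" using bounded_op_zero[OF A csubspaceD(1)[OF sub]]
      by (auto simp: cinner_self_eq_0)
    define x where "x = cnj (cinner (A u) y / cinner u u) *\<^sub>C u"
    have "cinner (A z) y = cinner z x" if z: "z \<in> M" for z
    proof -
      define c where "c = cinner (A z) y / cinner (A u) y"
      have "z - c *\<^sub>C u \<in> K" unfolding K_def
        using ay by (simp add: csubspaceD[OF sub] z uM bounded_op_diff[OF A sub] bounded_opD[OF A]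
            cinner_simps c_def)
      from uK[OF this] have "cinner z u = c * cinner u u" by (simp add: cinner_simps)
      then show ?thesis using ay u0 by (simp add: x_def cinner_simps c_def)
    qed
    moreover have "x \<in> M" unfolding x_def by (intro csubspaceD[OF sub] uM)
    ultimately show ?thesis by blast
  qed
qed

lemma cadjoint_eqI:
  assumes "csubspace M" "x \<in> M" "\<And>z. z \<in> M \<Longrightarrow> cinner (A z) y = cinner z x"
  shows "cadjoint M A y = x"
  unfolding cadjoint_def
  by (rule the_equality) (use assms in \<open>auto intro!: csubspace_eqI[of M]\<close>)

lemma cadjoint:
  fixes A :: "'a::chilbert_space \<Rightarrow> 'b::complex_inner"
  assumes A: "bounded_op M N A" and M: "closed_csubspace M"
  shows cadjoint_in: "cadjoint M A y \<in> M"
    and cadjoint_right: "z \<in> M \<Longrightarrow> cinner (A z) y = cinner z (cadjoint M A y)"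
    and cadjoint_left: "z \<in> M \<Longrightarrow> cinner y (A z) = cinner (cadjoint M A y) z"
proof -
  obtain x where x: "x \<in> M" "\<forall>z\<in>M. cinner (A z) y = cinner z x"
    using adjoint_vector_exists[OF A M] by blast
  then have eq: "cadjoint M A y = x" by (intro cadjoint_eqI closed_csubspaceD(1)[OF M]) auto
  show "cadjoint M A y \<in> M" and r: "z \<in> M \<Longrightarrow> cinner (A z) y = cinner z (cadjoint M A y)" for z
    using x by (auto simp: eq)
  show "z \<in> M \<Longrightarrow> cinner y (A z) = cinner (cadjoint M A y) z"
    by (subst (1 2) cinner_commute) (simp add: r)
qed

text \<open>\<open>cadjoint M A\<close> is the adjoint of \<open>A\<close> followed by the inclusion
  of \<open>N\<close> into the whole type, hence the domain \<open>UNIV\<close>. The bound holds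
  because the squared norm of \<open>x = cadjoint M A y\<close> is
  \<open>cinner (A x) y\<close>.\<close>

lemma bounded_op_cadjoint:
  fixes A :: "'a::chilbert_space \<Rightarrow> 'b::complex_inner"
  assumes A: "bounded_op M N A" and M: "closed_csubspace M"
  shows "bounded_op UNIV M (cadjoint M A)"
proof -
  note sub = closed_csubspaceD(1)[OF M]
  obtain C where C: "C > 0" "\<And>x. x \<in> M \<Longrightarrow> norm (A x) \<le> C * norm x" using bounded_op_bound[OF A] by blast
  show ?thesis
  proof (rule bounded_opI[of _ _ _ C])
    show "cadjoint M A x \<in> M" for x by (rule cadjoint_in[OF A M])
    show "cadjoint M A (x + y) = cadjoint M A x + cadjoint M A y" for x y
      by (rule cadjoint_eqI[OF sub])
        (auto simp: cinner_add_right cadjoint_right[OF A M] intro!: csubspaceD[OF sub] cadjoint_in[OF A M])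
    show "cadjoint M A (c *\<^sub>C x) = c *\<^sub>C cadjoint M A x" for c x
      by (rule cadjoint_eqI[OF sub])
        (auto simp: cinner_scaleC_right cadjoint_right[OF A M] intro!: csubspaceD[OF sub] cadjoint_in[OF A M])
    show "norm (cadjoint M A y) \<le> C * norm y" for y
    proof (cases "cadjoint M A y = 0")
      case False
      let ?x = "cadjoint M A y"
      have "(norm ?x)\<^sup>2 = cmod (cinner (A ?x) y)"
        by (simp add: cadjoint_right[OF A M cadjoint_in[OF A M]] cinner_self flip: of_real_power)
      also have "\<dots> \<le> norm (A ?x) * norm y" by (rule norm_cinner_le)
      also have "\<dots> \<le> C * norm ?x * norm y" by (intro mult_right_mono C cadjoint_in[OF A M]) auto
      finally show ?thesis using False by (simp add: power2_eq_square)
    qed (use C in simp)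
  qed
qed

lemma bounded_op_id: "bounded_op M M (\<lambda>x. x)"
  by (rule bounded_opI[of _ _ _ 1]) auto

lemma bounded_op_proj: "closed_csubspace M \<Longrightarrow> bounded_op UNIV M (proj M)"
  by (rule bounded_opI[of _ _ _ 1]) (auto simp: proj_in proj_add proj_scaleC norm_proj_le)

instance chilbert_space \<subseteq> banach ..

section \<open>Positive square roots\<close>

text \<open>The coefficients of the power series \<open>1 - \<surd>(1 - t) = \<Sum> c\<^sub>m t\<^sup>m\<close>, whose square is
  twice the series minus \<open>t\<close>.\<close>

fun sqrt_coeff :: "nat \<Rightarrow> real" where
  "sqrt_coeff 0 = 0"
| "sqrt_coeff (Suc 0) = 1/2"
| "sqrt_coeff (Suc (Suc m)) = (\<Sum>a\<in>{1..Suc m}. sqrt_coeff a * sqrt_coeff (Suc (Suc m) - a)) / 2"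

lemma sqrt_coeff_nonneg: "0 \<le> sqrt_coeff m"
proof (induction m rule: sqrt_coeff.induct)
  case (3 m)
  then show ?case unfolding sqrt_coeff.simps
    by (intro divide_nonneg_nonneg sum_nonneg mult_nonneg_nonneg) auto
qed auto

lemma sqrt_coeff_conv:
  "(\<Sum>i\<le>m. sqrt_coeff i * sqrt_coeff (m - i)) = 2 * sqrt_coeff m - (if m = 1 then 1 else 0)"
proof (cases m rule: sqrt_coeff.cases)
  case (3 l)
  have "(\<Sum>i\<le>m. sqrt_coeff i * sqrt_coeff (m - i)) = (\<Sum>i\<in>{1..Suc l}. sqrt_coeff i * sqrt_coeff (m - i))"
  proof (rule sum.mono_neutral_right)
    show "\<forall>i\<in>{..m} - {1..Suc l}. sqrt_coeff i * sqrt_coeff (m - i) = 0"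
    proof
      fix i assume "i \<in> {..m} - {1..Suc l}"
      then have "i = 0 \<or> m - i = 0" using 3 by auto
      then show "sqrt_coeff i * sqrt_coeff (m - i) = 0" by auto
    qed
  qed (use 3 in auto)
  then show ?thesis using 3 by simp
qed auto

text \<open>For the partial sums \<open>s_N\<close> the convolution identity gives
  \<open>2 s_(K+1) - 1 \<le> s_K^2\<close>: in a nonzero product both indices are at least 1, hence
  at most \<open>K\<close>. The bound 1 reproduces itself under this recursion.\<close>

lemma sqrt_coeff_sum_le: "(\<Sum>m\<le>N. sqrt_coeff m) \<le> 1"
proof (induction N)
  case (Suc K)
  let ?c = sqrt_coeff
  have "2 * (\<Sum>m\<le>Suc K. ?c m) - 1 \<le> (\<Sum>m\<le>Suc K. 2 * ?c m - (if m = 1 then 1 else 0))"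
    by (simp add: sum_subtractf sum_distrib_left[symmetric])
  also have "\<dots> = (\<Sum>m\<le>Suc K. \<Sum>i\<le>m. ?c i * ?c (m - i))" by (simp only: sqrt_coeff_conv)
  also have "\<dots> = (\<Sum>(i,j)\<in>{(i,j). i + j \<le> Suc K}. ?c i * ?c j)"
    by (rule sum.triangle_reindex_eq[symmetric])
  also have "\<dots> = (\<Sum>(i,j)\<in>{(i,j). i + j \<le> Suc K \<and> 1 \<le> i \<and> 1 \<le> j}. ?c i * ?c j)"
  proof (rule sum.mono_neutral_right)
    show "finite {(i,j). i + j \<le> Suc K}"
      by (rule finite_subset[of _ "{..Suc K} \<times> {..Suc K}"]) auto
    show "\<forall>p\<in>{(i, j). i + j \<le> Suc K} - {(i, j). i + j \<le> Suc K \<and> 1 \<le> i \<and> 1 \<le> j}.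
      (case p of (i, j) \<Rightarrow> ?c i * ?c j) = 0" by (auto simp: Suc_le_eq intro!: gr0I)
  qed auto
  also have "\<dots> \<le> (\<Sum>(i,j)\<in>{..K} \<times> {..K}. ?c i * ?c j)"
    by (rule sum_mono2) (auto intro: mult_nonneg_nonneg sqrt_coeff_nonneg)
  also have "\<dots> = (\<Sum>m\<le>K. ?c m)\<^sup>2"
    by (simp add: power2_eq_square sum_product sum.cartesian_product)
  also have "\<dots> \<le> 1\<^sup>2" by (intro power_mono Suc.IH sum_nonneg sqrt_coeff_nonneg)
  finally show ?case by simp
qed simp

lemma sqrt_coeff_summable: "summable sqrt_coeff"
  by (rule bounded_imp_summable[OF sqrt_coeff_nonneg sqrt_coeff_sum_le])

lemma positive_opD:
  assumes "positive_op M A" "x \<in> M"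
  shows "0 \<le> Re (cinner (A x) x)" "cinner (A x) x = of_real (Re (cinner (A x) x))"
  using assms by (auto simp: positive_op_def complex_nonneg_Reals_iff complex_eq_iff)

text \<open>A nonnegative form is real, so \<open>A\<close> and its adjoint have the same form, and
  their difference vanishes by \<open>bounded_op_eq_zero\<close>.\<close>

lemma positive_op_symmetric:
  fixes A :: "'a::chilbert_space \<Rightarrow> 'a"
  assumes A: "bounded_op UNIV UNIV A" and pos: "positive_op UNIV A"
  shows "cinner (A x) y = cinner x (A y)"
proof -
  note adj = cadjoint_right[OF A closed_csubspace_UNIV UNIV_I]
  have "A x - cadjoint UNIV A x = 0" for x
  proof (rule bounded_op_eq_zero[where M = UNIV and Z = "\<lambda>x. A x - cadjoint UNIV A x"])
    show "bounded_op UNIV UNIV (\<lambda>x. A x - cadjoint UNIV A x)"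
      by (intro bounded_op_diff_op A bounded_op_cadjoint[OF A]) auto
    fix z :: 'a
    have "cinner (cadjoint UNIV A z) z = cnj (cinner (A z) z)"
      by (subst cinner_commute) (simp add: adj)
    also have "\<dots> = cinner (A z) z"
      using positive_opD(2)[OF pos, of z] by (metis UNIV_I complex_cnj_complex_of_real)
    finally show "cinner (A z - cadjoint UNIV A z) z = 0" by (simp add: cinner_diff_left)
  qed auto
  then have "A y = cadjoint UNIV A y" by simp
  then show ?thesis using adj[of x y] by simp
qed

text \<open>Positivity of \<open>R\<close> at the vector \<open>u - R u / C\<close>, expanded, with
  the term in \<open>R (R u)\<close> estimated through \<open>C\<close>.\<close>

lemma positive_op_norm_le:
  fixes R :: "'a::chilbert_space \<Rightarrow> 'a"
  assumes R: "bounded_op UNIV UNIV R" and pos: "positive_op UNIV R"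
    and C: "C > 0" "\<And>v. Re (cinner (R v) v) \<le> C * (norm v)\<^sup>2"
  shows "(norm (R u))\<^sup>2 \<le> C * Re (cinner (R u) u)"
proof -
  define t where "t = complex_of_real (1 / C)"
  have "cinner (R (u - t *\<^sub>C R u)) (u - t *\<^sub>C R u)
      = cinner (R u) u - t * cinner (R u) (R u) - t * cinner (R u) (R u) + t * t * cinner (R (R u)) (R u)"
    by (simp add: bounded_op_diff[OF R] bounded_opD(3)[OF R] cinner_simps
        positive_op_symmetric[OF R pos, of "R u" u] t_def algebra_simps)
  then have "Re (cinner (R (u - t *\<^sub>C R u)) (u - t *\<^sub>C R u))
      = Re (cinner (R u) u) - 2 / C * (norm (R u))\<^sup>2 + (1 / C)\<^sup>2 * Re (cinner (R (R u)) (R u))"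
    by (simp add: cinner_self t_def power2_eq_square flip: of_real_power of_real_mult of_real_divide)
  moreover have "0 \<le> Re (cinner (R (u - t *\<^sub>C R u)) (u - t *\<^sub>C R u))"
    by (rule positive_opD[OF pos]) simp
  moreover have "(1 / C)\<^sup>2 * Re (cinner (R (R u)) (R u)) \<le> (1 / C)\<^sup>2 * (C * (norm (R u))\<^sup>2)"
    by (intro mult_left_mono C) auto
  moreover have "(1 / C)\<^sup>2 * (C * (norm (R u))\<^sup>2) = (norm (R u))\<^sup>2 / C" "2 / C * (norm (R u))\<^sup>2 = 2 * ((norm (R u))\<^sup>2 / C)"
    using C(1) by (simp_all add: power2_eq_square)
  ultimately have "(norm (R u))\<^sup>2 / C \<le> Re (cinner (R u) u)"
    by linarith
  then show ?thesis using C(1) by (simp add: field_simps)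
qed

lemma positive_op_eq_0:
  fixes R :: "'a::chilbert_space \<Rightarrow> 'a"
  assumes R: "bounded_op UNIV UNIV R" and pos: "positive_op UNIV R" and 0: "cinner (R u) u = 0"
  shows "R u = 0"
proof -
  obtain C where C: "C > 0" "\<And>x. norm (R x) \<le> C * norm x" by (rule bounded_op_bound[OF R]) simp
  have "Re (cinner (R v) v) \<le> C * (norm v)\<^sup>2" for v
  proof -
    have "Re (cinner (R v) v) \<le> norm (R v) * norm v"
      using norm_cinner_le[of "R v" v] complex_Re_le_cmod order_trans by blast
    also have "\<dots> \<le> C * norm v * norm v" by (intro mult_right_mono C) auto
    finally show ?thesis by (simp add: power2_eq_square mult.assoc)
  qed
  from positive_op_norm_le[OF R pos C(1) this, of u] 0 show ?thesis by simp
qed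

lemma norm_pow_le:
  fixes B :: "'a::real_normed_vector \<Rightarrow> 'a"
  assumes "\<And>x. norm (B x) \<le> norm x" shows "norm ((B ^^ m) x) \<le> norm x"
  proof (induction m)
  case (Suc m)
  then show ?case using assms[of "(B ^^ m) x"] by simp
qed simp

text \<open>The difference on the left consists of the index pairs in the square but outside the
  triangle \<open>i + j \<le> N\<close>, and the bracket on the right is the total weight of these
  pairs. With \<open>v m = (B ^^ m) x\<close> this controls the square of a partial sum of the
  operator series.\<close>

lemma norm_conv_remainder_le:
  fixes v :: "nat \<Rightarrow> 'a::real_normed_vector"
  assumes v: "\<And>m. norm (v m) \<le> K" and c: "\<And>m::nat. 0 \<le> c m"
  shows "norm ((\<Sum>i\<le>N. \<Sum>j\<le>N. (c i * c j) *\<^sub>R v (i + j)) - (\<Sum>m\<le>N. (\<Sum>i\<le>m. c i * c (m - i)) *\<^sub>R v m))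
     \<le> ((\<Sum>m\<le>N. c m)\<^sup>2 - (\<Sum>m\<le>N. \<Sum>i\<le>m. c i * c (m - i))) * K"
proof -
  define S where "S = {..N} \<times> {..N}"
  define U where "U = {(i,j). i + j \<le> N}"
  have fin: "finite S" and sub: "U \<subseteq> S" by (auto simp: S_def U_def)
  have 1: "(\<Sum>i\<le>N. \<Sum>j\<le>N. (c i * c j) *\<^sub>R v (i + j)) = (\<Sum>(i,j)\<in>S. (c i * c j) *\<^sub>R v (i + j))"
    by (simp add: S_def sum.cartesian_product)
  have 2: "(\<Sum>m\<le>N. (\<Sum>i\<le>m. c i * c (m - i)) *\<^sub>R v m) = (\<Sum>(i,j)\<in>U. (c i * c j) *\<^sub>R v (i + j))"
    unfolding U_def sum.triangle_reindex_eq by (simp add: scaleR_sum_left)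
  have 3: "(\<Sum>m\<le>N. c m)\<^sup>2 = (\<Sum>(i,j)\<in>S. c i * c j)"
    by (simp add: S_def power2_eq_square sum_product sum.cartesian_product)
  have 4: "(\<Sum>m\<le>N. \<Sum>i\<le>m. c i * c (m - i)) = (\<Sum>(i,j)\<in>U. c i * c j)"
    unfolding U_def sum.triangle_reindex_eq ..
  have "norm (\<Sum>(i,j)\<in>S - U. (c i * c j) *\<^sub>R v (i + j)) \<le> (\<Sum>(i,j)\<in>S - U. c i * c j * K)"
    by (rule sum_norm_le) (auto simp: c abs_of_nonneg intro!: mult_left_mono v)
  then show ?thesis
    unfolding 1 2 3 4 sum_diff[OF fin sub, symmetric]
    by (simp add: sum_distrib_right case_prod_unfold)
qed

text \<open>\<open>Y\<close> is the power series of \<open>1 - \<surd>(1 - t)\<close> at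
  \<open>B\<close>, and its square identity is that of the coefficients. That it commutes with
  whatever commutes with \<open>B\<close> is recorded because uniqueness of square roots rests on
  it.\<close>

lemma contraction_series:
  fixes B :: "'a::chilbert_space \<Rightarrow> 'a"
  assumes B: "bounded_op UNIV UNIV B" and sym: "\<And>x y. cinner (B x) y = cinner x (B y)"
    and le: "\<And>x. norm (B x) \<le> norm x"
  obtains Y where "bounded_op UNIV UNIV Y" "\<And>x y. cinner (Y x) y = cinner x (Y y)"
    "\<And>x. norm (Y x) \<le> norm x" "\<And>x. Y (Y x) = 2 *\<^sub>R Y x - B x"
    "\<And>C x. bounded_op UNIV UNIV C \<Longrightarrow> (\<And>x. C (B x) = B (C x)) \<Longrightarrow> C (Y x) = Y (C x)"
proof -
  let ?c = sqrt_coeff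
  define Z where "Z N x = (\<Sum>m\<le>N. ?c m *\<^sub>R (B ^^ m) x)" for N x
  define Y where "Y x = (\<Sum>m. ?c m *\<^sub>R (B ^^ m) x)" for x
  note Bl = bounded_opD[OF B, simplified]
  have pl: "(B ^^ m) (x + y) = (B ^^ m) x + (B ^^ m) y" "(B ^^ m) (c *\<^sub>C x) = c *\<^sub>C (B ^^ m) x" for m x y c
    by (induction m) (auto simp: Bl)
  have ps: "cinner ((B ^^ m) x) y = cinner x ((B ^^ m) y)" for m x y
  proof (induction m arbitrary: x y)
    case (Suc m)
    have "cinner ((B ^^ Suc m) x) y = cinner x ((B ^^ m) (B y))" using Suc.IH by (simp add: sym)
    then show ?case by (simp only: funpow_swap1 funpow.simps comp_apply)
  qed simp
  have pn: "norm ((B ^^ m) x) \<le> norm x" for m x by (rule norm_pow_le[OF le])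
  have summ: "summable (\<lambda>m. ?c m *\<^sub>R (B ^^ m) x)" for x
  proof (rule summable_comparison_test)
    show "summable (\<lambda>m. ?c m * norm x)" by (intro summable_mult2 sqrt_coeff_summable)
    show "\<exists>N. \<forall>m\<ge>N. norm (?c m *\<^sub>R (B ^^ m) x) \<le> ?c m * norm x"
      by (auto intro!: mult_left_mono pn simp: sqrt_coeff_nonneg abs_of_nonneg)
  qed
  have ZY: "(\<lambda>N. Z N x) \<longlonglongrightarrow> Y x" for x
    unfolding Z_def Y_def by (rule summable_LIMSEQ'[OF summ])
  have Zn: "norm (Z N x) \<le> norm x" for N x
  proof -
    have "norm (Z N x) \<le> (\<Sum>m\<le>N. ?c m * norm x)" unfolding Z_def
      by (rule sum_norm_le) (auto intro!: mult_left_mono pn simp: sqrt_coeff_nonneg abs_of_nonneg)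
    also have "\<dots> = (\<Sum>m\<le>N. ?c m) * norm x" by (simp add: sum_distrib_right)
    also have "\<dots> \<le> 1 * norm x" by (intro mult_right_mono sqrt_coeff_sum_le) auto
    finally show ?thesis by simp
  qed
  have Zadd: "Z N (x + y) = Z N x + Z N y" for N x y
    by (simp add: Z_def pl scaleR_right_distrib sum.distrib)
  have Zsc: "Z N (c *\<^sub>C x) = c *\<^sub>C Z N x" for N x c
    by (simp add: Z_def pl scaleC_sum_right scaleR_scaleC scaleC_scaleC mult.commute)
  have Yadd: "Y (x + y) = Y x + Y y" for x y
    by (rule LIMSEQ_unique[OF ZY]) (simp add: Zadd tendsto_add ZY)
  have Ysc: "Y (c *\<^sub>C x) = c *\<^sub>C Y x" for x c
    by (rule LIMSEQ_unique[OF ZY])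
      (simp add: Zsc continuous_on_tendsto_compose[OF continuous_scaleC ZY])
  have Yn: "norm (Y x) \<le> norm x" for x
    by (rule LIMSEQ_le_const2[OF tendsto_norm[OF ZY]]) (use Zn in blast)
  have Yb: "bounded_op UNIV UNIV Y" by (rule bounded_opI[of _ _ _ 1]) (auto simp: Yadd Ysc Yn)
  have Ysym: "cinner (Y x) y = cinner x (Y y)" for x y
  proof (rule LIMSEQ_unique)
    show "(\<lambda>N. cinner (Z N x) y) \<longlonglongrightarrow> cinner (Y x) y" by (intro tendsto_cinner ZY tendsto_const)
    have "cinner (Z N x) y = cinner x (Z N y)" for N
      by (simp add: Z_def cinner_sum_left cinner_sum_right scaleR_scaleC cinner_simps ps)
    then show "(\<lambda>N. cinner (Z N x) y) \<longlonglongrightarrow> cinner x (Y y)" by (simp add: tendsto_cinner ZY)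
  qed
  have Ycomm: "C (Y x) = Y (C x)" if C: "bounded_op UNIV UNIV C" and cm: "\<And>x. C (B x) = B (C x)" for C x
  proof (rule LIMSEQ_unique)
    show "(\<lambda>N. C (Z N x)) \<longlonglongrightarrow> C (Y x)" by (rule bounded_op_tendsto[OF C _ _ ZY]) auto
    have "C ((B ^^ m) x) = (B ^^ m) (C x)" for m by (induction m) (auto simp: cm)
    then have "C (Z N x) = Z N (C x)" for N
      by (simp add: Z_def bounded_op_sum[OF C] scaleR_scaleC bounded_opD(3)[OF C])
    then show "(\<lambda>N. C (Z N x)) \<longlonglongrightarrow> Y (C x)" by (simp add: ZY)
  qed
  have YY: "Y (Y x) = 2 *\<^sub>R Y x - B x" for x
  proof -
    define W where "W N = (\<Sum>m\<le>N. (\<Sum>i\<le>m. ?c i * ?c (m - i)) *\<^sub>R (B ^^ m) x)" for N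
    \<comment> \<open>Contractivity of the partial sums lets operator and argument converge
      simultaneously.\<close>
    have ZZ: "(\<lambda>N. Z N (Z N x)) \<longlonglongrightarrow> Y (Y x)"
    proof (rule LIM_zero_cancel, rule Lim_null_comparison)
      have "norm (Z N (Z N x) - Y (Y x)) \<le> norm (Z N x - Y x) + norm (Z N (Y x) - Y (Y x))" for N
      proof -
        have "Z N (Z N x) = Z N (Z N x - Y x) + Z N (Y x)" by (simp flip: Zadd)
        then have "Z N (Z N x) - Y (Y x) = Z N (Z N x - Y x) + (Z N (Y x) - Y (Y x))" by simp
        then show ?thesis using Zn[of N "Z N x - Y x"] norm_triangle_le by (metis add_mono_thms_linordered_semiring(3))
      qed
      then show "\<forall>\<^sub>F N in sequentially. norm (Z N (Z N x) - Y (Y x))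
          \<le> norm (Z N x - Y x) + norm (Z N (Y x) - Y (Y x))" by simp
      show "(\<lambda>N. norm (Z N x - Y x) + norm (Z N (Y x) - Y (Y x))) \<longlonglongrightarrow> 0"
        by (rule tendsto_eq_intros tendsto_norm_zero LIM_zero ZY | simp)+
    qed
    have ZZW: "(\<lambda>N. Z N (Z N x) - W N) \<longlonglongrightarrow> 0"
    proof (rule Lim_null_comparison)
      let ?e = "\<lambda>N. ((\<Sum>m\<le>N. ?c m)\<^sup>2 - (\<Sum>m\<le>N. \<Sum>i\<le>m. ?c i * ?c (m - i))) * norm x"
      have "Z N (Z N x) = (\<Sum>i\<le>N. \<Sum>j\<le>N. (?c i * ?c j) *\<^sub>R (B ^^ (i + j)) x)" for N
      proof -
        have "(B ^^ i) (Z N x) = (\<Sum>j\<le>N. ?c j *\<^sub>R (B ^^ (i + j)) x)" for i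
        proof -
          have "bounded_op UNIV UNIV (B ^^ i)" by (rule bounded_opI[of _ _ _ 1]) (auto simp: pl pn)
          then show ?thesis
            by (simp add: Z_def bounded_op_sum scaleR_scaleC pl(2) funpow_add)
        qed
        then show ?thesis by (simp add: Z_def[of N "Z N x"] scaleR_right.sum)
      qed
      then have "norm (Z N (Z N x) - W N) \<le> ?e N" for N
        unfolding W_def by (simp only:) (intro norm_conv_remainder_le pn sqrt_coeff_nonneg)
      then show "\<forall>\<^sub>F N in sequentially. norm (Z N (Z N x) - W N) \<le> ?e N" by simp
      \<comment> \<open>The Cauchy product of the scalar series converges to the square of its sum,
        so the scalar remainder tends to 0.\<close>
      have "(\<lambda>k. \<Sum>i\<le>k. ?c i * ?c (k - i)) sums ((\<Sum>k. ?c k) * (\<Sum>k. ?c k))"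
        by (rule Cauchy_product_sums) (simp_all add: sqrt_coeff_nonneg sqrt_coeff_summable)
      then have a: "(\<lambda>N. \<Sum>m\<le>N. \<Sum>i\<le>m. ?c i * ?c (m - i)) \<longlonglongrightarrow> (\<Sum>k. ?c k)\<^sup>2"
        by (simp add: sums_def_le power2_eq_square)
      have b: "(\<lambda>N. (\<Sum>m\<le>N. ?c m)\<^sup>2) \<longlonglongrightarrow> (\<Sum>k. ?c k)\<^sup>2"
        by (intro tendsto_power summable_LIMSEQ' sqrt_coeff_summable)
      show "?e \<longlonglongrightarrow> 0" by (rule tendsto_mult_left_zero) (use tendsto_diff[OF b a] in simp)
    qed
    \<comment> \<open>From \<open>N = 1\<close> on, the exceptional coefficient at
      \<open>m = 1\<close> lies in the range of summation and produces \<open>- B x\<close>.\<close>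
    have W: "W N = 2 *\<^sub>R Z N x - B x" if "N \<ge> 1" for N
    proof -
      have "W N = (\<Sum>m\<le>N. 2 *\<^sub>R ?c m *\<^sub>R (B ^^ m) x - (if m = 1 then B x else 0))"
        unfolding W_def sqrt_coeff_conv by (intro sum.cong) (auto simp: scaleR_left_diff_distrib)
      also have "\<dots> = 2 *\<^sub>R Z N x - B x"
        using that by (simp add: sum_subtractf Z_def scaleR_right.sum)
      finally show ?thesis .
    qed
    have "(\<lambda>N. 2 *\<^sub>R Z N x - B x) \<longlonglongrightarrow> Y (Y x)"
    proof (rule Lim_transform_eventually)
      show "(\<lambda>N. Z N (Z N x) - (Z N (Z N x) - W N)) \<longlonglongrightarrow> Y (Y x)" using tendsto_diff[OF ZZ ZZW] by simp
      show "\<forall>\<^sub>F N in sequentially. Z N (Z N x) - (Z N (Z N x) - W N) = 2 *\<^sub>R Z N x - B x"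
        using eventually_ge_at_top[of 1] by eventually_elim (simp add: W)
    qed
    moreover have "(\<lambda>N. 2 *\<^sub>R Z N x - B x) \<longlonglongrightarrow> 2 *\<^sub>R Y x - B x" by (intro tendsto_intros ZY)
    ultimately show ?thesis by (rule LIMSEQ_unique)
  qed
  show ?thesis by (rule that[OF Yb Ysym Yn YY Ycomm])
qed

text \<open>For a norm bound \<open>C\<close> of \<open>A\<close>, the operator
  \<open>B = 1 - A / C\<close> is a positive contraction, and
  \<open>\<surd>A = \<surd>C (1 - Y)\<close> with the series \<open>Y\<close> of
  \<open>contraction_series\<close> for \<open>B\<close>.\<close>

lemma positive_sqrt_exists:
  fixes A :: "'a::chilbert_space \<Rightarrow> 'a"
  assumes A: "bounded_op UNIV UNIV A" and pos: "positive_op UNIV A"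
  obtains R where "bounded_op UNIV UNIV R" "positive_op UNIV R" "R \<circ> R = A"
    "\<And>C x. bounded_op UNIV UNIV C \<Longrightarrow> (\<And>x. C (A x) = A (C x)) \<Longrightarrow> C (R x) = R (C x)"
proof -
  obtain C where C: "C > 0" "\<And>x. norm (A x) \<le> C * norm x"
    by (rule bounded_op_bound[OF A]) simp
  define B where "B x = x - of_real (1 / C) *\<^sub>C A x" for x
  note Al = bounded_opD(2,3)[OF A UNIV_I] bounded_opD(2)[OF A UNIV_I UNIV_I] and Asym = positive_op_symmetric[OF A pos]
  have sA: "bounded_op UNIV UNIV (\<lambda>x. of_real (1 / C) *\<^sub>C A x)"
  proof (rule bounded_opI[of _ _ _ 1])
    show "norm (of_real (1 / C) *\<^sub>C A x) \<le> 1 * norm x" for x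
      using C(1) C(2)[of x] by (simp add: norm_scaleC norm_divide field_simps)
  qed (simp_all add: Al scaleC_add_right scaleC_scaleC mult.commute)
  have B: "bounded_op UNIV UNIV B" unfolding B_def
    by (rule bounded_op_diff_op[OF bounded_op_id sA]) simp
  have Bsym: "cinner (B x) y = cinner x (B y)" for x y
    by (simp add: B_def cinner_simps Asym)
  have Bq: "cinner (B x) x = of_real ((norm x)\<^sup>2 - Re (cinner (A x) x) / C)" for x
    by (subst of_real_diff, subst of_real_divide, subst positive_opD(2)[OF pos, symmetric])
      (simp_all add: B_def cinner_simps cinner_self)
  have Aq: "Re (cinner (A x) x) \<le> C * (norm x)\<^sup>2" for x
  proof -
    have "Re (cinner (A x) x) \<le> norm (A x) * norm x"
      using norm_cinner_le[of "A x" x] complex_Re_le_cmod order_trans by blast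
    also have "\<dots> \<le> C * norm x * norm x" by (intro mult_right_mono C) auto
    finally show ?thesis by (simp add: power2_eq_square mult.assoc)
  qed
  have Bpos: "positive_op UNIV B" using Aq C(1)
    by (simp add: positive_op_def Bq complex_nonneg_Reals_iff divide_le_eq mult.commute del: of_real_diff)
  have Ble: "norm (B x) \<le> norm x" for x
  proof (cases "B x = 0")
    case False
    have "(norm (B x))\<^sup>2 \<le> 1 * Re (cinner (B x) x)"
      by (rule positive_op_norm_le[OF B Bpos])
        (use C(1) positive_opD(1)[OF pos] in \<open>simp_all add: Bq del: of_real_diff\<close>)
    also have "\<dots> \<le> norm (B x) * norm x"
      using norm_cinner_le[of "B x" x] complex_Re_le_cmod[of "cinner (B x) x"] by simp
    finally show ?thesis using False by (simp add: power2_eq_square)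
  qed simp
  obtain Y where Y: "bounded_op UNIV UNIV Y" "\<And>x y. cinner (Y x) y = cinner x (Y y)"
    "\<And>x. norm (Y x) \<le> norm x" "\<And>x. Y (Y x) = 2 *\<^sub>R Y x - B x"
    "\<And>C x. bounded_op UNIV UNIV C \<Longrightarrow> (\<And>x. C (B x) = B (C x)) \<Longrightarrow> C (Y x) = Y (C x)"
    using contraction_series[OF B Bsym Ble] by blast
  define q where "q = complex_of_real (sqrt C)"
  have qq: "q * q = of_real C" using C(1) by (simp add: q_def flip: of_real_mult)
  define R where "R x = q *\<^sub>C (x - Y x)" for x
  note Yl = bounded_opD[OF Y(1), simplified]
  have R: "bounded_op UNIV UNIV R"
  proof (rule bounded_opI[of _ _ _ "cmod q * 2"])
    show "norm (R x) \<le> cmod q * 2 * norm x" for x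
    proof -
      have "norm (x - Y x) \<le> 2 * norm x" using norm_triangle_ineq4[of x "Y x"] Y(3)[of x] by linarith
      then show ?thesis by (simp add: R_def norm_scaleC mult.assoc mult_left_mono)
    qed
  qed (auto simp: R_def Yl scaleC_diff_right scaleC_add_right scaleC_scaleC mult.commute)
  have "cinner (R x) x \<in> \<real>\<^sub>\<ge>\<^sub>0" for x
  proof -
    have "cinner (Y x) x = cnj (cinner (Y x) x)" by (metis Y(2) cinner_commute)
    then have "Im (cinner (Y x) x) = 0" by (simp add: complex_eq_iff)
    moreover have "Re (cinner (Y x) x) \<le> (norm x)\<^sup>2"
    proof -
      have "Re (cinner (Y x) x) \<le> norm (Y x) * norm x"
        using norm_cinner_le[of "Y x" x] complex_Re_le_cmod order_trans by blast
      also have "\<dots> \<le> norm x * norm x" by (intro mult_right_mono Y) auto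
      finally show ?thesis by (simp add: power2_eq_square)
    qed
    ultimately show ?thesis using C(1)
      by (simp add: R_def cinner_simps cinner_self complex_nonneg_Reals_iff q_def flip: of_real_power)
  qed
  then have Rpos: "positive_op UNIV R" by (simp add: positive_op_def)
  have RR: "R \<circ> R = A"
  proof
    fix x
    have "R (R x) = (q * q) *\<^sub>C ((x - Y x) - Y (x - Y x))"
      by (simp only: R_def bounded_opD(3)[OF Y(1) UNIV_I] scaleC_scaleC flip: scaleC_diff_right)
    also have "(x - Y x) - Y (x - Y x) = x - B x"
      by (simp add: bounded_op_diff[OF Y(1)] Y(4) scaleR_2)
    also have "(q * q) *\<^sub>C (x - B x) = A x" using C(1) by (simp add: qq B_def scaleC_scaleC)
    finally show "(R \<circ> R) x = A x" by simp
  qed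
  have "D (R x) = R (D x)" if D: "bounded_op UNIV UNIV D" and c: "\<And>x. D (A x) = A (D x)" for D x
  proof -
    have "D (Y x) = Y (D x)"
      by (rule Y(5)[OF D]) (simp add: B_def bounded_op_diff[OF D] bounded_opD(3)[OF D] c)
    then show ?thesis by (simp add: R_def bounded_op_diff[OF D] bounded_opD(3)[OF D])
  qed
  then show ?thesis by (rule that[OF R Rpos RR])
qed

text \<open>Uniqueness: a second root \<open>Q\<close> commutes with \<open>A\<close>, hence with
  \<open>R\<close>, so \<open>R + Q\<close> kills \<open>u = R x - Q x\<close>. The two forms are
  nonnegative and add up to 0 at \<open>u\<close>, so \<open>R u = Q u = 0\<close>, and
  \<open>u\<close> is orthogonal to itself.\<close>

theorem positive_sqrt:
  fixes A :: "'a::chilbert_space \<Rightarrow> 'a"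
  assumes A: "bounded_op UNIV UNIV A" and pos: "positive_op UNIV A"
  shows bounded_op_positive_sqrt: "bounded_op UNIV UNIV (positive_sqrt A)"
    and positive_op_positive_sqrt: "positive_op UNIV (positive_sqrt A)"
    and positive_sqrt_square: "positive_sqrt A (positive_sqrt A x) = A x"
proof -
  obtain R where R: "bounded_op UNIV UNIV R" "positive_op UNIV R" "R \<circ> R = A"
    and comm: "\<And>C x. bounded_op UNIV UNIV C \<Longrightarrow> (\<And>x. C (A x) = A (C x)) \<Longrightarrow> C (R x) = R (C x)"
    using positive_sqrt_exists[OF A pos] by blast
  have RR: "R (R x) = A x" for x using R(3) by (auto simp: fun_eq_iff)
  have uniq: "Q = R" if Q: "bounded_op UNIV UNIV Q" "positive_op UNIV Q" "Q \<circ> Q = A" for Q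
  proof
    fix x
    have QQ: "Q (Q x) = A x" for x using Q(3) by (auto simp: fun_eq_iff)
    have QR: "Q (R x) = R (Q x)" for x by (rule comm[OF Q(1)]) (simp flip: QQ)
    define u where "u = R x - Q x"
    have "R u + Q u = 0"
      by (simp add: u_def bounded_op_diff[OF R(1)] bounded_op_diff[OF Q(1)] RR QQ QR)
    then have "cinner (R u) u + cinner (Q u) u = 0" by (simp flip: cinner_add_left)
    then have "Re (cinner (R u) u) + Re (cinner (Q u) u) = 0" by (metis plus_complex.simps(1) zero_complex.simps(1))
    then have "Re (cinner (R u) u) = 0" "Re (cinner (Q u) u) = 0"
      using positive_opD(1)[OF R(2), of u] positive_opD(1)[OF Q(2), of u] by auto
    then have "cinner (R u) u = 0" "cinner (Q u) u = 0"
      using positive_opD(2)[OF R(2), of u] positive_opD(2)[OF Q(2), of u] by auto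
    then have "R u = 0" "Q u = 0"
      using positive_op_eq_0[OF R(1,2)] positive_op_eq_0[OF Q(1,2)] by auto
    then have "cinner u (R x - Q x) = 0"
      using positive_op_symmetric[OF R(1,2), of u x] positive_op_symmetric[OF Q(1,2), of u x]
      by (simp add: cinner_diff_right)
    then show "Q x = R x" by (simp add: u_def[symmetric] cinner_self_eq_0) (simp add: u_def)
  qed
  have eq: "positive_sqrt A = R" unfolding positive_sqrt_def
    by (rule the_equality, intro conjI R, elim conjE, rule uniq)
  show "bounded_op UNIV UNIV (positive_sqrt A)" "positive_op UNIV (positive_sqrt A)"
    "positive_sqrt A (positive_sqrt A x) = A x" by (simp_all add: eq R RR)
qed

lemma norm_positive_sqrt:
  fixes A :: "'a::chilbert_space \<Rightarrow> 'a"
  assumes A: "bounded_op UNIV UNIV A" and pos: "positive_op UNIV A"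
  shows "(norm (positive_sqrt A x))\<^sup>2 = Re (cinner (A x) x)"
proof -
  let ?S = "positive_sqrt A"
  have "cinner (?S x) (?S x) = cinner (?S (?S x)) x"
    by (rule positive_op_symmetric[OF positive_sqrt(1,2)[OF assms], symmetric])
  then have "cinner (?S x) (?S x) = cinner (A x) x" unfolding positive_sqrt(3)[OF assms] .
  from arg_cong[OF this, of Re] show ?thesis unfolding cinner_self by simp
qed

lemma csubspace_image:
  assumes A: "bounded_op M N A" and M: "csubspace M" shows "csubspace (A ` M)"
proof -
  have "A 0 = 0" by (rule bounded_op_zero[OF A csubspaceD(1)[OF M]])
  then have "0 \<in> A ` M" using csubspaceD(1)[OF M] by (metis imageI)
  moreover have "A u + A v \<in> A ` M" if "u \<in> M" "v \<in> M" for u v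
    using imageI[OF csubspaceD(2)[OF M that], of A] bounded_opD(2)[OF A that] by simp
  moreover have "c *\<^sub>C A u \<in> A ` M" if "u \<in> M" for c u
    using imageI[OF csubspaceD(3)[OF M that], of A c] bounded_opD(3)[OF A that, of c] by simp
  ultimately show ?thesis unfolding csubspace_def by blast
qed

text \<open>D(T) is defined by the range of the defect, whereas the Berezin kernel takes values in
  the range of its root; this reconciles the two. If \<open>y\<close> is orthogonal to the range of
  \<open>A\<close>, then \<open>cinner (A y) y = 0\<close>, which is the squared norm of the root at
  \<open>y\<close>.\<close>

lemma closure_range_positive_sqrt:
  fixes A :: "'a::chilbert_space \<Rightarrow> 'a"
  assumes A: "bounded_op UNIV UNIV A" and pos: "positive_op UNIV A"
  shows "closure (range (positive_sqrt A)) = closure (range A)"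
proof (rule closed_csubspace_eqI[symmetric])
  let ?R = "positive_sqrt A"
  note R = positive_sqrt(1,2)[OF assms] and RR = positive_sqrt(3)[OF assms]
  show "closed_csubspace (closure (range A))" "closed_csubspace (closure (range ?R))"
    using closed_csubspace_closure[OF csubspace_image[OF _ csubspace_UNIV]] A R(1) by auto
  have "range A \<subseteq> range ?R" by (metis RR image_subset_iff rangeI)
  then show "closure (range A) \<subseteq> closure (range ?R)" by (rule closure_mono)
  fix y assume y: "y \<in> closure (range ?R)" and 0: "\<And>m. m \<in> closure (range A) \<Longrightarrow> cinner y m = 0"
  have "cinner (A y) y = 0" using 0[of "A y"] closure_subset[of "range A"] by (subst cinner_zero_comm) auto
  then have "?R y = 0" using norm_positive_sqrt[OF assms, of y] by simp
  then have "cinner y (?R x) = 0" for x using positive_op_symmetric[OF R, of y x] by simp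
  then have "y \<in> orthocomp_in UNIV (closure (range ?R))"
    unfolding orthocomp_in_closure by (auto simp: orthocomp_in_def)
  then have "cinner y y = 0" using y by (simp add: orthocomp_in_def)
  then show "y = 0" by (simp add: cinner_self_eq_0)
qed

section \<open>Square-summable families\<close>

lemma ell2_eqI: "(\<And>i. coord f i = coord g i) \<Longrightarrow> f = g"
  using coord_inject by blast

lemma coord_Abs_ell2: "(\<lambda>i. (norm (f i))\<^sup>2) summable_on UNIV \<Longrightarrow> coord (Abs_ell2 f) = f"
  by (simp add: Abs_ell2_inverse)

lemmas coord_simps = zero_ell2.rep_eq plus_ell2.rep_eq minus_ell2.rep_eq uminus_ell2.rep_eq
  scaleC_ell2.rep_eq

lemma coord_sum: "coord (sum f S) i = (\<Sum>s\<in>S. coord (f s) i)"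
  by (induction S rule: infinite_finite_induct) (auto simp: coord_simps)

lemma tendsto_coord: "X \<longlonglongrightarrow> l \<Longrightarrow> (\<lambda>n. coord (X n) i) \<longlonglongrightarrow> coord l i"
proof -
  assume X: "X \<longlonglongrightarrow> l"
  have "(\<lambda>n. coord (X n) i - coord l i) \<longlonglongrightarrow> 0"
  proof (rule Lim_null_comparison)
    show "\<forall>\<^sub>F n in sequentially. norm (coord (X n) i - coord l i) \<le> norm (X n - l)"
      using norm_coord_le[of "X _ - l" i] by (simp add: coord_simps)
    show "(\<lambda>n. norm (X n - l)) \<longlonglongrightarrow> 0" using X by (simp add: LIM_zero tendsto_norm_zero)
  qed
  then show ?thesis by (simp add: LIM_zero_iff)
qed

lemma cinner_ell2_support:
  assumes "\<And>i. i \<notin> S \<Longrightarrow> cinner (coord f i) (coord g i) = 0"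
  shows "cinner f g = (\<Sum>\<^sub>\<infinity>i\<in>S. cinner (coord f i) (coord g i))"
  unfolding cinner_ell2_def by (rule infsum_cong_neutral) (use assms in auto)

lemma norm_ell2_support:
  assumes "\<And>i. i \<notin> S \<Longrightarrow> coord f i = 0"
  shows "(norm f)\<^sup>2 = (\<Sum>\<^sub>\<infinity>i\<in>S. (norm (coord f i))\<^sup>2)"
  unfolding norm_ell2_infsum by (rule infsum_cong_neutral) (use assms in auto)

lemma coord_summable_on: "(\<lambda>i. (norm (coord f i))\<^sup>2) summable_on S"
  by (rule summable_on_subset[OF coord_summable]) simp

lemma cinner_single: "cinner f (single i x) = cinner (coord f i) x"
proof -
  have "cinner f (single i x) = (\<Sum>\<^sub>\<infinity>j\<in>{i}. cinner (coord f j) (coord (single i x) j))"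
    by (rule cinner_ell2_support) (simp add: single.rep_eq)
  then show ?thesis by (simp add: single.rep_eq)
qed

text \<open>Serves to evaluate \<open>berezin\<close>, an infinite sum of elementary tensors. By
  orthogonality the squared distance of a finite partial sum from \<open>f\<close> is the missing
  part of the squared norm.\<close>

lemma has_sum_single:
  assumes "\<And>i. i \<notin> S \<Longrightarrow> coord f i = 0"
  shows "((\<lambda>i. single i (coord f i)) has_sum f) S"
proof -
  let ?s = "\<lambda>F. \<Sum>i\<in>F. single i (coord f i)"
  have eq: "(norm (?s F - f))\<^sup>2 = (norm f)\<^sup>2 - (\<Sum>i\<in>F. (norm (coord f i))\<^sup>2)" if F: "finite F" for F
  proof -
    have c: "coord (?s F) i = (if i \<in> F then coord f i else 0)" for i
      using F by (simp add: coord_sum single.rep_eq)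
    have fs: "cinner f (?s F) = of_real (\<Sum>i\<in>F. (norm (coord f i))\<^sup>2)"
      by (simp add: cinner_sum_right cinner_single cinner_self)
    have ss: "cinner (?s F) (?s F) = of_real (\<Sum>i\<in>F. (norm (coord f i))\<^sup>2)"
      by (subst cinner_sum_right) (simp add: cinner_single c cinner_self)
    have "cinner (?s F - f) (?s F - f)
        = cinner (?s F) (?s F) - cinner f (?s F) - cnj (cinner f (?s F)) + cinner f f"
      by (simp only: cinner_diff_left cinner_diff_right cinner_commute[of "?s F" f]) simp
    then have "of_real ((norm (?s F - f))\<^sup>2)
        = complex_of_real ((norm f)\<^sup>2 - (\<Sum>i\<in>F. (norm (coord f i))\<^sup>2))"
      unfolding fs ss by (simp only: cinner_self complex_cnj_complex_of_real) simp
    then show ?thesis by (simp only: of_real_eq_iff)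
  qed
  have "((\<lambda>i. (norm (coord f i))\<^sup>2) has_sum (norm f)\<^sup>2) S"
    using has_sum_infsum[OF coord_summable_on, of f S] norm_ell2_support[of S f] assms by simp
  then have "(sum (\<lambda>i. (norm (coord f i))\<^sup>2) \<longlongrightarrow> (norm f)\<^sup>2) (finite_subsets_at_top S)"
    by (simp add: has_sum_def)
  then have "((\<lambda>F. (norm f)\<^sup>2 - (\<Sum>i\<in>F. (norm (coord f i))\<^sup>2)) \<longlongrightarrow> 0) (finite_subsets_at_top S)"
    using tendsto_diff[OF tendsto_const[of "(norm f)\<^sup>2"]] by fastforce
  then have "((\<lambda>F. (norm (?s F - f))\<^sup>2) \<longlongrightarrow> 0) (finite_subsets_at_top S)"
    by (rule Lim_transform_eventually) (auto simp: eventually_finite_subsets_at_top eq)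
  from tendsto_real_sqrt[OF this] have "(?s \<longlongrightarrow> f) (finite_subsets_at_top S)"
    by (simp add: tendsto_norm_zero_iff LIM_zero_iff)
  then show ?thesis by (simp add: has_sum_def)
qed

section \<open>The full Fock space and the universal model\<close>

lemma closed_csubspace_fock:
  assumes E: "closed_csubspace E" shows "closed_csubspace (fock k n E)"
  unfolding closed_csubspace_def
proof
  note sub = csubspaceD[OF closed_csubspaceD(1)[OF E]]
  show "csubspace (fock k n E)"
    by (auto simp: csubspace_def fock_def coord_simps sub)
  show "closed (fock k n E)" unfolding closed_sequential_limits
  proof (intro allI impI, elim conjE)
    fix X l assume X: "\<forall>m. X m \<in> fock k n E" "X \<longlonglongrightarrow> l"
    note lim = tendsto_coord[OF X(2)]
    have "coord l \<alpha> \<in> E" if "\<alpha> \<in> multiwords k n" for \<alpha>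
    proof (rule closed_sequentially[OF closed_csubspaceD(2)[OF E] _ lim])
      show "coord (X m) \<alpha> \<in> E" for m using X(1) that by (simp add: fock_def)
    qed
    moreover have "coord l \<alpha> = 0" if "\<alpha> \<notin> multiwords k n" for \<alpha>
      by (rule LIMSEQ_unique[OF lim]) (use X(1) that in \<open>simp add: fock_def\<close>)
    ultimately show "l \<in> fock k n E" by (simp add: fock_def)
  qed
qed

lemma fockD:
  assumes "f \<in> fock k n E"
  shows "\<alpha> \<in> multiwords k n \<Longrightarrow> coord f \<alpha> \<in> E" "\<alpha> \<notin> multiwords k n \<Longrightarrow> coord f \<alpha> = 0"
  using assms by (auto simp: fock_def)

lemma zero_fock: "0 \<in> fock k n UNIV"
  by (simp add: fock_def coord_simps)

lemma fock_mono: "f \<in> fock k n E \<Longrightarrow> E \<subseteq> E' \<Longrightarrow> f \<in> fock k n E'"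
  by (auto simp: fock_def)

definition push :: "nat \<Rightarrow> nat \<Rightarrow> multiword \<Rightarrow> multiword" where
  "push i s \<alpha> = \<alpha>(i := s # \<alpha> i)"

lemma push_apply: "push i s \<alpha> j = (if j = i then s # \<alpha> i else \<alpha> j)"
  by (simp add: push_def)

lemma push_inject: "push i s \<alpha> = push i t \<beta> \<longleftrightarrow> s = t \<and> \<alpha> = \<beta>"
proof
  assume eq: "push i s \<alpha> = push i t \<beta>"
  have "\<alpha> j = \<beta> j" for j using fun_cong[OF eq, of j] by (auto simp: push_def split: if_splits)
  then show "s = t \<and> \<alpha> = \<beta>" using fun_cong[OF eq, of i] by (auto simp: push_def)
qed simp

lemma inj_push: "inj_on (push i s) A"
  by (auto simp: inj_on_def push_inject)

lemma push_commute: "i \<noteq> j \<Longrightarrow> push i s (push j t \<alpha>) = push j t (push i s \<alpha>)"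
  by (auto simp: push_def fun_upd_twist)

lemma push_multiwords: "push i s \<alpha> \<in> multiwords k n \<longleftrightarrow> i \<in> {1..k} \<and> s \<in> {1..n i} \<and> \<alpha> \<in> multiwords k n"
  by (auto simp: multiwords_def push_def split: if_splits)

lemma push_upd: "\<alpha> i = s # w \<Longrightarrow> push i s (\<alpha>(i := w)) = \<alpha>"
  by (auto simp: push_def fun_eq_iff)

lemma push_cases:
  obtains "\<alpha> i = []" | s \<beta> where "\<alpha> = push i s \<beta>"
proof (cases "\<alpha> i")
  case (Cons s w)
  then have "\<alpha> = push i s (\<alpha>(i := w))" by (simp add: push_upd)
  then show ?thesis using that by blast
qed (use that in blast)

lemma summable_on_push: "(\<And>\<gamma>. \<gamma> \<notin> range (push i s) \<Longrightarrow> F \<gamma> = 0) \<Longrightarrow>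
    F summable_on UNIV \<longleftrightarrow> (\<lambda>\<alpha>. F (push i s \<alpha>)) summable_on UNIV"
  using summable_on_reindex[OF inj_push[of i s UNIV], of F]
    summable_on_cong_neutral[of UNIV "range (push i s)" F F] by (simp add: comp_def)

lemma infsum_push: "(\<And>\<gamma>. \<gamma> \<notin> range (push i s) \<Longrightarrow> F \<gamma> = 0) \<Longrightarrow>
    infsum F UNIV = infsum (\<lambda>\<alpha>. F (push i s \<alpha>)) UNIV"
  using infsum_reindex[OF inj_push[of i s UNIV], of F]
    infsum_cong_neutral[of UNIV "range (push i s)" F F] by (simp add: comp_def)

section \<open>Weights, shifts and their commutation relations\<close>

locale phases =
  fixes k :: nat and n :: "nat \<Rightarrow> nat" and lam :: "nat \<Rightarrow> nat \<Rightarrow> nat \<Rightarrow> nat \<Rightarrow> complex"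
  assumes cmod_lam: "\<lbrakk>i \<in> {1..k}; j \<in> {1..k}; i \<noteq> j; s \<in> {1..n i}; t \<in> {1..n j}\<rbrakk> \<Longrightarrow> cmod (lam i j s t) = 1"
    and lam_swap: "\<lbrakk>i \<in> {1..k}; j \<in> {1..k}; i \<noteq> j; s \<in> {1..n i}; t \<in> {1..n j}\<rbrakk> \<Longrightarrow> lam j i t s = cnj (lam i j s t)"
begin

abbreviation "mw \<equiv> multiwords k n"
abbreviation "letter i s \<equiv> i \<in> {1..k} \<and> s \<in> {1..n i}"
abbreviation "F E \<equiv> fock k n E"
abbreviation "S \<equiv> model lam"
abbreviation "c \<equiv> shift_coeff lam"

lemma csubspace_F: "csubspace E \<Longrightarrow> csubspace (F E)"
  by (auto simp: csubspace_def fock_def coord_simps)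

lemma lam_cnj: "\<lbrakk>i \<in> {1..k}; j \<in> {1..k}; i \<noteq> j; s \<in> {1..n i}; t \<in> {1..n j}\<rbrakk> \<Longrightarrow> lam i j s t * cnj (lam i j s t) = 1"
  using cmod_lam[of i j s t] by (simp add: complex_norm_square[symmetric])

lemma cmod_shift_coeff:
  assumes "letter i s" "\<alpha> \<in> mw" shows "cmod (c i s \<alpha>) = 1"
proof -
  have w: "cmod (word_coeff lam i j s w) = 1" if "set w \<subseteq> {1..n j}" "j \<in> {1..k}" "i \<noteq> j" for j w
    using that by (induction w) (use assms cmod_lam in \<open>auto simp: word_coeff_def norm_mult\<close>)
  have "cmod (word_coeff lam i j s (\<alpha> j)) = 1" if "j \<in> {1..<i}" for j
    by (rule w) (use that assms in \<open>auto simp: multiwords_def\<close>)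
  then show ?thesis unfolding shift_coeff_def by (simp add: prod_norm[symmetric])
qed

lemma shift_coeff_cnj: "letter i s \<Longrightarrow> \<alpha> \<in> mw \<Longrightarrow> c i s \<alpha> * cnj (c i s \<alpha>) = 1"
  using cmod_shift_coeff[of i s \<alpha>] by (simp add: complex_norm_square[symmetric])

text \<open>The weight of \<open>S i s\<close> reads only the components below \<open>i\<close>, so
  a letter in front of component \<open>j\<close> changes it by \<open>lam i j s t\<close> when
  \<open>j < i\<close> and not at all when \<open>j > i\<close>. This asymmetry is the source of the
  commutation relations of the model.\<close>

lemma shift_coeff_push:
  assumes "1 \<le> j" "i \<noteq> j"
  shows "c i s (push j t \<alpha>) = (if j < i then lam i j s t else 1) * c i s \<alpha>"
proof (cases "j < i")
  case True
  have *: "c i s \<beta> = word_coeff lam i j s (\<beta> j) * (\<Prod>l\<in>{1..<i} - {j}. word_coeff lam i l s (\<beta> l))" for \<beta>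
    unfolding shift_coeff_def by (rule prod.remove) (use True assms in auto)
  have "(\<Prod>l\<in>{1..<i} - {j}. word_coeff lam i l s (push j t \<alpha> l))
      = (\<Prod>l\<in>{1..<i} - {j}. word_coeff lam i l s (\<alpha> l))"
    by (intro prod.cong) (auto simp: push_apply)
  then show ?thesis using True by (simp add: *[of "push j t \<alpha>"] *[of \<alpha>] push_apply word_coeff_def)
next
  case False
  then have "push j t \<alpha> l = \<alpha> l" if "l \<in> {1..<i}" for l using that by (auto simp: push_apply)
  then show ?thesis using False by (simp add: shift_coeff_def)
qed

lemma model_fun_push:
  "(case push i s \<alpha> i of [] \<Rightarrow> 0 | t # \<beta> \<Rightarrow>
     if t = s then c i s ((push i s \<alpha>)(i := \<beta>)) *\<^sub>C f ((push i s \<alpha>)(i := \<beta>)) else 0) = c i s \<alpha> *\<^sub>C f \<alpha>"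
  by (simp add: push_def)

text \<open>\<open>f\<close> has to live on the multiwords: the weights have modulus one there, and
  elsewhere nothing controls them, so the family under \<open>Abs_ell2\<close> might fail to be
  square summable.\<close>

lemma coord_model:
  assumes "letter i s" "f \<in> F UNIV"
  shows coord_model_push: "coord (S i s f) (push i s \<alpha>) = c i s \<alpha> *\<^sub>C coord f \<alpha>"
    and coord_model_other: "\<gamma> \<notin> range (push i s) \<Longrightarrow> coord (S i s f) \<gamma> = 0"
    and coord_model_neq: "t \<noteq> s \<Longrightarrow> coord (S i s f) (push i t \<alpha>) = 0"
proof -
  define G where "G = (\<lambda>\<gamma>. case \<gamma> i of [] \<Rightarrow> 0 | t # \<beta> \<Rightarrow>
     if t = s then c i s (\<gamma>(i := \<beta>)) *\<^sub>C coord f (\<gamma>(i := \<beta>)) else 0)"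
  have Gp: "G (push i s \<alpha>) = c i s \<alpha> *\<^sub>C coord f \<alpha>" for \<alpha>
    unfolding G_def by (rule model_fun_push)
  have G0: "G \<gamma> = 0" if "\<gamma> \<notin> range (push i s)" for \<gamma>
  proof (cases "\<gamma> i")
    case (Cons t \<beta>)
    have "\<gamma> = push i t (\<gamma>(i := \<beta>))" using Cons by (simp add: push_upd)
    then have "t \<noteq> s" using that by (metis rangeI)
    then show ?thesis using Cons by (simp add: G_def)
  qed (simp add: G_def)
  have "(norm (G (push i s \<alpha>)))\<^sup>2 = (norm (coord f \<alpha>))\<^sup>2" for \<alpha>
    using cmod_shift_coeff[OF assms(1)] fockD(2)[OF assms(2)]
    by (cases "\<alpha> \<in> mw") (simp_all add: Gp norm_scaleC)
  then have "(\<lambda>\<gamma>. (norm (G \<gamma>))\<^sup>2) summable_on UNIV"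
    using coord_summable[of f] by (subst summable_on_push[of i s]) (simp_all add: G0)
  then have eq: "coord (S i s f) = G"
    unfolding model_def G_def[symmetric] by (rule coord_Abs_ell2)
  show "coord (S i s f) (push i s \<alpha>) = c i s \<alpha> *\<^sub>C coord f \<alpha>"
    "\<gamma> \<notin> range (push i s) \<Longrightarrow> coord (S i s f) \<gamma> = 0"
    "t \<noteq> s \<Longrightarrow> coord (S i s f) (push i t \<alpha>) = 0"
    unfolding eq by (auto simp: Gp G0) (auto simp: G_def push_def)
qed

text \<open>The adjoint of \<open>S i s\<close> in closed form. It does not refer to the coefficient
  space, so one operator serves every \<open>F E\<close>, and the cutoff outside \<open>mw\<close>
  puts its values into \<open>F UNIV\<close> for every argument.\<close>

definition mstar :: "nat \<Rightarrow> nat \<Rightarrow> (multiword, 'e) ell2 \<Rightarrow> (multiword, 'e::complex_inner) ell2" where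
  "mstar i s f = Abs_ell2 (\<lambda>\<alpha>. if \<alpha> \<in> mw then cnj (c i s \<alpha>) *\<^sub>C coord f (push i s \<alpha>) else 0)"

lemma coord_mstar:
  assumes "letter i s"
  shows "coord (mstar i s f) \<alpha> = (if \<alpha> \<in> mw then cnj (c i s \<alpha>) *\<^sub>C coord f (push i s \<alpha>) else 0)"
proof -
  let ?G = "\<lambda>\<alpha>. if \<alpha> \<in> mw then cnj (c i s \<alpha>) *\<^sub>C coord f (push i s \<alpha>) else 0"
  have "(\<lambda>\<alpha>. (norm (coord f (push i s \<alpha>)))\<^sup>2) summable_on UNIV"
    using summable_on_reindex[OF inj_push[of i s UNIV], of "\<lambda>\<gamma>. (norm (coord f \<gamma>))\<^sup>2"]
      coord_summable_on[of f "range (push i s)"]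
    by (simp add: comp_def)
  then have "(\<lambda>\<alpha>. (norm (?G \<alpha>))\<^sup>2) summable_on UNIV"
    by (rule summable_on_comparison_test) (auto simp: norm_scaleC cmod_shift_coeff[OF assms])
  then show ?thesis unfolding mstar_def by (subst coord_Abs_ell2) auto
qed

lemma mstar_linear:
  assumes "letter i s"
  shows "mstar i s (f + g) = mstar i s f + mstar i s g" "mstar i s (a *\<^sub>C f) = a *\<^sub>C mstar i s f"
  by (rule ell2_eqI; simp add: coord_mstar[OF assms] coord_simps scaleC_add_right scaleC_diff_right
      scaleC_scaleC mult.commute)+

lemma mstar_fock: "letter i s \<Longrightarrow> csubspace E \<Longrightarrow> f \<in> F E \<Longrightarrow> mstar i s f \<in> F E"
  by (auto simp: fock_def coord_mstar push_multiwords intro!: csubspaceD)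

lemma mstar_fock_UNIV: "letter i s \<Longrightarrow> mstar i s f \<in> F UNIV"
  by (auto simp: fock_def coord_mstar)

lemma model_fock:
  assumes l: "letter i s" and E: "csubspace E" and f: "f \<in> F E" shows "S i s f \<in> F E"
proof -
  have f': "f \<in> F UNIV" using fock_mono[OF f] by simp
  have "(\<gamma> \<in> mw \<longrightarrow> coord (S i s f) \<gamma> \<in> E) \<and> (\<gamma> \<notin> mw \<longrightarrow> coord (S i s f) \<gamma> = 0)" for \<gamma>
  proof (cases "\<gamma> \<in> range (push i s)")
    case True
    then obtain \<alpha> where "\<gamma> = push i s \<alpha>" by blast
    then show ?thesis using fockD[OF f, of \<alpha>] l
      by (auto simp: coord_model_push[OF l f'] push_multiwords intro!: csubspaceD[OF E])
  qed (simp add: coord_model_other[OF l f'] csubspaceD[OF E])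
  then show ?thesis by (simp add: fock_def)
qed

lemma model_linear:
  assumes "letter i s" "f \<in> F UNIV" "g \<in> F UNIV"
  shows "S i s (f + g) = S i s f + S i s g" "S i s (a *\<^sub>C f) = a *\<^sub>C S i s f"
proof -
  have sub: "csubspace (F UNIV)" by (rule closed_csubspaceD(1)[OF closed_csubspace_fock]) simp
  have "coord (S i s (f + g)) \<gamma> = coord (S i s f + S i s g) \<gamma> \<and>
      coord (S i s (a *\<^sub>C f)) \<gamma> = coord (a *\<^sub>C S i s f) \<gamma>" for \<gamma>
  proof (cases "\<gamma> \<in> range (push i s)")
    case True
    then obtain \<alpha> where \<gamma>: "\<gamma> = push i s \<alpha>" by blast
    show ?thesis
      by (simp add: \<gamma> coord_model_push[OF assms(1)] assms csubspaceD[OF sub] coord_simps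
          scaleC_add_right scaleC_scaleC mult.commute)
  qed (simp add: coord_model_other[OF assms(1)] assms csubspaceD[OF sub] coord_simps)
  then show "S i s (f + g) = S i s f + S i s g" "S i s (a *\<^sub>C f) = a *\<^sub>C S i s f"
    by (auto intro: ell2_eqI)
qed

lemma norm_model:
  assumes "letter i s" "f \<in> F UNIV" shows "norm (S i s f) = norm f"
proof -
  have "(norm (S i s f))\<^sup>2 = (\<Sum>\<^sub>\<infinity>\<alpha>. (norm (coord (S i s f) (push i s \<alpha>)))\<^sup>2)"
    unfolding norm_ell2_infsum by (rule infsum_push) (simp add: coord_model_other[OF assms])
  also have "\<dots> = (norm f)\<^sup>2" unfolding norm_ell2_infsum
  proof (rule infsum_cong)
    show "(norm (coord (S i s f) (push i s \<alpha>)))\<^sup>2 = (norm (coord f \<alpha>))\<^sup>2" for \<alpha>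
      using cmod_shift_coeff[OF assms(1)] fockD(2)[OF assms(2)]
      by (cases "\<alpha> \<in> mw") (simp_all add: coord_model_push[OF assms] norm_scaleC)
  qed
  finally show ?thesis by (simp add: power2_eq_iff_nonneg)
qed

lemma bounded_op_model: "letter i s \<Longrightarrow> csubspace E \<Longrightarrow> bounded_op (F E) (F E) (S i s)"
  by (rule bounded_opI[of _ _ _ 1])
    (auto simp: model_fock model_linear(1) model_linear(2)[of i s _ 0] norm_model fock_mono[of _ k n E UNIV] zero_fock)

lemma cinner_model:
  assumes "letter i s" "f \<in> F UNIV" shows "cinner (S i s f) g = cinner f (mstar i s g)"
proof -
  have "cinner (S i s f) g = (\<Sum>\<^sub>\<infinity>\<alpha>. cinner (coord (S i s f) (push i s \<alpha>)) (coord g (push i s \<alpha>)))"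
    unfolding cinner_ell2_def by (rule infsum_push) (simp add: coord_model_other[OF assms])
  also have "\<dots> = cinner f (mstar i s g)" unfolding cinner_ell2_def
  proof (rule infsum_cong)
    show "cinner (coord (S i s f) (push i s \<alpha>)) (coord g (push i s \<alpha>))
        = cinner (coord f \<alpha>) (coord (mstar i s g) \<alpha>)" for \<alpha>
      using fockD(2)[OF assms(2)]
      by (cases "\<alpha> \<in> mw") (simp_all add: coord_model_push[OF assms] coord_mstar[OF assms(1)] cinner_simps)
  qed
  finally show ?thesis .
qed

lemma cinner_mstar: "letter i s \<Longrightarrow> f \<in> F UNIV \<Longrightarrow> cinner (mstar i s g) f = cinner g (S i s f)"
  by (metis cinner_model cinner_commute)

lemma cadjoint_model:
  assumes "letter i s" "closed_csubspace E" "f \<in> F E"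
  shows "cadjoint (F E) (S i s) f = mstar i s f"
proof (rule cadjoint_eqI)
  show "csubspace (F E)" by (intro closed_csubspaceD closed_csubspace_fock assms)
  show "mstar i s f \<in> F E" by (intro mstar_fock assms closed_csubspaceD)
  show "cinner (S i s z) f = cinner z (mstar i s f)" if "z \<in> F E" for z
    by (rule cinner_model[OF assms(1) fock_mono[OF that]]) simp
qed

lemma mstar_model:
  assumes "letter i s" "letter i t" "f \<in> F UNIV"
  shows "mstar i s (S i t f) = (if s = t then f else 0)"
proof (rule ell2_eqI)
  fix \<alpha>
  show "coord (mstar i s (S i t f)) \<alpha> = coord (if s = t then f else 0) \<alpha>"
    using fockD(2)[OF assms(3), of \<alpha>] shift_coeff_cnj[OF assms(1), of \<alpha>]
    by (auto simp: coord_mstar[OF assms(1)] coord_model_push[OF assms(2,3)]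
        coord_model_neq[OF assms(2,3)] coord_simps scaleC_scaleC mult.commute)
qed

text \<open>Both orders read the same coordinate of \<open>f\<close>, so only weights are compared.
  Exactly one order picks up a phase, depending on whether \<open>i < j\<close>, and
  \<open>lam_swap\<close> makes the two cases agree.\<close>

lemma mstar_mstar:
  assumes "letter i s" "letter j t" "i \<noteq> j"
  shows "mstar i s (mstar j t f) = lam i j s t *\<^sub>C mstar j t (mstar i s f)"
proof (rule ell2_eqI)
  fix \<alpha>
  show "coord (mstar i s (mstar j t f)) \<alpha> = coord (lam i j s t *\<^sub>C mstar j t (mstar i s f)) \<alpha>"
  proof (cases "\<alpha> \<in> mw")
    case True
    have sw: "lam j i t s = cnj (lam i j s t)" and u: "lam i j s t * cnj (lam i j s t) = 1"
      using assms by (auto intro: lam_swap lam_cnj)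
    have "(cnj (c i s \<alpha>) * cnj (c j t (push i s \<alpha>))) = lam i j s t * (cnj (c j t \<alpha>) * cnj (c i s (push j t \<alpha>)))"
    proof (cases "i < j")
      case True
      then show ?thesis using assms by (simp add: shift_coeff_push sw)
    next
      case False
      then have "lam i j s t * (cnj (c j t \<alpha>) * cnj (c i s (push j t \<alpha>)))
          = (lam i j s t * cnj (lam i j s t)) * (cnj (c j t \<alpha>) * cnj (c i s \<alpha>))"
        using assms by (simp add: shift_coeff_push)
      also have "\<dots> = cnj (c i s \<alpha>) * cnj (c j t (push i s \<alpha>))"
        using assms False by (simp add: u shift_coeff_push)
      finally show ?thesis by simp
    qed
    then show ?thesis using assms True
      by (simp add: coord_mstar coord_simps push_multiwords scaleC_scaleC push_commute)
  qed (use assms in \<open>simp add: coord_mstar coord_simps\<close>)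
qed

lemma mstar_model_commute:
  assumes "letter i s" "letter j t" "i \<noteq> j" "f \<in> F UNIV"
  shows "mstar i s (S j t f) = cnj (lam i j s t) *\<^sub>C S j t (mstar i s f)"
proof (rule ell2_eqI)
  fix \<alpha>
  have sw: "lam j i t s = cnj (lam i j s t)" using assms by (auto intro: lam_swap)
  note m = coord_model_push[OF assms(2)] coord_model_other[OF assms(2)] coord_mstar[OF assms(1)]
  have fi: "mstar i s f \<in> F UNIV" by (rule mstar_fock_UNIV[OF assms(1)])
  show "coord (mstar i s (S j t f)) \<alpha> = coord (cnj (lam i j s t) *\<^sub>C S j t (mstar i s f)) \<alpha>"
  proof (cases "\<alpha> \<in> range (push j t)")
    case True
    then obtain \<beta> where \<alpha>: "\<alpha> = push j t \<beta>" by blast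
    have "cnj (c i s (push j t \<beta>)) * c j t (push i s \<beta>) = cnj (lam i j s t) * (c j t \<beta> * cnj (c i s \<beta>))"
      using assms by (simp add: shift_coeff_push sw)
    then show ?thesis using assms
      by (simp add: \<alpha> m fi push_multiwords coord_simps push_commute[of i j] scaleC_scaleC mult.assoc)
  next
    case False
    \<comment> \<open>A letter put in front of component \<open>i\<close> leaves the head of
      component \<open>j\<close> alone.\<close>
    have "push i s \<alpha> \<notin> range (push j t)"
    proof
      assume "push i s \<alpha> \<in> range (push j t)"
      then obtain \<beta> where "push i s \<alpha> = push j t \<beta>" by blast
      from fun_cong[OF this, of j] have "\<alpha> j = t # \<beta> j" using assms(3) by (simp add: push_apply)
      then have "\<alpha> = push j t (\<alpha>(j := \<beta> j))" by (simp add: push_upd)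
      then show False using False by blast
    qed
    then show ?thesis using False by (simp add: m assms fi coord_simps)
  qed
qed

lemma model_commute:
  assumes "letter i s" "letter j t" "i \<noteq> j" "f \<in> F UNIV"
  shows "S i s (S j t f) = lam i j s t *\<^sub>C S j t (S i s f)"
proof (rule csubspace_eqI)
  have cs: "closed_csubspace (F UNIV)" by (rule closed_csubspace_fock) simp
  show sub: "csubspace (F UNIV)" using cs by (rule closed_csubspaceD)
  show "S i s (S j t f) \<in> F UNIV" "lam i j s t *\<^sub>C S j t (S i s f) \<in> F UNIV"
    by (intro csubspaceD[OF sub] model_fock csubspace_UNIV assms)+
  fix z :: "(multiword, 'a) ell2" assume "z \<in> F UNIV"
  have "mstar j t (mstar i s z) = lam j i t s *\<^sub>C mstar i s (mstar j t z)"
    by (rule mstar_mstar) (use assms in auto)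
  moreover have "lam j i t s = cnj (lam i j s t)" using assms by (auto intro: lam_swap)
  ultimately show "cinner z (S i s (S j t f)) = cinner z (lam i j s t *\<^sub>C S j t (S i s f))"
    using assms by (simp add: cinner_mstar[symmetric] model_fock cinner_simps)
qed

subsection \<open>Coordinate sums\<close>

text \<open>Squared norm of the part of \<open>f\<close> on the multiwords satisfying
  \<open>P\<close>. The forms obtained from the identity operator on the model are all of this
  diagonal type.\<close>

definition wsum :: "(multiword \<Rightarrow> bool) \<Rightarrow> (multiword, 'e::complex_inner) ell2 \<Rightarrow> real" where
  "wsum P f = (\<Sum>\<^sub>\<infinity>\<alpha>\<in>{\<alpha>\<in>mw. P \<alpha>}. (norm (coord f \<alpha>))\<^sup>2)"

lemma wsum_nonneg: "0 \<le> wsum P f"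
  unfolding wsum_def by (rule infsum_nonneg) simp

lemma wsum_True: "f \<in> F E \<Longrightarrow> wsum (\<lambda>_. True) f = (norm f)\<^sup>2"
  unfolding wsum_def by (subst norm_ell2_support[of mw]) (simp_all add: fockD)

lemma wsum_split: "wsum (\<lambda>\<alpha>. P \<alpha> \<and> Q \<alpha>) f = wsum P f - wsum (\<lambda>\<alpha>. P \<alpha> \<and> \<not> Q \<alpha>) f"
proof -
  have "wsum P f = (\<Sum>\<^sub>\<infinity>\<alpha>\<in>{\<alpha>\<in>mw. P \<alpha> \<and> Q \<alpha>} \<union> {\<alpha>\<in>mw. P \<alpha> \<and> \<not> Q \<alpha>}. (norm (coord f \<alpha>))\<^sup>2)"
    unfolding wsum_def by (rule arg_cong[of _ _ "infsum _"]) auto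
  also have "\<dots> = wsum (\<lambda>\<alpha>. P \<alpha> \<and> Q \<alpha>) f + wsum (\<lambda>\<alpha>. P \<alpha> \<and> \<not> Q \<alpha>) f"
    unfolding wsum_def by (rule infsum_Un_disjoint) (auto intro: coord_summable_on)
  finally show ?thesis by simp
qed

text \<open>Removing the first letter of component \<open>i\<close> sorts the words in
  \<open>Q\<close> by that letter, and weights of modulus one do not affect norms.\<close>

lemma wsum_mstar:
  assumes i: "i \<in> {1..k}" and PQ: "\<And>s \<alpha>. P \<alpha> \<longleftrightarrow> Q (push i s \<alpha>)" and Q: "\<And>\<gamma>. Q \<gamma> \<Longrightarrow> \<gamma> i \<noteq> []"
  shows "(\<Sum>s=1..n i. wsum P (mstar i s f)) = wsum Q f"
proof -
  have "wsum P (mstar i s f) = (\<Sum>\<^sub>\<infinity>\<gamma>\<in>push i s ` {\<alpha>\<in>mw. P \<alpha>}. (norm (coord f \<gamma>))\<^sup>2)" if "s \<in> {1..n i}" for s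
    unfolding wsum_def infsum_reindex[OF inj_push]
    by (rule infsum_cong) (use i that in \<open>simp add: coord_mstar norm_scaleC cmod_shift_coeff\<close>)
  then have "(\<Sum>s=1..n i. wsum P (mstar i s f))
      = (\<Sum>s=1..n i. \<Sum>\<^sub>\<infinity>\<gamma>\<in>push i s ` {\<alpha>\<in>mw. P \<alpha>}. (norm (coord f \<gamma>))\<^sup>2)" by simp
  also have "\<dots> = (\<Sum>\<^sub>\<infinity>\<gamma>\<in>(\<Union>s\<in>{1..n i}. push i s ` {\<alpha>\<in>mw. P \<alpha>}). (norm (coord f \<gamma>))\<^sup>2)"
    by (rule sum_infsum) (auto simp: coord_summable_on push_inject)
  also have "(\<Union>s\<in>{1..n i}. push i s ` {\<alpha>\<in>mw. P \<alpha>}) = {\<gamma>\<in>mw. Q \<gamma>}"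
  proof (intro equalityI subsetI)
    fix \<gamma> assume \<gamma>: "\<gamma> \<in> {\<gamma>\<in>mw. Q \<gamma>}"
    then obtain s \<beta> where eq: "\<gamma> = push i s \<beta>" using Q push_cases[of \<gamma> i] by blast
    with \<gamma> show "\<gamma> \<in> (\<Union>s\<in>{1..n i}. push i s ` {\<alpha>\<in>mw. P \<alpha>})"
      using PQ by (auto simp: push_multiwords)
  qed (use i PQ in \<open>auto simp: push_multiwords\<close>)
  finally show ?thesis by (simp add: wsum_def)
qed

lemma norm_mstar_row_le:
  assumes "i \<in> {1..k}" shows "(\<Sum>s=1..n i. (norm (mstar i s f))\<^sup>2) \<le> (norm f)\<^sup>2"
proof -
  have "(\<Sum>s=1..n i. (norm (mstar i s f))\<^sup>2) = (\<Sum>s=1..n i. wsum (\<lambda>_. True) (mstar i s f))"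
    using assms by (intro sum.cong refl wsum_True[symmetric, of _ UNIV] mstar_fock_UNIV) auto
  also have "\<dots> = wsum (\<lambda>\<alpha>. \<alpha> i \<noteq> []) f" by (rule wsum_mstar[OF assms]) (auto simp: push_apply)
  also have "\<dots> \<le> (norm f)\<^sup>2" unfolding wsum_def norm_ell2_infsum
    by (rule infsum_mono_neutral) (auto intro: coord_summable_on)
  finally show ?thesis .
qed

text \<open>This is purity of the model. Finitely many multiwords carry all but \<open>e\<close> of
  the squared norm, and from some length on the condition excludes every one of them.\<close>

lemma wsum_length_tendsto: "(\<lambda>p. wsum (\<lambda>\<alpha>. p \<le> length (\<alpha> i)) f) \<longlonglongrightarrow> 0"
proof (rule LIMSEQ_I)
  fix e :: real assume e: "e > 0"
  let ?g = "\<lambda>\<alpha>. (norm (coord f \<alpha>))\<^sup>2"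
  have "(sum ?g \<longlongrightarrow> infsum ?g mw) (finite_subsets_at_top mw)"
    using has_sum_infsum[OF coord_summable_on, of f mw] by (simp add: has_sum_def)
  from tendstoD[OF this e] obtain X where X: "finite X" "X \<subseteq> mw" "dist (sum ?g X) (infsum ?g mw) < e"
    by (auto simp: eventually_finite_subsets_at_top)
  define N where "N = Suc (Max (insert 0 ((\<lambda>\<alpha>. length (\<alpha> i)) ` X)))"
  have N: "length (\<alpha> i) < N" if "\<alpha> \<in> X" for \<alpha>
    unfolding N_def less_Suc_eq_le by (rule Max_ge) (use X that in auto)
  have "norm (wsum (\<lambda>\<alpha>. p \<le> length (\<alpha> i)) f - 0) < e" if p: "p \<ge> N" for p
  proof -
    have "wsum (\<lambda>\<alpha>. p \<le> length (\<alpha> i)) f \<le> infsum ?g (mw - X)" unfolding wsum_def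
      by (rule infsum_mono_neutral) (use N p in \<open>auto intro!: coord_summable_on dest: N\<close>)
    also have "\<dots> = infsum ?g mw - sum ?g X"
      using infsum_Un_disjoint[of ?g X "mw - X"] X by (simp add: coord_summable_on Un_absorb1)
    also have "\<dots> < e" using X(3) by (simp add: dist_real_def)
    finally show ?thesis using wsum_nonneg[of "\<lambda>\<alpha>. p \<le> length (\<alpha> i)" f] by simp
  qed
  then show "\<exists>N. \<forall>p\<ge>N. norm (wsum (\<lambda>\<alpha>. p \<le> length (\<alpha> i)) f - 0) < e" by blast
qed

subsection \<open>Ampliations\<close>

definition amp :: "('e \<Rightarrow> 'f) \<Rightarrow> (multiword, 'e::complex_inner) ell2 \<Rightarrow> (multiword, 'f::complex_inner) ell2" where
  "amp J f = Abs_ell2 (\<lambda>\<alpha>. if \<alpha> \<in> mw then J (coord f \<alpha>) else 0)"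

context
  fixes J :: "'e::complex_inner \<Rightarrow> 'f::complex_inner" and E :: "'e set" and E' :: "'f set"
  assumes J: "bounded_op E E' J" and E: "csubspace E"
begin

lemma coord_amp:
  assumes "f \<in> F E" shows "coord (amp J f) \<alpha> = (if \<alpha> \<in> mw then J (coord f \<alpha>) else 0)"
proof -
  obtain C where C: "C > 0" "\<And>x. x \<in> E \<Longrightarrow> norm (J x) \<le> C * norm x" by (rule bounded_op_bound[OF J]) auto
  have "(\<lambda>\<alpha>. C\<^sup>2 * (norm (coord f \<alpha>))\<^sup>2) summable_on UNIV"
    by (intro summable_on_cmult_right coord_summable)
  then have "(\<lambda>\<alpha>. (norm (if \<alpha> \<in> mw then J (coord f \<alpha>) else 0))\<^sup>2) summable_on UNIV"
  proof (rule summable_on_comparison_test)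
    show "(norm (if \<alpha> \<in> mw then J (coord f \<alpha>) else 0))\<^sup>2 \<le> C\<^sup>2 * (norm (coord f \<alpha>))\<^sup>2" for \<alpha>
      using C(2)[OF fockD(1)[OF assms], of \<alpha>] by (auto simp: power_mult_distrib[symmetric] intro: power_mono)
  qed auto
  then show ?thesis unfolding amp_def by (subst coord_Abs_ell2) auto
qed

lemma bounded_op_amp: "bounded_op (F E) (F E') (amp J)"
proof -
  obtain C where C: "C > 0" "\<And>x. x \<in> E \<Longrightarrow> norm (J x) \<le> C * norm x" by (rule bounded_op_bound[OF J]) auto
  note sub = csubspaceD[OF csubspace_F[OF E]]
  show ?thesis
  proof (rule bounded_opI[of _ _ _ C])
    show "amp J f \<in> F E'" if "f \<in> F E" for f
      using that bounded_opD(1)[OF J] by (auto simp: fock_def[of k n E'] coord_amp fockD)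
    show "amp J (f + g) = amp J f + amp J g" if "f \<in> F E" "g \<in> F E" for f g
      by (rule ell2_eqI) (simp add: that sub coord_amp coord_simps bounded_opD(2)[OF J] fockD(1)[OF that(1)] fockD(1)[OF that(2)])
    show "amp J (a *\<^sub>C f) = a *\<^sub>C amp J f" if "f \<in> F E" for a f
      by (rule ell2_eqI) (simp add: that sub coord_amp coord_simps bounded_opD(3)[OF J] fockD(1)[OF that])
    show "norm (amp J f) \<le> C * norm f" if f: "f \<in> F E" for f
    proof (rule power2_le_imp_le)
      have "(norm (amp J f))\<^sup>2 \<le> (\<Sum>\<^sub>\<infinity>\<alpha>. C\<^sup>2 * (norm (coord f \<alpha>))\<^sup>2)" unfolding norm_ell2_infsum
      proof (rule infsum_mono)
        show "(norm (coord (amp J f) \<alpha>))\<^sup>2 \<le> C\<^sup>2 * (norm (coord f \<alpha>))\<^sup>2" for \<alpha>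
          using C(2)[OF fockD(1)[OF f], of \<alpha>]
          by (auto simp: coord_amp[OF f] power_mult_distrib[symmetric] intro: power_mono)
      qed (intro summable_on_cmult_right coord_summable)+
      then show "(norm (amp J f))\<^sup>2 \<le> (C * norm f)\<^sup>2"
        by (simp add: infsum_cmult_right coord_summable power_mult_distrib norm_ell2_infsum)
    qed (use C in simp)
  qed
qed

lemma amp_model:
  assumes "letter i s" "f \<in> F E" "csubspace E'" shows "amp J (S i s f) = S i s (amp J f)"
proof (rule ell2_eqI)
  fix \<gamma>
  have f: "f \<in> F UNIV" and Sf: "S i s f \<in> F E" and Jf: "amp J f \<in> F UNIV"
    using assms fock_mono[of _ k n _ UNIV] bounded_opD(1)[OF bounded_op_amp] model_fock[OF assms(1) E] by auto
  have J0: "J 0 = 0" by (rule bounded_op_zero[OF J csubspaceD(1)[OF E]])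
  show "coord (amp J (S i s f)) \<gamma> = coord (S i s (amp J f)) \<gamma>"
  proof (cases "\<gamma> \<in> range (push i s)")
    case True
    then obtain \<alpha> where "\<gamma> = push i s \<alpha>" by blast
    then show ?thesis using assms(1)
      by (auto simp: coord_amp[OF Sf] coord_amp[OF assms(2)] coord_model_push[OF assms(1)] f Jf
          push_multiwords bounded_opD(3)[OF J] fockD[OF assms(2)])
  qed (simp add: coord_amp[OF Sf] coord_model_other[OF assms(1)] f Jf J0)
qed

lemma amp_mstar:
  assumes "letter i s" "f \<in> F E" shows "amp J (mstar i s f) = mstar i s (amp J f)"
  by (rule ell2_eqI)
    (use assms in \<open>simp add: coord_amp mstar_fock[OF _ E] coord_mstar push_multiwords
      bounded_opD(3)[OF J] fockD\<close>)

lemma norm_amp: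
  assumes "\<And>x. x \<in> E \<Longrightarrow> norm (J x) = norm x" "f \<in> F E" shows "norm (amp J f) = norm f"
proof -
  have "(norm (amp J f))\<^sup>2 = (norm f)\<^sup>2" unfolding norm_ell2_infsum
    by (rule infsum_cong) (simp add: coord_amp assms fockD[OF assms(2)])
  then show ?thesis by (simp add: power2_eq_iff_nonneg)
qed

end

end

section \<open>Defects as quadratic forms\<close>

text \<open>The quadratic form of \<open>\<Phi>(X)\<close> is obtained from that of \<open>X\<close> by summing over the adjoint
  operators, so defects are computed on real-valued functions; \<open>A i s\<close> stands for an adjoint.\<close>

context phases
begin

definition phi :: "(nat \<Rightarrow> nat \<Rightarrow> 'a \<Rightarrow> 'a) \<Rightarrow> nat \<Rightarrow> ('a \<Rightarrow> real) \<Rightarrow> 'a \<Rightarrow> real" where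
  "phi A i q x = (\<Sum>s=1..n i. q (A i s x))"

definition dphi :: "(nat \<Rightarrow> nat \<Rightarrow> 'a \<Rightarrow> 'a) \<Rightarrow> nat \<Rightarrow> nat \<Rightarrow> ('a \<Rightarrow> real) \<Rightarrow> 'a \<Rightarrow> real" where
  "dphi A i p q x = q x - (phi A i ^^ p) q x"

text \<open>With \<open>p = Suc 0\<close> this is the form of the defect. General \<open>p\<close>
  gives the product of the factors id - \<Phi>_i^p, which is what the sums over words of length
  below \<open>p\<close> telescope to.\<close>

primrec defect_form :: "(nat \<Rightarrow> nat \<Rightarrow> 'a \<Rightarrow> 'a) \<Rightarrow> nat \<Rightarrow> nat \<Rightarrow> ('a \<Rightarrow> real) \<Rightarrow> 'a \<Rightarrow> real" where
  "defect_form A p 0 q = q"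
| "defect_form A p (Suc j) q = dphi A (Suc j) p (defect_form A p j q)"

lemma dphi_1: "dphi A i (Suc 0) q x = q x - phi A i q x"
  by (simp add: dphi_def)

lemma phi_diff: "phi A i (\<lambda>x. q x - r x) = (\<lambda>x. phi A i q x - phi A i r x)"
  by (simp add: phi_def fun_eq_iff sum_subtractf)

lemma phi_pow_diff: "(phi A i ^^ p) (\<lambda>x. q x - r x) = (\<lambda>x. (phi A i ^^ p) q x - (phi A i ^^ p) r x)"
  by (induction p) (simp_all add: phi_diff)

lemma phi_mono: "(\<And>y. q y \<le> r y) \<Longrightarrow> phi A i q x \<le> phi A i r x"
  by (simp add: phi_def sum_mono)

lemma phi_pow_mono: "(\<And>y. q y \<le> r y) \<Longrightarrow> (phi A i ^^ p) q x \<le> (phi A i ^^ p) r x"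
  by (induction p arbitrary: x) (auto intro: phi_mono)

lemma phi_scale: "phi A i (\<lambda>x. a * q x) = (\<lambda>x. a * phi A i q x)"
  by (simp add: phi_def fun_eq_iff sum_distrib_left)

lemma phi_pow_scale: "(phi A i ^^ p) (\<lambda>x. a * q x) = (\<lambda>x. a * (phi A i ^^ p) q x)"
  by (induction p) (simp_all add: phi_scale)

lemma phi_pow_abs_le:
  assumes "\<And>y. \<bar>q y\<bar> \<le> a * r y" shows "\<bar>(phi A i ^^ p) q x\<bar> \<le> a * (phi A i ^^ p) r x"
proof -
  have "(phi A i ^^ p) q x \<le> (phi A i ^^ p) (\<lambda>y. a * r y) x"
    by (rule phi_pow_mono) (use assms in \<open>simp add: abs_le_iff\<close>)
  moreover have "(phi A i ^^ p) (\<lambda>y. (-1) * q y) x \<le> (phi A i ^^ p) (\<lambda>y. a * r y) x"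
    by (rule phi_pow_mono) (use assms in \<open>simp add: abs_le_iff\<close>)
  ultimately show ?thesis unfolding phi_pow_scale by (simp add: abs_le_iff)
qed

lemma phi_pow_le:
  assumes le: "\<And>x. phi A i q x \<le> a * q x" and a: "0 \<le> a"
  shows "(phi A i ^^ p) q x \<le> a ^ p * q x"
proof (induction p arbitrary: x)
  case (Suc p)
  have "(phi A i ^^ Suc p) q x \<le> phi A i (\<lambda>x. a ^ p * q x) x"
    by (simp add: phi_mono Suc.IH)
  also have "\<dots> = a ^ p * phi A i q x" by (simp add: phi_scale)
  also have "\<dots> \<le> a ^ p * (a * q x)" by (intro mult_left_mono le) (simp add: a)
  finally show ?case by (simp add: mult_ac)
qed simp

lemma phi_pow_nonneg: "(\<And>y. 0 \<le> q y) \<Longrightarrow> 0 \<le> (phi A i ^^ p) q x"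
  using phi_pow_mono[where q = "\<lambda>_. 0" and r = q and A = A and i = i and p = p and x = x]
    phi_pow_scale[where q = q and a = 0 and A = A and i = i and p = p] by simp

text \<open>Each factor at most doubles the bound, since \<open>r\<close> does not grow under any
  \<open>phi A i\<close>.\<close>

lemma defect_form_abs_le:
  assumes q: "\<And>y. \<bar>q y\<bar> \<le> r y" and r: "\<And>i y. i \<in> {1..k} \<Longrightarrow> phi A i r y \<le> r y"
  shows "j \<le> k \<Longrightarrow> \<bar>defect_form A p j q x\<bar> \<le> 2 ^ j * r x"
proof (induction j arbitrary: x)
  case (Suc j)
  have "\<bar>(phi A (Suc j) ^^ p) (defect_form A p j q) x\<bar> \<le> 2 ^ j * (phi A (Suc j) ^^ p) r x"
    by (rule phi_pow_abs_le) (use Suc in simp)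
  also have "\<dots> \<le> 2 ^ j * r x"
    using phi_pow_le[of A "Suc j" r 1 p x] r Suc.prems by simp
  finally show ?case using Suc.IH[of x] Suc.prems by (simp add: dphi_def abs_le_iff)
qed (simp add: q)

text \<open>Each subtracted power is dominated by a multiple of the same power applied to
  \<open>r\<close>, which dies out. In the uses \<open>r\<close> is the squared norm and the last
  hypothesis is purity.\<close>

lemma defect_form_tendsto:
  assumes q: "\<And>y. \<bar>q y\<bar> \<le> r y" and r: "\<And>i y. i \<in> {1..k} \<Longrightarrow> phi A i r y \<le> r y"
    and 0: "\<And>i. i \<in> {1..k} \<Longrightarrow> (\<lambda>p. (phi A i ^^ p) r x) \<longlonglongrightarrow> 0"
  shows "j \<le> k \<Longrightarrow> (\<lambda>p. defect_form A p j q x) \<longlonglongrightarrow> q x"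
proof (induction j)
  case (Suc j)
  have "(\<lambda>p. (phi A (Suc j) ^^ p) (defect_form A p j q) x) \<longlonglongrightarrow> 0"
  proof (rule Lim_null_comparison)
    show "\<forall>\<^sub>F p in sequentially. norm ((phi A (Suc j) ^^ p) (defect_form A p j q) x)
        \<le> 2 ^ j * (phi A (Suc j) ^^ p) r x"
      unfolding real_norm_def
      by (intro always_eventually allI phi_pow_abs_le defect_form_abs_le q r) (use Suc.prems in auto)
    show "(\<lambda>p. 2 ^ j * (phi A (Suc j) ^^ p) r x) \<longlonglongrightarrow> 0"
      by (rule tendsto_mult_right_zero) (use 0 Suc.prems in simp)
  qed
  from tendsto_diff[OF Suc.IH this] Suc.prems show ?case by (simp add: dphi_def)
qed simp

text \<open>The forms depend only on how the adjoints act, so an intertwining \<open>W\<close>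
  carries one into the other. In the uses \<open>W\<close> is the adjoint of a multi-analytic
  operator, the projection onto the complement of the range of \<open>K\<close>, or an
  identification of H with a space of model vectors.\<close>

lemma defect_form_intertwine:
  assumes M: "\<And>i s x. letter i s \<Longrightarrow> x \<in> M \<Longrightarrow> A i s x \<in> M \<and> B i s (W x) = W (A i s x)"
    and q: "\<And>x. x \<in> M \<Longrightarrow> q x = r (W x)"
  shows "j \<le> k \<Longrightarrow> x \<in> M \<Longrightarrow> defect_form A p j q x = defect_form B p j r (W x)"
proof (induction j arbitrary: x)
  case (Suc j)
  have "(phi A (Suc j) ^^ p) (defect_form A p' j q) x = (phi B (Suc j) ^^ p) (defect_form B p' j r) (W x)"
    if x: "x \<in> M" and IH: "\<And>x. x \<in> M \<Longrightarrow> defect_form A p' j q x = defect_form B p' j r (W x)" for p p' x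
    using x
  proof (induction p arbitrary: x)
    case (Suc l)
    then show ?case using M[of "Suc j"] Suc_le_lessD \<open>Suc j \<le> k\<close> by (simp add: phi_def)
  qed (simp add: IH)
  with Suc show ?case by (simp add: dphi_def)
qed (simp add: q)

text \<open>Drops the last factor. Nonnegativity says that \<open>?q\<close> dominates its image
  under \<open>phi A (Suc j)\<close>, hence its images under all powers, and these are bounded below
  by a multiple of \<open>- (a ^ p)\<close>, which tends to 0 because \<open>a < 1\<close>.\<close>

lemma defect_form_descend:
  assumes r: "\<And>i y. i \<in> {1..k} \<Longrightarrow> phi A i r y \<le> a * r y" and a: "0 \<le> a" "a < 1" and r0: "\<And>y. 0 \<le> r y"
    and j: "Suc j \<le> k" and pos: "\<And>y. 0 \<le> defect_form A (Suc 0) (Suc j) r y"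
  shows "0 \<le> defect_form A (Suc 0) j r x"
proof -
  let ?q = "defect_form A (Suc 0) j r"
  have r1: "phi A i r y \<le> r y" if "i \<in> {1..k}" for i y
    using r[OF that, of y] mult_right_mono[of a 1 "r y"] a r0[of y] by simp
  have step: "phi A (Suc j) ?q y \<le> ?q y" for y using pos[of y] by (simp add: dphi_1)
  have "(phi A (Suc j) ^^ p) ?q y \<le> ?q y" for p y
    using phi_pow_le[of A "Suc j" ?q 1 p y] step by simp
  moreover have "- (2 ^ j * (a ^ p * r x)) \<le> (phi A (Suc j) ^^ p) ?q x" for p
  proof -
    have "\<bar>(phi A (Suc j) ^^ p) ?q x\<bar> \<le> 2 ^ j * (phi A (Suc j) ^^ p) r x"
      by (rule phi_pow_abs_le, rule defect_form_abs_le) (use r0 r1 j in auto)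
    also have "\<dots> \<le> 2 ^ j * (a ^ p * r x)"
      by (intro mult_left_mono phi_pow_le a r) (use j in auto)
    finally show ?thesis by simp
  qed
  ultimately have "- (2 ^ j * (a ^ p * r x)) \<le> ?q x" for p using order_trans by blast
  moreover have "(\<lambda>p. - (2 ^ j * (a ^ p * r x))) \<longlonglongrightarrow> - (2 ^ j * (0 * r x))"
    by (intro tendsto_intros LIMSEQ_power_zero) (use a in simp)
  ultimately show ?thesis using LIMSEQ_le_const2 by (metis (no_types, lifting) minus_zero mult_eq_0_iff)
qed

text \<open>\<open>act\<close> is the adjoint of \<open>T\<^sub>1\<^sub>,\<^sub>\<beta>\<^sub>1 \<cdots> T\<^sub>j\<^sub>,\<^sub>\<beta>\<^sub>j\<close>.\<close>

definition act :: "(nat \<Rightarrow> nat \<Rightarrow> 'a \<Rightarrow> 'a) \<Rightarrow> nat \<Rightarrow> multiword \<Rightarrow> 'a \<Rightarrow> 'a" where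
  "act A j \<beta> = fold (\<lambda>i. fold (A i) (\<beta> i)) [1..<Suc j]"

lemma act_0 [simp]: "act A 0 \<beta> x = x" by (simp add: act_def)

lemma act_Suc: "act A (Suc j) \<beta> x = fold (A (Suc j)) (\<beta> (Suc j)) (act A j \<beta> x)"
  by (simp add: act_def)

lemma act_cong: "(\<And>i. i \<in> {1..j} \<Longrightarrow> \<beta> i = \<gamma> i) \<Longrightarrow> act A j \<beta> x = act A j \<gamma> x"
  by (induction j) (auto simp: act_Suc)

lemma sum_words_eq:
  "(\<Sum>w\<in>{w. set w \<subseteq> {1..n i} \<and> length w = l}. q (fold (A i) w x)) = (phi A i ^^ l) q x"
proof (induction l arbitrary: x)
  case (Suc l)
  let ?W = "{w. set w \<subseteq> {1..n i} \<and> length w = l}"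
  have "(\<Sum>w\<in>{w. set w \<subseteq> {1..n i} \<and> length w = Suc l}. q (fold (A i) w x))
      = (\<Sum>(w,s)\<in>?W \<times> {1..n i}. q (fold (A i) w (A i s x)))"
    unfolding lists_length_Suc_eq by (subst sum.reindex) (auto simp: inj_on_def case_prod_unfold)
  also have "\<dots> = (\<Sum>s=1..n i. (phi A i ^^ l) q (A i s x))"
    unfolding sum.cartesian_product[symmetric] Suc.IH[symmetric] by (rule sum.swap)
  finally show ?case by (simp add: phi_def[of A i "(phi A i ^^ l) q"])
qed (auto simp: conj_commute cong: conj_cong)

text \<open>The words of length \<open>l\<close> contribute the \<open>l\<close>-th power of
  \<open>phi\<close>, and the sum of \<Phi>^l (id - \<Phi>) over l < p telescopes to id -
  \<Phi>^p.\<close>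

lemma sum_words_less:
  "(\<Sum>w\<in>{w. set w \<subseteq> {1..n i} \<and> length w < p}. dphi A i (Suc 0) q (fold (A i) w x)) = dphi A i p q x"
proof (induction p)
  case (Suc p)
  have eq: "{w. set w \<subseteq> {1..n i} \<and> length w < Suc p}
      = {w. set w \<subseteq> {1..n i} \<and> length w < p} \<union> {w. set w \<subseteq> {1..n i} \<and> length w = p}" by auto
  have fin: "finite {w. set w \<subseteq> {1..n i} \<and> length w < p}"
    by (rule finite_subset[OF _ finite_lists_length_le[of "{1..n i}" p]]) auto
  have *: "(phi A i ^^ p) (dphi A i (Suc 0) q) x = (phi A i ^^ p) q x - (phi A i ^^ Suc p) q x"
    unfolding dphi_def[abs_def] phi_pow_diff by (simp add: funpow_swap1)
  show ?case unfolding eq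
    by (subst sum.union_disjoint[OF fin finite_lists_length_eq], simp, blast, unfold Suc.IH sum_words_eq *)
      (simp add: dphi_def)
qed (simp add: dphi_def)

definition short :: "nat \<Rightarrow> nat \<Rightarrow> multiword set" where
  "short j p = {\<beta> \<in> multiwords j n. \<forall>i. length (\<beta> i) < p}"

lemma multiwords_Suc:
  "\<beta> \<in> multiwords j n \<Longrightarrow> set w \<subseteq> {1..n (Suc j)} \<Longrightarrow> \<beta>(Suc j := w) \<in> multiwords (Suc j) n"
  "\<beta> \<in> multiwords (Suc j) n \<Longrightarrow> \<beta>(Suc j := []) \<in> multiwords j n"
  "\<beta> \<in> multiwords j n \<Longrightarrow> \<beta>(Suc j := []) = \<beta>"
  "\<beta> \<in> multiwords (Suc j) n \<Longrightarrow> set (\<beta> (Suc j)) \<subseteq> {1..n (Suc j)}"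
  unfolding multiwords_def mem_Collect_eq
  by (auto simp: le_Suc_eq fun_upd_idem)[3] (elim conjE, erule bspec, simp)

lemma short_Suc:
  assumes "p > 0"
  shows "bij_betw (\<lambda>(\<beta>, w). \<beta>(Suc j := w)) (short j p \<times> {w. set w \<subseteq> {1..n (Suc j)} \<and> length w < p}) (short (Suc j) p)"
proof (rule bij_betw_byWitness[where f' = "\<lambda>\<beta>. (\<beta>(Suc j := []), \<beta> (Suc j))"])
  show "\<forall>a\<in>short j p \<times> {w. set w \<subseteq> {1..n (Suc j)} \<and> length w < p}.
      (\<lambda>\<beta>. (\<beta>(Suc j := []), \<beta> (Suc j))) ((\<lambda>(\<beta>, w). \<beta>(Suc j := w)) a) = a"
    by (auto simp: short_def multiwords_Suc(3))
  show "(\<lambda>(\<beta>, w). \<beta>(Suc j := w)) ` (short j p \<times> {w. set w \<subseteq> {1..n (Suc j)} \<and> length w < p}) \<subseteq> short (Suc j) p"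
    by (auto simp only: short_def mem_Collect_eq mem_Times_iff intro: multiwords_Suc(1)) simp
  show "(\<lambda>\<beta>. (\<beta>(Suc j := []), \<beta> (Suc j))) ` short (Suc j) p
      \<subseteq> short j p \<times> {w. set w \<subseteq> {1..n (Suc j)} \<and> length w < p}"
    using assms multiwords_Suc(2,4)[of _ j] by (fastforce simp: short_def)
qed auto

lemma finite_short: "p > 0 \<Longrightarrow> finite (short j p)"
proof (induction j)
  case 0
  have "short 0 p \<subseteq> {\<lambda>_. []}" by (auto simp: short_def multiwords_def)
  then show ?case by (rule finite_subset) simp
next
  case (Suc j)
  have "finite {w. set w \<subseteq> {1..n (Suc j)} \<and> length w < p}"
    by (rule finite_subset[OF _ finite_lists_length_le[of "{1..n (Suc j)}" p]]) auto
  with Suc show ?case using bij_betw_finite[OF short_Suc[OF Suc.prems, of j]] by simp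
qed

end

text \<open>What the adjoints of a polyball tuple and the adjoint shifts \<open>mstar\<close> have
  in common, so that one telescoping argument serves both.\<close>

locale star_family = phases +
  fixes A :: "nat \<Rightarrow> nat \<Rightarrow> 'a \<Rightarrow> 'a::complex_inner"
  assumes A_scaleC: "letter i s \<Longrightarrow> A i s (a *\<^sub>C x) = a *\<^sub>C A i s x"
    and A_commute: "\<lbrakk>letter i s; letter j t; i \<noteq> j\<rbrakk> \<Longrightarrow> A i s (A j t x) = lam i j s t *\<^sub>C A j t (A i s x)"
begin

definition phase_invariant :: "('a \<Rightarrow> real) \<Rightarrow> bool" where
  "phase_invariant q \<longleftrightarrow> (\<forall>a x. cmod a = 1 \<longrightarrow> q (a *\<^sub>C x) = q x)"

lemma phase_invariant_phi: "phase_invariant q \<Longrightarrow> i \<in> {1..k} \<Longrightarrow> phase_invariant (phi A i q)"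
  by (simp add: phase_invariant_def phi_def A_scaleC)

lemma phase_invariant_phi_pow: "phase_invariant q \<Longrightarrow> i \<in> {1..k} \<Longrightarrow> phase_invariant ((phi A i ^^ p) q)"
  by (induction p) (auto intro: phase_invariant_phi)

lemma phase_invariant_dphi: "phase_invariant q \<Longrightarrow> i \<in> {1..k} \<Longrightarrow> phase_invariant (dphi A i p q)"
  using phase_invariant_phi_pow[of q i p] by (simp add: phase_invariant_def dphi_def)

lemma phase_invariant_defect_form:
  "phase_invariant q \<Longrightarrow> j \<le> k \<Longrightarrow> phase_invariant (defect_form A p j q)"
  by (induction j) (auto intro: phase_invariant_dphi)

lemma phi_commute:
  assumes "phase_invariant q" "i \<in> {1..k}" "j \<in> {1..k}" "i \<noteq> j"
  shows "phi A i (phi A j q) = phi A j (phi A i q)"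
proof
  fix x
  have "phi A i (phi A j q) x = (\<Sum>s=1..n i. \<Sum>t=1..n j. q (A i s (A j t x)))"
    unfolding phi_def
  proof (intro sum.cong refl)
    fix s t assume "s \<in> {1..n i}" "t \<in> {1..n j}"
    then have "A j t (A i s x) = lam j i t s *\<^sub>C A i s (A j t x)" "cmod (lam j i t s) = 1"
      using assms by (auto intro!: A_commute cmod_lam)
    then show "q (A j t (A i s x)) = q (A i s (A j t x))"
      using assms(1) by (simp add: phase_invariant_def)
  qed
  also have "\<dots> = phi A j (phi A i q) x" unfolding phi_def by (rule sum.swap)
  finally show "phi A i (phi A j q) x = phi A j (phi A i q) x" .
qed

lemma phi_pow_commute:
  assumes "phase_invariant q" "i \<in> {1..k}" "j \<in> {1..k}" "i \<noteq> j"
  shows "(phi A i ^^ p) ((phi A j ^^ r) q) = (phi A j ^^ r) ((phi A i ^^ p) q)"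
proof -
  have 1: "phi A i ((phi A j ^^ r) q) = (phi A j ^^ r) (phi A i q)" if "phase_invariant q" for q
  proof (induction r)
    case (Suc r)
    have "phi A i ((phi A j ^^ Suc r) q) = phi A j (phi A i ((phi A j ^^ r) q))"
      using phi_commute[OF phase_invariant_phi_pow[OF that assms(3)] assms(2,3,4)] by simp
    then show ?case by (simp add: Suc)
  qed simp
  show ?thesis
  proof (induction p)
    case (Suc p)
    then show ?case using 1[OF phase_invariant_phi_pow[OF assms(1,2)], of p] by simp
  qed simp
qed

lemma dphi_commute:
  assumes "phase_invariant q" "i \<in> {1..k}" "j \<in> {1..k}" "i \<noteq> j"
  shows "dphi A i p (dphi A j r q) = dphi A j r (dphi A i p q)"
  unfolding dphi_def[abs_def] phi_pow_diff phi_pow_commute[OF assms] by (simp add: fun_eq_iff)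

lemma defect_form_dphi:
  assumes "phase_invariant q" "i \<in> {1..k}"
  shows "j < i \<Longrightarrow> defect_form A r j (dphi A i p q) = dphi A i p (defect_form A r j q)"
proof (induction j)
  case (Suc j)
  then show ?case
    using assms dphi_commute[OF phase_invariant_defect_form[OF assms(1)], of j i "Suc j" p r r] by simp
qed simp

text \<open>Summing over the last component turns its factor into id - \<Phi>^p. On phase invariant
  forms this factor moves past the earlier ones and is absorbed into \<open>q\<close>, which is why
  \<open>q\<close> is arbitrary in the induction.\<close>

theorem sum_defect_form:
  assumes "p > 0"
  shows "phase_invariant q \<Longrightarrow> j \<le> k \<Longrightarrow>
    (\<Sum>\<beta>\<in>short j p. defect_form A (Suc 0) j q (act A j \<beta> x)) = defect_form A p j q x"
proof (induction j arbitrary: q)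
  case 0
  have "short 0 p = {\<lambda>_. []}" using assms by (auto simp: short_def multiwords_def)
  then show ?case by simp
next
  case (Suc j)
  let ?W = "{w. set w \<subseteq> {1..n (Suc j)} \<and> length w < p}"
  let ?D = "defect_form A (Suc 0)"
  have a: "act A (Suc j) (\<beta>(Suc j := w)) x = fold (A (Suc j)) w (act A j \<beta> x)" for \<beta> w
    unfolding act_Suc by (simp, subst act_cong[of j _ \<beta>]) auto
  have "(\<Sum>\<beta>\<in>short (Suc j) p. ?D (Suc j) q (act A (Suc j) \<beta> x))
      = (\<Sum>(\<beta>,w)\<in>short j p \<times> ?W. ?D (Suc j) q (act A (Suc j) (\<beta>(Suc j := w)) x))"
    using sum.reindex_bij_betw[OF short_Suc[OF assms], of "\<lambda>\<beta>. ?D (Suc j) q (act A (Suc j) \<beta> x)" j]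
    by (simp add: case_prod_unfold)
  also have "\<dots> = (\<Sum>\<beta>\<in>short j p. \<Sum>w\<in>?W. dphi A (Suc j) (Suc 0) (?D j q) (fold (A (Suc j)) w (act A j \<beta> x)))"
    by (simp add: sum.cartesian_product a)
  also have "\<dots> = (\<Sum>\<beta>\<in>short j p. ?D j (dphi A (Suc j) p q) (act A j \<beta> x))"
    unfolding sum_words_less using Suc.prems by (subst defect_form_dphi) auto
  also have "\<dots> = defect_form A p j (dphi A (Suc j) p q) x"
    using Suc.prems by (intro Suc.IH phase_invariant_dphi) auto
  also have "\<dots> = defect_form A p (Suc j) q x"
    using Suc.prems by (subst defect_form_dphi) auto
  finally show ?case .
qed

text \<open>Mirrors the order in \<open>model_defect\<close>, where the factor with the largest
  index is applied first, opposite to \<open>defect\<close>.\<close>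

primrec defect_form_right :: "nat \<Rightarrow> ('a \<Rightarrow> real) \<Rightarrow> 'a \<Rightarrow> real" where
  "defect_form_right 0 q = q"
| "defect_form_right (Suc j) q = defect_form_right j (dphi A (Suc j) (Suc 0) q)"

lemma defect_form_right:
  "phase_invariant q \<Longrightarrow> j \<le> k \<Longrightarrow> defect_form_right j q = defect_form A (Suc 0) j q"
  by (induction j arbitrary: q) (simp_all add: phase_invariant_dphi defect_form_dphi)

text \<open>A finite set of multiwords lies in some box \<open>short k p\<close>, whose sum is the
  truncated form; a bound uniform in \<open>p\<close> thus suffices, without any limit.\<close>

lemma defect_form_summable:
  assumes q: "phase_invariant q" and pos: "\<And>\<beta>. \<beta> \<in> mw \<Longrightarrow> 0 \<le> defect_form A (Suc 0) k q (act A k \<beta> x)"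
    and le: "\<And>p. p > 0 \<Longrightarrow> defect_form A p k q x \<le> K"
  shows "(\<lambda>\<beta>. defect_form A (Suc 0) k q (act A k \<beta> x)) summable_on mw"
    and "(\<Sum>\<^sub>\<infinity>\<beta>\<in>mw. defect_form A (Suc 0) k q (act A k \<beta> x)) \<le> K"
proof -
  let ?f = "\<lambda>\<beta>. defect_form A (Suc 0) k q (act A k \<beta> x)"
  have fin: "sum ?f X \<le> K" if X: "finite X" "X \<subseteq> mw" for X
  proof -
    have "finite (\<Union>\<beta>\<in>X. (\<lambda>i. length (\<beta> i)) ` {1..k})" using X by simp
    then obtain N where N: "(\<Union>\<beta>\<in>X. (\<lambda>i. length (\<beta> i)) ` {1..k}) \<subseteq> {..N}"
      using finite_nat_iff_bounded_le by blast
    have "X \<subseteq> short k (Suc N)"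
    proof
      fix \<beta> assume \<beta>: "\<beta> \<in> X"
      have "length (\<beta> i) < Suc N" for i
      proof (cases "i \<in> {1..k}")
        case True
        then show ?thesis using N \<beta> by (fastforce simp: less_Suc_eq_le)
      next
        case False
        then have "\<beta> i = []" using \<beta> X(2) by (auto simp: multiwords_def)
        then show ?thesis by simp
      qed
      then show "\<beta> \<in> short k (Suc N)" using \<beta> X(2) by (auto simp: short_def)
    qed
    then have "sum ?f X \<le> sum ?f (short k (Suc N))"
      by (intro sum_mono2 finite_short pos) (auto simp: short_def)
    also have "\<dots> = defect_form A (Suc N) k q x" by (rule sum_defect_form) (use q in auto)
    also have "\<dots> \<le> K" by (rule le) simp
    finally show ?thesis .
  qed
  show s: "?f summable_on mw"
  proof (rule nonneg_bdd_above_summable_on)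
    show "bdd_above (sum ?f ` {F. F \<subseteq> mw \<and> finite F})"
      by (rule bdd_aboveI2[of _ _ K]) (use fin in blast)
  qed (rule pos)
  show "infsum ?f mw \<le> K" by (rule infsum_le_finite_sums[OF s]) (use fin in blast)
qed

text \<open>The boxes grow with \<open>p\<close> and the terms are nonnegative, so the truncated
  forms increase, and their limit is the full sum.\<close>

lemma defect_form_infsum:
  assumes q: "phase_invariant q" and pos: "\<And>\<beta>. \<beta> \<in> mw \<Longrightarrow> 0 \<le> defect_form A (Suc 0) k q (act A k \<beta> x)"
    and lim: "(\<lambda>p. defect_form A p k q x) \<longlonglongrightarrow> L"
  shows "(\<lambda>\<beta>. defect_form A (Suc 0) k q (act A k \<beta> x)) summable_on mw"
    and "(\<Sum>\<^sub>\<infinity>\<beta>\<in>mw. defect_form A (Suc 0) k q (act A k \<beta> x)) = L"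
proof -
  let ?f = "\<lambda>\<beta>. defect_form A (Suc 0) k q (act A k \<beta> x)"
  have sm: "sum ?f (short k p) = defect_form A p k q x" if "p > 0" for p
    by (rule sum_defect_form) (use q that in auto)
  have mono: "defect_form A p k q x \<le> defect_form A r k q x" if "0 < p" "p \<le> r" for p r
    using that unfolding sm[symmetric, OF \<open>0 < p\<close>] sm[symmetric, OF order_less_le_trans[OF that]]
    by (intro sum_mono2 finite_short pos) (auto simp: short_def intro: order_less_le_trans)
  have le: "defect_form A p k q x \<le> L" if "p > 0" for p
    by (rule LIMSEQ_le_const[OF lim]) (use mono that in blast)
  show s: "?f summable_on mw" by (rule defect_form_summable(1)[OF q pos le])
  show "infsum ?f mw = L"
  proof (rule antisym)
    show "infsum ?f mw \<le> L" by (rule defect_form_summable(2)[OF q pos le])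
    have "defect_form A p k q x \<le> infsum ?f mw" if "p \<ge> 1" for p
      using that unfolding sm[symmetric, OF order_less_le_trans[OF zero_less_one that]]
      by (intro finite_sum_le_infsum s finite_short) (auto simp: short_def intro: pos)
    then show "L \<le> infsum ?f mw" by (intro LIMSEQ_le_const2[OF lim]) blast
  qed
qed

text \<open>The truncated form of a partial product is a sum of nonnegative partial defects, so
  every further factor subtracts something nonnegative. This is why positivity is required for all
  \<open>j\<close>.\<close>

lemma defect_form_le:
  assumes q: "phase_invariant q" and pos: "\<And>j y. j \<le> k \<Longrightarrow> 0 \<le> defect_form A (Suc 0) j q y" and p: "p > 0"
  shows "j \<le> k \<Longrightarrow> defect_form A p j q x \<le> q x"
proof (induction j)
  case (Suc j)
  have "0 \<le> defect_form A p j q y" for y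
    using Suc.prems by (subst sum_defect_form[OF p q, symmetric]) (auto intro!: sum_nonneg pos)
  then have "0 \<le> (phi A (Suc j) ^^ p) (defect_form A p j q) x" by (rule phi_pow_nonneg)
  with Suc show ?case by (simp add: dphi_def)
qed simp

end

section \<open>Defect operators\<close>

lemma bounded_op_id_minus_cp_map:
  fixes R :: "nat \<Rightarrow> 'a::chilbert_space \<Rightarrow> 'a"
  assumes M: "closed_csubspace M" and R: "\<And>s. s \<in> {1..m} \<Longrightarrow> bounded_op M M (R s)" and X: "bounded_op M M X"
  shows "bounded_op M M (id_minus_cp_map M m R X)"
  unfolding id_minus_cp_map_def cp_map_def
proof (intro bounded_op_diff_op X bounded_op_sum_op closed_csubspaceD M)
  fix s assume s: "s \<in> {1..m}"
  have "bounded_op M M (cadjoint M (R s))"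
    using bounded_op_cadjoint[OF R[OF s] M] bounded_op_mono cadjoint_in[OF R[OF s] M] by blast
  then show "bounded_op M M (\<lambda>x. R s (X (cadjoint M (R s) x)))"
    using bounded_op_comp[OF bounded_op_comp[OF _ X] R[OF s]] by blast
qed

lemma cinner_id_minus_cp_map:
  fixes R :: "nat \<Rightarrow> 'a::chilbert_space \<Rightarrow> 'a"
  assumes M: "closed_csubspace M" and R: "\<And>s. s \<in> {1..m} \<Longrightarrow> bounded_op M M (R s)" and X: "bounded_op M M X"
    and A: "\<And>s x. s \<in> {1..m} \<Longrightarrow> x \<in> M \<Longrightarrow> cadjoint M (R s) x = A s x"
    and q: "\<And>x. x \<in> M \<Longrightarrow> cinner (X x) x = of_real (q x)" and x: "x \<in> M"
  shows "cinner (id_minus_cp_map M m R X x) x = of_real (q x - (\<Sum>s=1..m. q (A s x)))"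
proof -
  have "cinner (R s (X (cadjoint M (R s) x))) x = of_real (q (A s x))" if s: "s \<in> {1..m}" for s
  proof -
    have a: "cadjoint M (R s) x \<in> M" by (rule cadjoint_in[OF R[OF s] M])
    then have "cinner (R s (X (cadjoint M (R s) x))) x = cinner (X (cadjoint M (R s) x)) (cadjoint M (R s) x)"
      by (intro cadjoint_right[OF R[OF s] M] bounded_opD(1)[OF X])
    then show ?thesis using q[OF a] by (simp add: A[OF s x])
  qed
  then show ?thesis
    by (simp add: id_minus_cp_map_def cp_map_def cinner_diff_left cinner_sum_left q[OF x])
qed

context phases
begin

section \<open>Forms of the model and vacuum coefficients\<close>

lemma star_family_mstar:
  "star_family k n lam (mstar :: nat \<Rightarrow> nat \<Rightarrow> (multiword, 'e::complex_inner) ell2 \<Rightarrow> _)"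
proof
  show "letter i s \<Longrightarrow> mstar i s (a *\<^sub>C x) = a *\<^sub>C mstar i s x" for i s a and x :: "(multiword, 'e) ell2"
    by (rule mstar_linear(2))
  show "letter i s \<Longrightarrow> letter j t \<Longrightarrow> i \<noteq> j \<Longrightarrow>
      mstar i s (mstar j t x) = lam i j s t *\<^sub>C mstar j t (mstar i s x)" for i s j t and x :: "(multiword, 'e) ell2"
    by (rule mstar_mstar)
qed

abbreviation norm2 :: "'a::real_normed_vector \<Rightarrow> real" where
  "norm2 x \<equiv> (norm x)\<^sup>2"

lemma phi_mstar_norm2_le: "i \<in> {1..k} \<Longrightarrow> phi mstar i norm2 f \<le> norm2 f"
  unfolding phi_def by (rule norm_mstar_row_le)

lemma phi_mstar_pow:
  assumes "i \<in> {1..k}"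
  shows "f \<in> F UNIV \<Longrightarrow> (phi mstar i ^^ p) norm2 f = wsum (\<lambda>\<alpha>. p \<le> length (\<alpha> i)) f"
proof (induction p arbitrary: f)
  case (Suc p)
  have "(phi mstar i ^^ Suc p) norm2 f = (\<Sum>s=1..n i. wsum (\<lambda>\<alpha>. p \<le> length (\<alpha> i)) (mstar i s f))"
    using assms by (simp add: phi_def[of mstar i "(phi mstar i ^^ p) norm2"] Suc.IH mstar_fock_UNIV)
  also have "\<dots> = wsum (\<lambda>\<alpha>. Suc p \<le> length (\<alpha> i)) f"
    by (rule wsum_mstar[OF assms]) (auto simp: push_apply)
  finally show ?case .
qed (simp add: wsum_True)

lemma phi_mstar_pow_tendsto:
  "i \<in> {1..k} \<Longrightarrow> f \<in> F UNIV \<Longrightarrow> (\<lambda>p. (phi mstar i ^^ p) norm2 f) \<longlonglongrightarrow> 0"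
  by (simp add: phi_mstar_pow wsum_length_tendsto)

text \<open>By \<open>wsum_mstar\<close>, subtracting \<open>phi mstar (Suc j)\<close> removes the
  words with nonempty component \<open>Suc j\<close>. After all \<open>k\<close> factors only the
  vacuum is left.\<close>

lemma defect_form_mstar_wsum:
  "j \<le> k \<Longrightarrow> f \<in> F UNIV \<Longrightarrow>
    defect_form mstar (Suc 0) j norm2 f = wsum (\<lambda>\<alpha>. \<forall>l\<in>{1..j}. \<alpha> l = []) f"
proof (induction j arbitrary: f)
  case (Suc j)
  let ?P = "\<lambda>\<alpha>::multiword. \<forall>l\<in>{1..j}. \<alpha> l = []"
  have "phi mstar (Suc j) (defect_form mstar (Suc 0) j norm2) f = (\<Sum>s=1..n (Suc j). wsum ?P (mstar (Suc j) s f))"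
    using Suc.prems by (simp add: phi_def Suc.IH mstar_fock_UNIV)
  also have "\<dots> = wsum (\<lambda>\<alpha>. ?P \<alpha> \<and> \<not> \<alpha> (Suc j) = []) f"
    by (rule wsum_mstar) (use Suc.prems in \<open>auto simp: push_apply\<close>)
  finally have "defect_form mstar (Suc 0) (Suc j) norm2 f = wsum (\<lambda>\<alpha>. ?P \<alpha> \<and> \<alpha> (Suc j) = []) f"
    using Suc wsum_split[of ?P "\<lambda>\<alpha>. \<alpha> (Suc j) = []" f] by (simp add: dphi_1)
  also have "(\<lambda>\<alpha>. ?P \<alpha> \<and> \<alpha> (Suc j) = []) = (\<lambda>\<alpha>. \<forall>l\<in>{1..Suc j}. \<alpha> l = [])"
    by (auto simp: fun_eq_iff atLeastAtMostSuc_conv)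
  finally show ?case .
qed (simp add: wsum_True)

abbreviation (input) vacuum :: multiword where "vacuum \<equiv> \<lambda>_. []"

lemma vacuum_mw: "vacuum \<in> mw" by (simp add: multiwords_def)

lemma defect_form_mstar:
  assumes "f \<in> F UNIV"
  shows "defect_form mstar (Suc 0) k norm2 f = norm2 (coord f vacuum)"
proof -
  have "\<alpha> = vacuum" if "\<alpha> \<in> mw" "\<forall>l\<in>{1..k}. \<alpha> l = []" for \<alpha>
    using that unfolding multiwords_def fun_eq_iff by blast
  then have "{\<alpha> \<in> mw. \<forall>l\<in>{1..k}. \<alpha> l = []} = {vacuum}"
  proof (intro equalityI subsetI)
    show "\<alpha> \<in> {\<alpha> \<in> mw. \<forall>l\<in>{1..k}. \<alpha> l = []}" if "\<alpha> \<in> {vacuum}" for \<alpha>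
      using that vacuum_mw by simp
  qed blast
  then show ?thesis by (simp add: defect_form_mstar_wsum assms wsum_def)
qed

text \<open>The components below \<open>i\<close> are empty, so all weights met on the way are 1 and
  the letters of \<open>w\<close> are put in front of component \<open>i\<close> without a
  phase.\<close>

lemma coord_fold_mstar:
  assumes i: "i \<in> {1..k}" and \<gamma>: "\<gamma> \<in> mw" and 0: "\<And>l. l \<in> {1..<i} \<Longrightarrow> \<gamma> l = []"
  shows "set w \<subseteq> {1..n i} \<Longrightarrow> coord (fold (mstar i) w f) \<gamma> = coord f (\<gamma>(i := w @ \<gamma> i))"
proof (induction w arbitrary: f)
  case (Cons s w)
  have mw: "\<gamma>(i := w @ \<gamma> i) \<in> mw" using \<gamma> i Cons.prems by (auto simp: multiwords_def)
  have "c i s (\<gamma>(i := w @ \<gamma> i)) = 1"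
    unfolding shift_coeff_def by (rule prod.neutral) (auto simp: 0 word_coeff_def)
  moreover have l: "letter i s" using i Cons.prems by auto
  ultimately have "coord (mstar i s f) (\<gamma>(i := w @ \<gamma> i)) = coord f (push i s (\<gamma>(i := w @ \<gamma> i)))"
    using coord_mstar[OF l, of f "\<gamma>(i := w @ \<gamma> i)"] mw by simp
  moreover have "coord (fold (mstar i) w (mstar i s f)) \<gamma> = coord (mstar i s f) (\<gamma>(i := w @ \<gamma> i))"
    by (rule Cons.IH) (use Cons.prems in simp)
  ultimately show ?case by (simp add: push_def fun_upd_def cong: if_cong)
qed simp

lemma coord_act_mstar:
  assumes \<beta>: "\<beta> \<in> mw"
  shows "j \<le> k \<Longrightarrow> \<gamma> \<in> mw \<Longrightarrow> (\<And>l. l \<in> {1..j} \<Longrightarrow> \<gamma> l = []) \<Longrightarrow>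
    coord (act mstar j \<beta> f) \<gamma> = coord f (\<lambda>l. if l \<in> {1..j} then \<beta> l else \<gamma> l)"
proof (induction j arbitrary: \<gamma>)
  case (Suc j)
  have w: "set (\<beta> (Suc j)) \<subseteq> {1..n (Suc j)}" using \<beta> Suc.prems(1) by (auto simp: multiwords_def)
  let ?\<gamma> = "\<gamma>(Suc j := \<beta> (Suc j))"
  have g: "?\<gamma> \<in> mw" using w Suc.prems(1,2) by (auto simp: multiwords_def)
  have "coord (act mstar (Suc j) \<beta> f) \<gamma> = coord (act mstar j \<beta> f) ?\<gamma>"
    unfolding act_Suc using Suc.prems by (subst coord_fold_mstar[OF _ _ _ w]) auto
  also have "\<dots> = coord f (\<lambda>l. if l \<in> {1..j} then \<beta> l else ?\<gamma> l)"
    by (rule Suc.IH[OF _ g]) (use Suc.prems in auto)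
  also have "(\<lambda>l. if l \<in> {1..j} then \<beta> l else ?\<gamma> l) = (\<lambda>l. if l \<in> {1..Suc j} then \<beta> l else \<gamma> l)"
    by (auto simp: fun_eq_iff)
  finally show ?case .
qed simp

text \<open>Building \<beta> from the vacuum starts with component \<open>k\<close>, so every shift
  meets only empty lower components and no phase appears. A vector is thus recovered from the vacuum
  coefficients along its orbit.\<close>

lemma coord_act_vacuum: "\<beta> \<in> mw \<Longrightarrow> coord (act mstar k \<beta> f) vacuum = coord f \<beta>"
proof -
  assume \<beta>: "\<beta> \<in> mw"
  have "coord (act mstar k \<beta> f) vacuum = coord f (\<lambda>l. if l \<in> {1..k} then \<beta> l else [])"
    by (rule coord_act_mstar[OF \<beta>]) (auto simp: vacuum_mw)
  also have "(\<lambda>l. if l \<in> {1..k} then \<beta> l else []) = \<beta>"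
    using \<beta> by (auto simp: multiwords_def fun_eq_iff)
  finally show ?thesis .
qed

lemma act_closed:
  assumes "\<And>i s x. letter i s \<Longrightarrow> x \<in> M \<Longrightarrow> A i s x \<in> M" "\<beta> \<in> mw"
  shows "j \<le> k \<Longrightarrow> x \<in> M \<Longrightarrow> act A j \<beta> x \<in> M"
proof (induction j)
  case (Suc j)
  have "fold (A i) w y \<in> M" if "i \<in> {1..k}" "set w \<subseteq> {1..n i}" "y \<in> M" for i w y
    using that by (induction w arbitrary: y) (simp_all add: assms(1))
  moreover have "set (\<beta> (Suc j)) \<subseteq> {1..n (Suc j)}" using assms(2) Suc.prems by (auto simp: multiwords_def)
  ultimately show ?case using Suc by (simp add: act_Suc)
qed simp

lemma act_intertwine:
  assumes "\<And>i s x. letter i s \<Longrightarrow> x \<in> M \<Longrightarrow> A i s x \<in> M \<and> B i s (W x) = W (A i s x)" "\<beta> \<in> mw"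
  shows "j \<le> k \<Longrightarrow> x \<in> M \<Longrightarrow> act B j \<beta> (W x) = W (act A j \<beta> x)"
proof (induction j)
  case (Suc j)
  have "fold (B i) w (W y) = W (fold (A i) w y)" if "i \<in> {1..k}" "set w \<subseteq> {1..n i}" "y \<in> M" for i w y
    using that by (induction w arbitrary: y) (auto simp: assms(1))
  moreover have "set (\<beta> (Suc j)) \<subseteq> {1..n (Suc j)}" using assms(2) Suc.prems by (auto simp: multiwords_def)
  moreover have "act A j \<beta> x \<in> M" by (rule act_closed) (use assms Suc.prems in auto)
  ultimately show ?case using Suc by (simp add: act_Suc)
qed simp

section \<open>Poisson-type kernels\<close>

text \<open>Common shape of two operators: with the adjoints of \<open>T\<close> and the root of its
  defect it is the Berezin kernel; with \<open>mstar\<close> and a root of the defect of I minus the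
  Berezin projection term it is the adjoint of a characteristic function.\<close>

definition kernel :: "(nat \<Rightarrow> nat \<Rightarrow> 'a \<Rightarrow> 'a) \<Rightarrow> ('a \<Rightarrow> 'e) \<Rightarrow> 'a \<Rightarrow> (multiword, 'e::complex_inner) ell2" where
  "kernel A B x = Abs_ell2 (\<lambda>\<beta>. if \<beta> \<in> mw then B (act A k \<beta> x) else 0)"

end

context star_family
begin

lemma fold_A_scaleC: "i \<in> {1..k} \<Longrightarrow> set w \<subseteq> {1..n i} \<Longrightarrow> fold (A i) w (a *\<^sub>C x) = a *\<^sub>C fold (A i) w x"
  by (induction w arbitrary: x) (simp_all add: A_scaleC)

lemma A_fold:
  assumes "letter i s" "j \<in> {1..k}" "i \<noteq> j"
  shows "set w \<subseteq> {1..n j} \<Longrightarrow> A i s (fold (A j) w x) = word_coeff lam i j s w *\<^sub>C fold (A j) w (A i s x)"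
proof (induction w arbitrary: x)
  case (Cons t w)
  then have t: "letter j t" and w: "set w \<subseteq> {1..n j}" using assms by auto
  show ?case using Cons.IH[OF w, of "A j t x"] assms
    by (simp add: A_commute[OF assms(1) t assms(3)] fold_A_scaleC[OF assms(2) w] word_coeff_def
        scaleC_scaleC mult.commute)
qed (simp add: word_coeff_def)

lemma A_act:
  assumes "letter i s" "\<alpha> \<in> mw"
  shows "j < i \<Longrightarrow> A i s (act A j \<alpha> x) = (\<Prod>l=1..<Suc j. word_coeff lam i l s (\<alpha> l)) *\<^sub>C act A j \<alpha> (A i s x)"
proof (induction j)
  case (Suc j)
  have w: "set (\<alpha> (Suc j)) \<subseteq> {1..n (Suc j)}" "Suc j \<in> {1..k}"
    using assms Suc.prems by (auto simp: multiwords_def)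
  show ?case using Suc assms
    by (simp add: act_Suc A_fold[OF assms(1) w(2) _ w(1)] fold_A_scaleC[OF w(2,1)] scaleC_scaleC mult.commute)
qed simp

text \<open>\<open>act\<close> runs through the components in increasing order, so the new letter
  acts after all components below \<open>i\<close>. Letting it act first picks up the phases of
  exactly these components, whose product is \<open>c i s \<alpha>\<close>.\<close>

lemma act_push:
  assumes l: "letter i s" "\<alpha> \<in> mw"
  shows "i \<le> j \<Longrightarrow> j \<le> k \<Longrightarrow> act A j (push i s \<alpha>) x = c i s \<alpha> *\<^sub>C act A j \<alpha> (A i s x)"
proof (induction j)
  case (Suc j)
  have w: "set (\<alpha> (Suc j)) \<subseteq> {1..n (Suc j)}" "Suc j \<in> {1..k}"
    using assms Suc.prems by (auto simp: multiwords_def)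
  show ?case
  proof (cases "i = Suc j")
    case True
    have "act A j (push i s \<alpha>) x = act A j \<alpha> x"
      by (rule act_cong) (use True in \<open>auto simp: push_apply\<close>)
    moreover have "A i s (act A j \<alpha> x) = c i s \<alpha> *\<^sub>C act A j \<alpha> (A i s x)"
      using A_act[OF l, of j x] True by (simp add: shift_coeff_def)
    moreover have "push i s \<alpha> (Suc j) = s # \<alpha> (Suc j)" using True by (simp add: push_apply)
    ultimately show ?thesis using True w unfolding act_Suc by (simp add: fold_A_scaleC)
  next
    case False
    then have "push i s \<alpha> (Suc j) = \<alpha> (Suc j)" by (simp add: push_apply)
    then show ?thesis using False Suc w unfolding act_Suc by (simp add: fold_A_scaleC)
  qed
qed (use l in simp)

context
  fixes M :: "'a set" and B :: "'a \<Rightarrow> 'e::complex_inner" and E :: "'e set" and K :: real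
  assumes A_add: "\<And>i s x y. letter i s \<Longrightarrow> A i s (x + y) = A i s x + A i s y"
    and A_M: "\<And>i s x. letter i s \<Longrightarrow> x \<in> M \<Longrightarrow> A i s x \<in> M"
    and M: "csubspace M"
    and B: "bounded_op M E B"
    and B_sum: "\<And>x. x \<in> M \<Longrightarrow> (\<lambda>\<beta>. (norm (B (act A k \<beta> x)))\<^sup>2) summable_on mw"
    and B_le: "\<And>x. x \<in> M \<Longrightarrow> (\<Sum>\<^sub>\<infinity>\<beta>\<in>mw. (norm (B (act A k \<beta> x)))\<^sup>2) \<le> (norm x)\<^sup>2"
begin

lemma coord_kernel:
  assumes "x \<in> M" shows "coord (kernel A B x) \<beta> = (if \<beta> \<in> mw then B (act A k \<beta> x) else 0)"
proof -
  have "(\<lambda>\<beta>. (norm (if \<beta> \<in> mw then B (act A k \<beta> x) else 0))\<^sup>2) summable_on UNIV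
      \<longleftrightarrow> (\<lambda>\<beta>. (norm (B (act A k \<beta> x)))\<^sup>2) summable_on mw"
    by (rule summable_on_cong_neutral) auto
  then show ?thesis unfolding kernel_def using B_sum[OF assms] by (subst coord_Abs_ell2) auto
qed

lemma norm_kernel: "x \<in> M \<Longrightarrow> (norm (kernel A B x))\<^sup>2 = (\<Sum>\<^sub>\<infinity>\<beta>\<in>mw. (norm (B (act A k \<beta> x)))\<^sup>2)"
  by (subst norm_ell2_support[of mw]) (auto simp: coord_kernel intro: infsum_cong)

lemma norm_kernel_le: "x \<in> M \<Longrightarrow> norm (kernel A B x) \<le> norm x"
  by (rule power2_le_imp_le) (simp_all add: norm_kernel B_le)

lemma act_add:
  assumes "\<beta> \<in> mw" shows "j \<le> k \<Longrightarrow> act A j \<beta> (x + y) = act A j \<beta> x + act A j \<beta> y"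
proof (induction j)
  case (Suc j)
  have "fold (A i) w (x + y) = fold (A i) w x + fold (A i) w y"
    if "i \<in> {1..k}" "set w \<subseteq> {1..n i}" for i w x y
    using that by (induction w arbitrary: x y) (simp_all add: A_add)
  moreover have "set (\<beta> (Suc j)) \<subseteq> {1..n (Suc j)}" using assms Suc.prems by (auto simp: multiwords_def)
  ultimately show ?case using Suc by (simp add: act_Suc)
qed simp

lemma act_scaleC:
  assumes "\<beta> \<in> mw" shows "j \<le> k \<Longrightarrow> act A j \<beta> (a *\<^sub>C x) = a *\<^sub>C act A j \<beta> x"
proof (induction j)
  case (Suc j)
  have "set (\<beta> (Suc j)) \<subseteq> {1..n (Suc j)}" using assms Suc.prems by (auto simp: multiwords_def)
  then show ?case using Suc by (simp add: act_Suc fold_A_scaleC)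
qed simp

lemma bounded_op_kernel: "bounded_op M (F E) (kernel A B)"
proof (rule bounded_opI[of _ _ _ 1])
  have actM: "act A k \<beta> x \<in> M" if "\<beta> \<in> mw" "x \<in> M" for \<beta> x
    by (rule act_closed[OF _ that(1) order_refl that(2)]) (rule A_M)
  show "kernel A B x \<in> F E" if "x \<in> M" for x
    using that bounded_opD(1)[OF B] actM by (simp add: fock_def coord_kernel)
  show "kernel A B (x + y) = kernel A B x + kernel A B y" if "x \<in> M" "y \<in> M" for x y
  proof (rule ell2_eqI)
    show "coord (kernel A B (x + y)) \<beta> = coord (kernel A B x + kernel A B y) \<beta>" for \<beta>
      using bounded_opD(2)[OF B actM[OF _ that(1)] actM[OF _ that(2)], of \<beta> \<beta>]
      by (simp add: that csubspaceD[OF M] coord_kernel coord_simps act_add)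
  qed
  show "kernel A B (a *\<^sub>C x) = a *\<^sub>C kernel A B x" if "x \<in> M" for a x
  proof (rule ell2_eqI)
    show "coord (kernel A B (a *\<^sub>C x)) \<beta> = coord (a *\<^sub>C kernel A B x) \<beta>" for \<beta>
      using bounded_opD(3)[OF B actM[OF _ that], of \<beta> a]
      by (simp add: that csubspaceD[OF M] coord_kernel coord_simps act_scaleC)
  qed
qed (simp add: norm_kernel_le)

text \<open>The phase from \<open>act_push\<close> cancels against the conjugate weight in
  \<open>mstar\<close>.\<close>

lemma kernel_intertwine:
  assumes "letter i s" "x \<in> M" shows "kernel A B (A i s x) = mstar i s (kernel A B x)"
proof (rule ell2_eqI)
  fix \<alpha>
  have actM: "act A k \<beta> x \<in> M" if "\<beta> \<in> mw" "x \<in> M" for \<beta> x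
    by (rule act_closed[OF _ that(1) order_refl that(2)]) (rule A_M)
  show "coord (kernel A B (A i s x)) \<alpha> = coord (mstar i s (kernel A B x)) \<alpha>"
  proof (cases "\<alpha> \<in> mw")
    case True
    then have "act A k (push i s \<alpha>) x = c i s \<alpha> *\<^sub>C act A k \<alpha> (A i s x)"
      using assms by (intro act_push) auto
    moreover have "B (c i s \<alpha> *\<^sub>C act A k \<alpha> (A i s x)) = c i s \<alpha> *\<^sub>C B (act A k \<alpha> (A i s x))"
      by (rule bounded_opD(3)[OF B actM[OF True A_M[OF assms]]])
    ultimately show ?thesis using True assms shift_coeff_cnj[OF assms(1) True]
      by (simp add: coord_kernel A_M coord_mstar push_multiwords scaleC_scaleC mult.commute)
  qed (use assms in \<open>simp add: coord_kernel A_M coord_mstar\<close>)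
qed

end

end

context phases
begin

section \<open>Tuples in the regular polyball\<close>

lemma defect_fold:
  fixes R :: "nat \<Rightarrow> nat \<Rightarrow> 'h \<Rightarrow> 'h::chilbert_space"
  assumes R: "\<And>i s. letter i s \<Longrightarrow> bounded_op UNIV UNIV (R i s)"
    and A: "\<And>i s x. letter i s \<Longrightarrow> cadjoint UNIV (R i s) x = A i s x"
  shows "j \<le> k \<Longrightarrow> bounded_op UNIV UNIV (fold (\<lambda>i. id_minus_cp_map UNIV (n i) (R i)) [1..<Suc j] id) \<and>
    (\<forall>x. cinner (fold (\<lambda>i. id_minus_cp_map UNIV (n i) (R i)) [1..<Suc j] id x) x
       = of_real (defect_form A (Suc 0) j norm2 x))"
proof (induction j)
  case 0
  then show ?case by (simp add: id_def bounded_op_id cinner_self)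
next
  case (Suc j)
  let ?X = "fold (\<lambda>i. id_minus_cp_map UNIV (n i) (R i)) [1..<Suc j] id"
  have X: "bounded_op UNIV UNIV ?X" and q: "cinner (?X x) x = of_real (defect_form A (Suc 0) j norm2 x)" for x
    using Suc.IH[OF Suc_leD[OF Suc.prems]] by blast+
  have r: "bounded_op UNIV UNIV (R (Suc j) s)" if "s \<in> {1..n (Suc j)}" for s using R that Suc.prems by simp
  have eq: "fold (\<lambda>i. id_minus_cp_map UNIV (n i) (R i)) [1..<Suc (Suc j)] id
      = id_minus_cp_map UNIV (n (Suc j)) (R (Suc j)) ?X" by simp
  show ?case unfolding eq
    using bounded_op_id_minus_cp_map[OF closed_csubspace_UNIV r X]
      cinner_id_minus_cp_map[OF closed_csubspace_UNIV r X,
        where A = "A (Suc j)" and q = "defect_form A (Suc 0) j norm2"]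
      A[of "Suc j"] Suc.prems q by (simp add: dphi_1 phi_def)
qed

lemma cp_map_pow:
  fixes R :: "nat \<Rightarrow> nat \<Rightarrow> 'h \<Rightarrow> 'h::chilbert_space"
  assumes i: "i \<in> {1..k}" and R: "\<And>i s. letter i s \<Longrightarrow> bounded_op UNIV UNIV (R i s)"
    and A: "\<And>i s x. letter i s \<Longrightarrow> cadjoint UNIV (R i s) x = A i s x"
  shows "bounded_op UNIV UNIV ((cp_map UNIV (n i) (R i) ^^ p) id) \<and>
    (\<forall>x. cinner ((cp_map UNIV (n i) (R i) ^^ p) id x) x = of_real ((phi A i ^^ p) norm2 x))"
proof (induction p)
  case 0
  then show ?case by (simp add: id_def bounded_op_id cinner_self)
next
  case (Suc p)
  let ?X = "(cp_map UNIV (n i) (R i) ^^ p) id"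
  have X: "bounded_op UNIV UNIV ?X" and q: "cinner (?X x) x = of_real ((phi A i ^^ p) norm2 x)" for x
    using Suc by blast+
  have r: "bounded_op UNIV UNIV (R i s)" if "s \<in> {1..n i}" for s using R that i by simp
  \<comment> \<open>Writing \<Phi>(X) as X - (X - \<Phi>(X)) makes the lemmas on
    \<open>id_minus_cp_map\<close> applicable.\<close>
  have eq: "(cp_map UNIV (n i) (R i) ^^ Suc p) id = (\<lambda>x. ?X x - id_minus_cp_map UNIV (n i) (R i) ?X x)"
    by (simp add: id_minus_cp_map_def)
  have "bounded_op UNIV UNIV (id_minus_cp_map UNIV (n i) (R i) ?X)"
    by (rule bounded_op_id_minus_cp_map[OF closed_csubspace_UNIV r X])
  moreover have "cinner (id_minus_cp_map UNIV (n i) (R i) ?X x) x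
      = of_real ((phi A i ^^ p) norm2 x - (\<Sum>s=1..n i. (phi A i ^^ p) norm2 (A i s x)))" for x
    by (rule cinner_id_minus_cp_map[OF closed_csubspace_UNIV r X]) (use A i q in auto)
  ultimately show ?case unfolding eq
    using bounded_op_diff_op[OF X] q by (simp add: cinner_diff_left phi_def[of A i "(phi A i ^^ p) norm2"])
qed

lemma model_defect_foldr:
  fixes E :: "'e::chilbert_space set"
  assumes E: "closed_csubspace E"
  shows "j \<le> k \<Longrightarrow> bounded_op (F E) (F E) X \<Longrightarrow> (\<And>f. f \<in> F E \<Longrightarrow> cinner (X f) f = of_real (q f)) \<Longrightarrow>
    bounded_op (F E) (F E) (foldr (\<lambda>i. id_minus_cp_map (F E) (n i) (S i)) [1..<Suc j] X) \<and>
    (\<forall>f\<in>F E. cinner (foldr (\<lambda>i. id_minus_cp_map (F E) (n i) (S i)) [1..<Suc j] X f) f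
       = of_real (star_family.defect_form_right n mstar j q f))"
proof (induction j arbitrary: X q)
  case 0
  interpret star_family k n lam "mstar :: nat \<Rightarrow> nat \<Rightarrow> (multiword, 'e) ell2 \<Rightarrow> _"
    by (rule star_family_mstar)
  from 0 show ?case by simp
next
  case (Suc j)
  interpret star_family k n lam "mstar :: nat \<Rightarrow> nat \<Rightarrow> (multiword, 'e) ell2 \<Rightarrow> _"
    by (rule star_family_mstar)
  let ?Y = "id_minus_cp_map (F E) (n (Suc j)) (S (Suc j)) X"
  have FE: "closed_csubspace (F E)" by (rule closed_csubspace_fock[OF E])
  have r: "bounded_op (F E) (F E) (S (Suc j) s)" if "s \<in> {1..n (Suc j)}" for s
    by (rule bounded_op_model[OF _ closed_csubspaceD(1)[OF E]]) (use that Suc.prems in simp)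
  have Y: "bounded_op (F E) (F E) ?Y"
    by (rule bounded_op_id_minus_cp_map[OF FE r Suc.prems(2)])
  have q: "cinner (?Y f) f = of_real (dphi mstar (Suc j) (Suc 0) q f)" if "f \<in> F E" for f
    unfolding dphi_1 phi_def
    by (rule cinner_id_minus_cp_map[OF FE r Suc.prems(2)])
      (use Suc.prems that cadjoint_model[OF _ E] in auto)
  have eq: "foldr (\<lambda>i. id_minus_cp_map (F E) (n i) (S i)) [1..<Suc (Suc j)] X
      = foldr (\<lambda>i. id_minus_cp_map (F E) (n i) (S i)) [1..<Suc j] ?Y" by simp
  show ?case unfolding eq defect_form_right.simps
    by (rule Suc.IH[OF _ Y q]) (use Suc.prems in simp)
qed

lemma model_defect:
  fixes E :: "'e::chilbert_space set"
  assumes E: "closed_csubspace E" and X: "bounded_op (F E) (F E) X"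
    and q: "\<And>f. f \<in> F E \<Longrightarrow> cinner (X f) f = of_real (q f)"
    and inv: "\<And>a f. cmod a = 1 \<Longrightarrow> q (a *\<^sub>C f) = q f"
  shows bounded_op_model_defect: "bounded_op (F E) (F E) (model_defect k n lam E X)"
    and cinner_model_defect: "f \<in> F E \<Longrightarrow>
      cinner (model_defect k n lam E X f) f = of_real (defect_form mstar (Suc 0) k q f)"
proof -
  interpret star_family k n lam "mstar :: nat \<Rightarrow> nat \<Rightarrow> (multiword, 'e) ell2 \<Rightarrow> _"
    by (rule star_family_mstar)
  have "phase_invariant q" using inv by (simp add: phase_invariant_def)
  then have "defect_form_right k q = defect_form mstar (Suc 0) k q" by (rule defect_form_right) simp
  then show "bounded_op (F E) (F E) (model_defect k n lam E X)"
    "f \<in> F E \<Longrightarrow> cinner (model_defect k n lam E X f) f = of_real (defect_form mstar (Suc 0) k q f)"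
    using model_defect_foldr[OF E order_refl X q] by (auto simp: model_defect_def)
qed

section \<open>Multi-analytic operators\<close>

lemma multi_analyticD:
  assumes "multi_analytic k n lam E K \<Psi>"
  shows "bounded_op (F E) (F K) \<Psi>"
    and "letter i s \<Longrightarrow> f \<in> F E \<Longrightarrow> \<Psi> (S i s f) = S i s (\<Psi> f)"
  using assms by (auto simp: multi_analytic_def)

lemma multi_analytic_adjoint:
  fixes E :: "'e::chilbert_space set" and K :: "'f::chilbert_space set"
  assumes \<Psi>: "multi_analytic k n lam E K \<Psi>" and E: "closed_csubspace E" and l: "letter i s" and f: "f \<in> F K"
  shows "mstar i s (cadjoint (F E) \<Psi> f) = cadjoint (F E) \<Psi> (mstar i s f)"
proof (rule csubspace_eqI)
  note FE = closed_csubspace_fock[OF E, of k n] and b = multi_analyticD(1)[OF \<Psi>]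
  show "csubspace (F E)" by (rule closed_csubspaceD(1)[OF FE])
  show "mstar i s (cadjoint (F E) \<Psi> f) \<in> F E" "cadjoint (F E) \<Psi> (mstar i s f) \<in> F E"
    by (intro mstar_fock l closed_csubspaceD E cadjoint_in[OF b FE])+
  fix z assume z: "z \<in> F E"
  have z': "z \<in> F UNIV" "\<Psi> z \<in> F UNIV"
    using fock_mono[OF z] fock_mono[OF bounded_opD(1)[OF b z]] by auto
  have "cinner z (mstar i s (cadjoint (F E) \<Psi> f)) = cinner (\<Psi> (S i s z)) f"
    using model_fock[OF l closed_csubspaceD(1)[OF E] z]
    by (simp add: cinner_model[OF l z'(1), symmetric] cadjoint_right[OF b FE])
  also have "\<dots> = cinner z (cadjoint (F E) \<Psi> (mstar i s f))"
    by (simp add: multi_analyticD(2)[OF \<Psi> l z] cinner_model[OF l z'(2)] cadjoint_right[OF b FE z])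
  finally show "cinner z (mstar i s (cadjoint (F E) \<Psi> f)) = cinner z (cadjoint (F E) \<Psi> (mstar i s f))" .
qed

text \<open>Characteristic functions are obtained from their adjoints: \<open>L\<close> is a kernel,
  which intertwines \<open>mstar\<close>, and passing to adjoints turns this into
  multi-analyticity.\<close>

lemma multi_analytic_cadjoint:
  fixes E :: "'e::chilbert_space set" and K :: "'f::chilbert_space set"
  assumes L: "bounded_op (F K) (F E) L" and E: "closed_csubspace E" and K: "closed_csubspace K"
    and int: "\<And>i s f. letter i s \<Longrightarrow> f \<in> F K \<Longrightarrow> L (mstar i s f) = mstar i s (L f)"
  shows "multi_analytic k n lam E K (cadjoint (F K) L)"
    and "f \<in> F K \<Longrightarrow> cadjoint (F E) (cadjoint (F K) L) f = L f"
proof -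
  note FE = closed_csubspace_fock[OF E, of k n] and FK = closed_csubspace_fock[OF K, of k n]
  note sub = closed_csubspaceD(1)[OF E] closed_csubspaceD(1)[OF K]
  let ?P = "cadjoint (F K) L"
  have b: "bounded_op (F E) (F K) ?P"
    by (rule bounded_op_mono[OF bounded_op_cadjoint[OF L FK]]) (auto simp: cadjoint_in[OF L FK])
  have "?P (S i s u) = S i s (?P u)" if l: "letter i s" and u: "u \<in> F E" for i s u
  proof (rule csubspace_eqI[OF closed_csubspaceD(1)[OF FK]])
    have Pu: "?P u \<in> F K" by (rule bounded_opD(1)[OF b u])
    show "?P (S i s u) \<in> F K" "S i s (?P u) \<in> F K"
      by (rule cadjoint_in[OF L FK], rule model_fock[OF l sub(2) Pu])
    fix z assume z: "z \<in> F K"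
    have u': "u \<in> F UNIV" "?P u \<in> F UNIV" using fock_mono[OF u] fock_mono[OF Pu] by auto
    have "cinner z (?P (S i s u)) = cinner (L z) (S i s u)" by (rule cadjoint_right[OF L FK z, symmetric])
    also have "\<dots> = cinner (L (mstar i s z)) u" by (simp only: cinner_mstar[OF l u'(1), symmetric] int[OF l z])
    also have "\<dots> = cinner (mstar i s z) (?P u)"
      by (rule cadjoint_right[OF L FK mstar_fock[OF l sub(2) z]])
    also have "\<dots> = cinner z (S i s (?P u))" by (rule cinner_mstar[OF l u'(2)])
    finally show "cinner z (?P (S i s u)) = cinner z (S i s (?P u))" .
  qed
  then show "multi_analytic k n lam E K ?P" using b by (simp add: multi_analytic_def)
  show "cadjoint (F E) ?P f = L f" if f: "f \<in> F K"
  proof (rule cadjoint_eqI[OF closed_csubspaceD(1)[OF FE] bounded_opD(1)[OF L f]])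
    show "cinner (?P z) f = cinner z (L f)" for z by (rule cadjoint_left[OF L FK f, symmetric])
  qed
qed

end

section \<open>Positivity of the partial defects of a tuple in the polyball\<close>

locale polyball_tuple = phases +
  fixes T :: "nat \<Rightarrow> nat \<Rightarrow> 'h \<Rightarrow> 'h::chilbert_space"
  assumes T: "T \<in> polyball k n lam"
begin

definition Tst :: "nat \<Rightarrow> nat \<Rightarrow> 'h \<Rightarrow> 'h" where "Tst i s = cadjoint UNIV (T i s)"

lemma row_contraction_T: "i \<in> {1..k} \<Longrightarrow> row_contraction UNIV (n i) (T i)"
  using T unfolding polyball_def by blast

lemma bounded_op_T: "letter i s \<Longrightarrow> bounded_op UNIV UNIV (T i s)"
  using row_contraction_T unfolding row_contraction_def by blast

lemma cinner_T: "letter i s \<Longrightarrow> cinner (T i s x) y = cinner x (Tst i s y)"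
  unfolding Tst_def by (rule cadjoint_right[OF bounded_op_T]) auto

lemma bounded_op_Tst: "letter i s \<Longrightarrow> bounded_op UNIV UNIV (Tst i s)"
  unfolding Tst_def by (rule bounded_op_cadjoint[OF bounded_op_T]) auto

lemma T_commute:
  "letter i s \<Longrightarrow> letter j t \<Longrightarrow> i \<noteq> j \<Longrightarrow> T i s (T j t h) = lam i j s t *\<^sub>C T j t (T i s h)"
  using T unfolding polyball_def by blast

sublocale star_family k n lam Tst
proof
  show "letter i s \<Longrightarrow> Tst i s (a *\<^sub>C x) = a *\<^sub>C Tst i s x" for i s a x
    by (rule bounded_opD(3)[OF bounded_op_Tst]) auto
  fix i s j t x assume l: "letter i s" "letter j t" "i \<noteq> j"
  show "Tst i s (Tst j t x) = lam i j s t *\<^sub>C Tst j t (Tst i s x)"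
  proof (rule csubspace_eqI[OF csubspace_UNIV])
    fix z
    have "lam j i t s = cnj (lam i j s t)" using l by (intro lam_swap) auto
    then have "T j t (T i s z) = cnj (lam i j s t) *\<^sub>C T i s (T j t z)"
      using T_commute[OF l(2,1), of z] l(3) by simp
    then show "cinner z (Tst i s (Tst j t x)) = cinner z (lam i j s t *\<^sub>C Tst j t (Tst i s x))"
      using l by (simp add: cinner_T[symmetric] cinner_simps)
  qed auto
qed

lemma phi_Tst_norm2_le:
  assumes i: "i \<in> {1..k}" shows "phi Tst i norm2 x \<le> norm2 x"
proof -
  have r: "bounded_op UNIV UNIV (T i s)" if "s \<in> {1..n i}" for s using bounded_op_T i that by simp
  have "cinner (id_minus_cp_map UNIV (n i) (T i) id x) x = of_real (norm2 x - (\<Sum>s=1..n i. norm2 (Tst i s x)))"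
    by (rule cinner_id_minus_cp_map[OF closed_csubspace_UNIV r, where A = "Tst i" and q = norm2])
      (simp_all add: id_def bounded_op_id Tst_def cinner_self)
  moreover have "positive_op UNIV (id_minus_cp_map UNIV (n i) (T i) id)"
    using row_contraction_T[OF i] by (simp add: row_contraction_def)
  ultimately have "0 \<le> norm2 x - (\<Sum>s=1..n i. norm2 (Tst i s x))"
    using positive_opD(1)[of UNIV _ x] by (metis Re_complex_of_real UNIV_I)
  then show ?thesis by (simp add: phi_def)
qed

definition scaled :: "real \<Rightarrow> nat \<Rightarrow> nat \<Rightarrow> 'h \<Rightarrow> 'h" where "scaled r i s x = r *\<^sub>R Tst i s x"

lemma scaled_1: "scaled 1 = Tst"
  by (simp add: scaled_def fun_eq_iff)

lemma defect_form_scaled_nonneg: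
  assumes r: "0 \<le> r" "r < 1"
  shows "0 \<le> defect_form (scaled r) (Suc 0) k norm2 x"
proof -
  let ?R = "\<lambda>i s h. r *\<^sub>R T i s h"
  have b: "bounded_op UNIV UNIV (?R i s)" if "letter i s" for i s
  proof -
    have "bounded_op UNIV UNIV (\<lambda>h::'h. r *\<^sub>R h)"
      by (rule bounded_opI[of _ _ _ "\<bar>r\<bar>"])
        (auto simp: scaleR_scaleC scaleC_scaleC scaleC_add_right mult.commute norm_scaleC)
    then show ?thesis using bounded_op_comp[OF bounded_op_T[OF that]] by blast
  qed
  have a: "cadjoint UNIV (?R i s) y = scaled r i s y" if l: "letter i s" for i s y
    by (rule cadjoint_eqI[OF csubspace_UNIV])
      (auto simp: scaled_def scaleR_scaleC cinner_simps cinner_T[OF l])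
  have "cinner (defect k n ?R x) x = of_real (defect_form (scaled r) (Suc 0) k norm2 x)"
    unfolding defect_def using defect_fold[of ?R "scaled r" k] b a by simp
  moreover have "positive_op UNIV (defect k n ?R)" using T r unfolding polyball_def by blast
  ultimately show ?thesis using positive_opD(1)[of UNIV _ x] by (metis Re_complex_of_real UNIV_I)
qed

text \<open>Descends from the full product, dropping the last factor each time by
  \<open>defect_form_descend\<close>; the strict constant there is \<open>r\<^sup>2\<close>.\<close>

lemma defect_form_scaled_initial_nonneg:
  assumes r: "0 \<le> r" "r < 1"
  shows "j \<le> k \<Longrightarrow> 0 \<le> defect_form (scaled r) (Suc 0) (k - j) norm2 x"
proof (induction j arbitrary: x)
  case 0
  then show ?case using defect_form_scaled_nonneg[OF r] by simp
next
  case (Suc j)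
  have le: "phi (scaled r) i norm2 y \<le> r\<^sup>2 * norm2 y" if "i \<in> {1..k}" for i y
  proof -
    have "phi (scaled r) i norm2 y = r\<^sup>2 * phi Tst i norm2 y"
      by (simp add: phi_def scaled_def power_mult_distrib sum_distrib_left)
    then show ?thesis using phi_Tst_norm2_le[OF that, of y] by (simp add: mult_left_mono)
  qed
  have r2: "r\<^sup>2 < 1" using r abs_square_less_1[of r] by simp
  have "Suc (k - Suc j) = k - j" using Suc.prems by simp
  then have pos: "0 \<le> defect_form (scaled r) (Suc 0) (Suc (k - Suc j)) norm2 y" for y
    using Suc.IH[of y] Suc.prems by simp
  show ?case
    by (rule defect_form_descend[where a = "r\<^sup>2" and r = norm2, OF le _ r2 _ _ pos])
      (use Suc.prems in simp_all)
qed

lemma scaled_scaleR: "letter i s \<Longrightarrow> scaled r i s (a *\<^sub>R x) = a *\<^sub>R scaled r i s x"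
  by (simp add: scaled_def scaleR_scaleC A_scaleC scaleC_scaleC mult.commute)

lemma defect_form_scaleR:
  "j \<le> k \<Longrightarrow> defect_form (scaled r) (Suc 0) j norm2 (a *\<^sub>R x) = a\<^sup>2 * defect_form (scaled r) (Suc 0) j norm2 x"
proof (induction j arbitrary: x)
  case (Suc j)
  then have "phi (scaled r) (Suc j) (defect_form (scaled r) (Suc 0) j norm2) (a *\<^sub>R x)
      = a\<^sup>2 * phi (scaled r) (Suc j) (defect_form (scaled r) (Suc 0) j norm2) x"
    by (simp add: phi_def scaled_scaleR sum_distrib_left)
  with Suc show ?case by (simp add: dphi_1 right_diff_distrib)
qed (simp add: power_mult_distrib)

text \<open>By homogeneity \<open>r\<close> leaves the argument as a factor
  \<open>r\<^sup>2\<close>, so the recursion only combines continuous functions of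
  \<open>r\<close>.\<close>

lemma continuous_defect_form_scaled:
  "j \<le> k \<Longrightarrow> continuous_on UNIV (\<lambda>r. defect_form (scaled r) (Suc 0) j norm2 x)"
proof (induction j arbitrary: x)
  case (Suc j)
  have "defect_form (scaled r) (Suc 0) (Suc j) norm2 x = defect_form (scaled r) (Suc 0) j norm2 x
      - (\<Sum>s=1..n (Suc j). r\<^sup>2 * defect_form (scaled r) (Suc 0) j norm2 (Tst (Suc j) s x))" for r
    using Suc.prems by (simp add: dphi_1 phi_def scaled_def[of r "Suc j"] defect_form_scaleR)
  moreover have "continuous_on UNIV (\<lambda>r. defect_form (scaled r) (Suc 0) j norm2 y)" for y
    using Suc by simp
  ultimately show ?case by (simp only:) (intro continuous_intros)
qed simp

text \<open>The descent needs strict contractions, so the partial products are handled for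
  \<open>r < 1\<close> and positivity reaches \<open>r = 1\<close> by continuity.\<close>

lemma defect_form_Tst_nonneg:
  assumes "j \<le> k" shows "0 \<le> defect_form Tst (Suc 0) j norm2 x"
proof (rule LIMSEQ_le_const)
  have "(\<lambda>m. 1 - inverse (real (Suc m))) \<longlonglongrightarrow> 1 - 0"
    by (intro tendsto_diff tendsto_const LIMSEQ_inverse_real_of_nat)
  then have "(\<lambda>m. defect_form (scaled (1 - inverse (real (Suc m)))) (Suc 0) j norm2 x)
      \<longlonglongrightarrow> defect_form (scaled (1 - 0)) (Suc 0) j norm2 x"
    using continuous_on_tendsto_compose[OF continuous_defect_form_scaled[OF assms]] by auto
  then show "(\<lambda>m. defect_form (scaled (1 - inverse (real (Suc m)))) (Suc 0) j norm2 x)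
      \<longlonglongrightarrow> defect_form Tst (Suc 0) j norm2 x" by (simp add: scaled_1)
  have "0 \<le> defect_form (scaled (1 - inverse (real (Suc m)))) (Suc 0) j norm2 x" for m
    using defect_form_scaled_initial_nonneg[of "1 - inverse (real (Suc m))" "k - j" x] assms
    by (simp add: inverse_le_1_iff)
  then show "\<exists>N. \<forall>m\<ge>N. 0 \<le> defect_form (scaled (1 - inverse (real (Suc m)))) (Suc 0) j norm2 x" by blast
qed

section \<open>The Berezin kernel\<close>

abbreviation "\<Delta> \<equiv> defect k n T"
abbreviation "R \<equiv> positive_sqrt \<Delta>"
abbreviation "D \<equiv> defect_space k n T"
abbreviation "K \<equiv> berezin k n T"

lemma bounded_op_defect: "bounded_op UNIV UNIV \<Delta>"
  and cinner_defect: "cinner (\<Delta> x) x = of_real (defect_form Tst (Suc 0) k norm2 x)"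
proof -
  have "bounded_op UNIV UNIV \<Delta> \<and> (\<forall>x. cinner (\<Delta> x) x = of_real (defect_form Tst (Suc 0) k norm2 x))"
    unfolding defect_def
    by (rule defect_fold[OF bounded_op_T _ order_refl]) (simp_all add: Tst_def)
  then show "bounded_op UNIV UNIV \<Delta>" "cinner (\<Delta> x) x = of_real (defect_form Tst (Suc 0) k norm2 x)"
    by blast+
qed

lemma positive_defect: "positive_op UNIV \<Delta>"
  using defect_form_Tst_nonneg[of k] by (simp add: positive_op_def cinner_defect complex_nonneg_Reals_iff)

lemmas R_bounded = bounded_op_positive_sqrt[OF bounded_op_defect positive_defect]

lemma norm_R: "norm2 (R x) = defect_form Tst (Suc 0) k norm2 x"
  by (simp add: norm_positive_sqrt[OF bounded_op_defect positive_defect] cinner_defect)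

lemma D_closed: "closed_csubspace D"
  unfolding defect_space_def
  by (rule closed_csubspace_closure[OF csubspace_image[OF bounded_op_defect csubspace_UNIV]])

lemma D_eq: "D = closure (range R)"
  unfolding defect_space_def
  by (rule closure_range_positive_sqrt[OF bounded_op_defect positive_defect, symmetric])

lemma R_D: "bounded_op UNIV D R"
  by (rule bounded_op_mono[OF R_bounded]) (use closure_subset[of "range R"] in \<open>auto simp: D_eq\<close>)

lemma phase_invariant_norm2: "phase_invariant norm2"
  by (simp add: phase_invariant_def norm_scaleC)

text \<open>For a general tuple only an inequality holds: the truncated sums stay below
  \<open>norm2 x\<close> since all partial defects are nonnegative. It makes \<open>K\<close> a
  contraction.\<close>

lemma R_summable:
  "(\<lambda>\<beta>. norm2 (R (act Tst k \<beta> x))) summable_on mw"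
  "(\<Sum>\<^sub>\<infinity>\<beta>\<in>mw. norm2 (R (act Tst k \<beta> x))) \<le> norm2 x"
proof -
  have "defect_form Tst p k norm2 x \<le> norm2 x" if "p > 0" for p
    by (rule defect_form_le[OF phase_invariant_norm2 defect_form_Tst_nonneg that order_refl])
  then show "(\<lambda>\<beta>. norm2 (R (act Tst k \<beta> x))) summable_on mw"
    "(\<Sum>\<^sub>\<infinity>\<beta>\<in>mw. norm2 (R (act Tst k \<beta> x))) \<le> norm2 x"
    unfolding norm_R
    using defect_form_summable[OF phase_invariant_norm2, of x "norm2 x"] defect_form_Tst_nonneg[of k] by auto
qed

lemmas Tst_add = bounded_opD(2)[OF bounded_op_Tst UNIV_I UNIV_I]

lemma kernel_Tst:
  shows "coord (kernel Tst R h) \<beta> = (if \<beta> \<in> mw then R (act Tst k \<beta> h) else 0)"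
    and "(norm (kernel Tst R h))\<^sup>2 = (\<Sum>\<^sub>\<infinity>\<beta>\<in>mw. norm2 (R (act Tst k \<beta> h)))"
    and "norm (kernel Tst R h) \<le> norm h"
    and "bounded_op UNIV (F D) (kernel Tst R)"
    and "letter i s \<Longrightarrow> kernel Tst R (Tst i s h) = mstar i s (kernel Tst R h)"
proof -
  show "coord (kernel Tst R h) \<beta> = (if \<beta> \<in> mw then R (act Tst k \<beta> h) else 0)"
    by (rule coord_kernel[where M = UNIV and E = D], rule Tst_add) (simp_all add: R_D R_summable)
  show "(norm (kernel Tst R h))\<^sup>2 = (\<Sum>\<^sub>\<infinity>\<beta>\<in>mw. norm2 (R (act Tst k \<beta> h)))"
    by (rule norm_kernel[where M = UNIV and E = D], rule Tst_add) (simp_all add: R_D R_summable)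
  show "norm (kernel Tst R h) \<le> norm h"
    by (rule norm_kernel_le[where M = UNIV and E = D], rule Tst_add) (simp_all add: R_D R_summable)
  show "bounded_op UNIV (F D) (kernel Tst R)"
    by (rule bounded_op_kernel, rule Tst_add) (simp_all add: R_D R_summable)
  show "kernel Tst R (Tst i s h) = mstar i s (kernel Tst R h)" if "letter i s"
    by (rule kernel_intertwine[where M = UNIV and E = D], rule Tst_add)
      (use that in \<open>simp_all add: R_D R_summable\<close>)
qed

lemma cadjoint_word_op:
  assumes "i \<in> {1..k}" "set w \<subseteq> {1..n i}"
  shows "cadjoint UNIV (word_op (T i) w) y = fold (Tst i) w y"
proof (rule cadjoint_eqI[OF csubspace_UNIV UNIV_I])
  show "cinner (word_op (T i) w z) y = cinner z (fold (Tst i) w y)" for z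
    using assms(2)
  proof (induction w arbitrary: y)
    case (Cons s w)
    then show ?case using assms(1) by (simp add: word_op_def cinner_T)
  qed (simp add: word_op_def)
qed

lemma berezin_eq: "K h = kernel Tst R h"
proof -
  have "fold (\<lambda>i. cadjoint UNIV (word_op (T i) (\<beta> i))) [1..<Suc k] = act Tst k \<beta>" if "\<beta> \<in> mw" for \<beta>
    unfolding act_def
  proof (rule ext, rule fold_cong[OF refl refl])
    fix i assume "i \<in> set [1..<Suc k]"
    then have "i \<in> {1..k}" "set (\<beta> i) \<subseteq> {1..n i}" using that by (auto simp: multiwords_def)
    then show "cadjoint UNIV (word_op (T i) (\<beta> i)) = fold (Tst i) (\<beta> i)"
      by (intro ext cadjoint_word_op)
  qed
  then have "K h = (\<Sum>\<^sub>\<infinity>\<beta>\<in>mw. single \<beta> (coord (kernel Tst R h) \<beta>))"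
    unfolding berezin_def by (intro infsum_cong) (simp add: kernel_Tst(1))
  also have "\<dots> = kernel Tst R h"
    by (intro infsumI has_sum_single) (simp add: kernel_Tst(1))
  finally show ?thesis .
qed

lemma coord_K: "coord (K h) \<beta> = (if \<beta> \<in> mw then R (act Tst k \<beta> h) else 0)"
  by (simp add: berezin_eq kernel_Tst(1))

lemma norm_K_le: "norm (K h) \<le> norm h"
  by (simp add: berezin_eq kernel_Tst(3))

lemma bounded_op_K: "bounded_op UNIV (F D) K"
  using kernel_Tst(4) by (simp add: berezin_eq[abs_def])

lemma K_Tst: "letter i s \<Longrightarrow> K (Tst i s h) = mstar i s (K h)"
  by (simp add: berezin_eq kernel_Tst(5))

text \<open>Purity makes the truncated forms tend to \<open>norm2 h\<close>, which turns the
  inequality of \<open>R_summable\<close> into an equality.\<close>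

lemma norm_K_pure:
  assumes "pure_tuple k n T" shows "norm (K h) = norm h"
proof -
  have 0: "(\<lambda>p. (phi Tst i ^^ p) norm2 h) \<longlonglongrightarrow> 0" if i: "i \<in> {1..k}" for i
  proof -
    have "(\<lambda>p. Re (cinner ((cp_map UNIV (n i) (T i) ^^ p) id h) h)) \<longlonglongrightarrow> Re 0"
      by (rule tendsto_Re) (use assms i in \<open>simp add: pure_tuple_def\<close>)
    then show ?thesis using cp_map_pow[of i T Tst, OF i bounded_op_T] by (simp add: Tst_def)
  qed
  have "(\<lambda>p. defect_form Tst p k norm2 h) \<longlonglongrightarrow> norm2 h"
    by (rule defect_form_tendsto[where r = norm2]) (use 0 phi_Tst_norm2_le in auto)
  then have "(\<Sum>\<^sub>\<infinity>\<beta>\<in>mw. defect_form Tst (Suc 0) k norm2 (act Tst k \<beta> h)) = norm2 h"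
    by (rule defect_form_infsum(2)[OF phase_invariant_norm2 defect_form_Tst_nonneg[OF order_refl]])
  then have "norm2 (K h) = norm2 h" by (simp add: berezin_eq kernel_Tst(2) norm_R)
  then show ?thesis by (simp add: power2_eq_iff_nonneg)
qed

abbreviation "Kst \<equiv> cadjoint UNIV K"

lemma FD_closed: "closed_csubspace (F D)"
  by (rule closed_csubspace_fock[OF D_closed])

lemma cinner_K: "cinner (K h) f = cinner h (Kst f)"
  by (rule cadjoint_right[OF bounded_op_K]) auto

lemma bounded_op_Kst: "bounded_op UNIV UNIV Kst"
  by (rule bounded_op_cadjoint[OF bounded_op_K]) auto

lemma norm_Kst_le: "norm (Kst f) \<le> norm f"
proof (cases "Kst f = 0")
  case False
  have "norm2 (Kst f) = Re (cinner (K (Kst f)) f)" by (simp add: cinner_K cinner_self)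
  also have "\<dots> \<le> norm (K (Kst f)) * norm f" using norm_cinner_le complex_Re_le_cmod order_trans by blast
  also have "\<dots> \<le> norm (Kst f) * norm f" by (intro mult_right_mono norm_K_le) simp
  finally show ?thesis using False by (simp add: power2_eq_square)
qed simp

section \<open>Characteristic functions and positivity of the model defect\<close>

abbreviation "X \<equiv> \<lambda>f. f - K (Kst f)"

definition g :: "(multiword, 'h) ell2 \<Rightarrow> real" where "g f = norm2 f - norm2 (Kst f)"

lemma bounded_op_X: "bounded_op (F D) (F D) X"
  by (rule bounded_op_diff_op[OF bounded_op_id _ closed_csubspaceD(1)[OF FD_closed]],
      rule bounded_op_mono[OF bounded_op_comp[OF bounded_op_Kst bounded_op_K]])
    (auto simp: bounded_opD(1)[OF bounded_op_K])

lemma cinner_X: "cinner (X f) f = of_real (g f)"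
  by (simp add: g_def cinner_diff_left cinner_K cinner_self)

lemma g_phase: "cmod a = 1 \<Longrightarrow> g (a *\<^sub>C f) = g f"
  by (simp add: g_def norm_scaleC bounded_opD(3)[OF bounded_op_Kst])

lemma g_abs: "\<bar>g f\<bar> \<le> norm2 f"
  using norm_Kst_le[of f] by (simp add: g_def abs_le_iff power_mono)

abbreviation "\<gamma> \<equiv> defect_form mstar (Suc 0) k g"

lemma cinner_model_defect_X: "f \<in> F D \<Longrightarrow> cinner (model_defect k n lam D X f) f = of_real (\<gamma> f)"
  using cinner_model_defect[OF D_closed bounded_op_X cinner_X g_phase] by simp

lemma positive_model_defect_iff:
  "positive_op (F D) (model_defect k n lam D X) \<longleftrightarrow> (\<forall>f\<in>F D. 0 \<le> \<gamma> f)"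
  by (simp add: positive_op_def cinner_model_defect_X complex_nonneg_Reals_iff)

text \<open>The factorization makes \<open>g\<close> the squared norm of the adjoint of \<Psi>, and
  that adjoint intertwines the adjoint shifts. Hence \<open>\<gamma> f\<close> is the squared norm
  of a vacuum coefficient.\<close>

lemma defect_positive_of_factorization:
  fixes E :: "'e::chilbert_space set"
  assumes E: "closed_csubspace E" and \<Psi>: "multi_analytic k n lam E D \<Psi>"
    and fac: "\<And>f. f \<in> F D \<Longrightarrow> K (Kst f) + \<Psi> (cadjoint (F E) \<Psi> f) = f" and f: "f \<in> F D"
  shows "0 \<le> \<gamma> f"
proof -
  note FE = closed_csubspace_fock[OF E, of k n] and b = multi_analyticD(1)[OF \<Psi>]
  let ?W = "cadjoint (F E) \<Psi>"
  have WE: "?W f \<in> F E" for f by (rule cadjoint_in[OF b FE])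
  have g: "g f = norm2 (?W f)" if "f \<in> F D" for f
  proof -
    have "X f = \<Psi> (?W f)" using fac[OF that] by (simp add: algebra_simps)
    then have "complex_of_real (g f) = of_real (norm2 (?W f))"
      by (metis cinner_X cadjoint_right[OF b FE WE] cinner_self)
    then show ?thesis by (simp only: of_real_eq_iff)
  qed
  have "\<gamma> f = defect_form mstar (Suc 0) k norm2 (?W f)"
    by (rule defect_form_intertwine[of "F D"])
      (use multi_analytic_adjoint[OF \<Psi> E] mstar_fock[OF _ closed_csubspaceD(1)[OF D_closed]] g f in auto)
  also have "\<dots> = norm2 (coord (?W f) vacuum)"
    by (rule defect_form_mstar) (use fock_mono[OF WE] in auto)
  finally show ?thesis by simp
qed

text \<open>Purity of the model makes the squared norm of the kernel equal to \<open>g\<close>, and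
  the adjoint of the kernel is the characteristic function. \<open>J\<close> only moves values into
  the type \<open>'e\<close>, all of which serves as coefficient space.\<close>

lemma factorization_of_defect_positive:
  fixes J :: "(multiword, 'h) ell2 \<Rightarrow> 'e::chilbert_space"
  assumes pos: "\<And>f. f \<in> F D \<Longrightarrow> 0 \<le> \<gamma> f"
    and J: "bounded_op UNIV UNIV J" "\<And>x. norm (J x) = norm x"
  obtains \<Psi> :: "(multiword, 'e) ell2 \<Rightarrow> (multiword, 'h) ell2"
  where "multi_analytic k n lam UNIV D \<Psi>"
    "\<And>f. f \<in> F D \<Longrightarrow> K (Kst f) + \<Psi> (cadjoint (F UNIV) \<Psi> f) = f"
proof -
  interpret m: star_family k n lam "mstar :: nat \<Rightarrow> nat \<Rightarrow> (multiword, 'h) ell2 \<Rightarrow> _"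
    by (rule star_family_mstar)
  note sub = closed_csubspaceD(1)[OF FD_closed]
  \<comment> \<open>Square roots are taken on a whole type, so the model defect is extended by 0 on
    the orthogonal complement of \<open>F D\<close>.\<close>
  define G where "G = (\<lambda>f. model_defect k n lam D X (proj (F D) f))"
  have bG: "bounded_op (F D) (F D) (model_defect k n lam D X)"
    by (rule bounded_op_model_defect[OF D_closed bounded_op_X cinner_X g_phase])
  have G: "bounded_op UNIV UNIV G" unfolding G_def
    by (rule bounded_op_mono[OF bounded_op_comp[OF bounded_op_proj[OF FD_closed] bG]]) auto
  have Gq: "cinner (G f) f = of_real (\<gamma> (proj (F D) f))" for f
  proof -
    have p: "proj (F D) f \<in> F D" by (rule proj_in[OF FD_closed])
    have "cinner (G f) f = cinner (G f) (proj (F D) f)"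
      using proj_cinner2[OF FD_closed, of "G f" f] bounded_opD(1)[OF bG p] by (simp add: G_def)
    then show ?thesis using cinner_model_defect_X[OF p] by (simp add: G_def)
  qed
  have Gpos: "positive_op UNIV G"
    using pos proj_in[OF FD_closed] by (simp add: positive_op_def Gq complex_nonneg_Reals_iff)
  define B where "B = (\<lambda>f. J (positive_sqrt G f))"
  have B: "bounded_op (F D) UNIV B" unfolding B_def
    by (rule bounded_op_mono[OF bounded_op_comp[OF bounded_op_positive_sqrt[OF G Gpos] J(1)]]) auto
  have nB: "norm2 (B f) = \<gamma> f" if "f \<in> F D" for f
    by (simp add: B_def J(2) norm_positive_sqrt[OF G Gpos] Gq proj_ident[OF FD_closed that])
  have mF: "mstar i s f \<in> F D" if "letter i s" "f \<in> F D" for i s f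
    by (rule mstar_fock[OF that(1) closed_csubspaceD(1)[OF D_closed] that(2)])
  have aF: "act mstar k \<beta> f \<in> F D" if "\<beta> \<in> mw" "f \<in> F D" for \<beta> f
    by (rule act_closed[OF _ that(1) order_refl that(2)]) (rule mF)
  have ginv: "m.phase_invariant g" using g_phase by (simp add: m.phase_invariant_def)
  have lim: "(\<lambda>p. defect_form mstar p k g f) \<longlonglongrightarrow> g f" if "f \<in> F D" for f
    by (rule defect_form_tendsto[where r = norm2])
      (use g_abs phi_mstar_norm2_le phi_mstar_pow_tendsto fock_mono[OF that, of UNIV] in simp_all)
  have pos': "0 \<le> \<gamma> (act mstar k \<beta> f)" if "f \<in> F D" "\<beta> \<in> mw" for \<beta> f
    using pos aF that by blast
  note sums = m.defect_form_infsum[OF ginv pos' lim]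
  have eqB: "(\<Sum>\<^sub>\<infinity>\<beta>\<in>mw. norm2 (B (act mstar k \<beta> f))) = g f" if "f \<in> F D" for f
    using sums(2)[OF that _ that] that by (simp add: nB aF cong: infsum_cong)
  have sB: "(\<lambda>\<beta>. norm2 (B (act mstar k \<beta> f))) summable_on mw" if "f \<in> F D" for f
    using sums(1)[OF that _ that] by (rule summable_on_cong[THEN iffD1, rotated]) (use that in \<open>simp_all add: nB aF\<close>)
  have leB: "(\<Sum>\<^sub>\<infinity>\<beta>\<in>mw. norm2 (B (act mstar k \<beta> f))) \<le> norm2 f" if "f \<in> F D" for f
    using eqB[OF that] g_abs[of f] by simp
  define L where "L = kernel mstar B"
  have L: "bounded_op (F D) (F UNIV) L" unfolding L_def
    by (rule m.bounded_op_kernel, rule mstar_linear(1)) (simp_all add: mF sub B sB leB)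
  have Lm: "L (mstar i s f) = mstar i s (L f)" if "letter i s" "f \<in> F D" for i s f
    unfolding L_def by (rule m.kernel_intertwine[where M = "F D" and E = UNIV], rule mstar_linear(1))
      (use that in \<open>simp_all add: mF sub B sB leB\<close>)
  have nL: "norm2 (L f) = g f" if "f \<in> F D" for f
    unfolding L_def eqB[OF that, symmetric]
    by (rule m.norm_kernel[where M = "F D" and E = UNIV], rule mstar_linear(1))
      (use that in \<open>simp_all add: mF sub B sB leB\<close>)
  define \<Psi> where "\<Psi> = cadjoint (F D) L"
  note ma = multi_analytic_cadjoint[OF L closed_csubspace_UNIV D_closed Lm]
  have "K (Kst f) + \<Psi> (cadjoint (F UNIV) \<Psi> f) = f" if f: "f \<in> F D" for f
  proof -
    \<comment> \<open>Both operators have the form \<open>g\<close>, so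
      \<open>bounded_op_eq_zero\<close> identifies them.\<close>
    let ?Z = "\<lambda>f. X f - \<Psi> (L f)"
    have "bounded_op (F D) (F D) (\<lambda>f. \<Psi> (L f))" unfolding \<Psi>_def
      by (rule bounded_op_comp[OF L multi_analyticD(1)[OF ma(1)]]) auto
    then have Z: "bounded_op (F D) (F D) ?Z" by (rule bounded_op_diff_op[OF bounded_op_X _ sub])
    have "cinner (?Z u) u = 0" if u: "u \<in> F D" for u
    proof -
      have "cinner (\<Psi> (L u)) u = cinner (L u) (L u)"
        unfolding \<Psi>_def by (rule cadjoint_left[OF L FD_closed u, symmetric])
      then show ?thesis using cinner_X[of u] nL[OF u] by (simp add: cinner_diff_left cinner_self)
    qed
    from bounded_op_eq_zero[OF Z sub this f]
    have "f - K (Kst f) - \<Psi> (L f) = 0" by simp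
    moreover have "cadjoint (F UNIV) \<Psi> f = L f" unfolding \<Psi>_def by (rule ma(2)[OF _ _ f]) auto
    ultimately show ?thesis by (simp add: algebra_simps)
  qed
  moreover have "multi_analytic k n lam UNIV D \<Psi>" unfolding \<Psi>_def by (rule ma(1)) auto
  ultimately show ?thesis using that by blast
qed

end

section \<open>Beurling type subspaces\<close>

context phases
begin

lemma norm_row_model:
  fixes x :: "nat \<Rightarrow> (multiword, 'z::complex_inner) ell2"
  assumes i: "i \<in> {1..k}" and x: "\<And>s. s \<in> {1..n i} \<Longrightarrow> x s \<in> F UNIV"
  shows "norm2 (\<Sum>s=1..n i. S i s (x s)) = (\<Sum>s=1..n i. norm2 (x s))"
proof -
  have "cinner (\<Sum>s=1..n i. S i s (x s)) (\<Sum>s=1..n i. S i s (x s))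
      = (\<Sum>s=1..n i. \<Sum>t=1..n i. cinner (S i t (x t)) (S i s (x s)))"
    by (simp add: cinner_sum_left cinner_sum_right)
  also have "\<dots> = (\<Sum>s=1..n i. \<Sum>t=1..n i. if t = s then cinner (x s) (x s) else 0)"
  proof (intro sum.cong refl)
    fix s t assume st: "s \<in> {1..n i}" "t \<in> {1..n i}"
    then have "cinner (S i t (x t)) (S i s (x s)) = cinner (x t) (mstar i t (S i s (x s)))"
      using i x by (intro cinner_model) auto
    then show "cinner (S i t (x t)) (S i s (x s)) = (if t = s then cinner (x s) (x s) else 0)"
      using st i x mstar_model[of i t s "x s"] by simp
  qed
  also have "\<dots> = (\<Sum>s=1..n i. cinner (x s) (x s))" by (simp cong: if_cong)
  finally have "complex_of_real (norm2 (\<Sum>s=1..n i. S i s (x s))) = of_real (\<Sum>s=1..n i. norm2 (x s))"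
    by (simp only: cinner_self of_real_sum)
  then show ?thesis by (simp only: of_real_eq_iff)
qed

section \<open>Structure of inner multi-analytic operators\<close>

context
  fixes L :: "'e::chilbert_space set" and E :: "'f::chilbert_space set" and \<Psi> :: "(multiword, 'e) ell2 \<Rightarrow> (multiword, 'f) ell2"
  assumes L: "closed_csubspace L" and E: "closed_csubspace E" and inner_\<Psi>: "inner_multi_analytic k n lam L E \<Psi>"
begin

abbreviation "ker_space \<equiv> {z \<in> F L. \<Psi> z = 0}"
abbreviation "initial_space \<equiv> orthocomp_in (F L) ker_space"
abbreviation "W \<equiv> cadjoint (F L) \<Psi>"

lemma multi_analytic_inner: "multi_analytic k n lam L E \<Psi>"
  using inner_\<Psi> by (simp add: inner_multi_analytic_def)

lemmas bounded_\<Psi> = multi_analyticD(1)[OF multi_analytic_inner] and \<Psi>_model = multi_analyticD(2)[OF multi_analytic_inner]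
lemmas FL = closed_csubspace_fock[OF L, of k n] and FE = closed_csubspace_fock[OF E, of k n]
lemmas W_in = cadjoint_in[OF bounded_\<Psi> FL] and W_right = cadjoint_right[OF bounded_\<Psi> FL] and W_left = cadjoint_left[OF bounded_\<Psi> FL]

lemma norm_initial: "x \<in> initial_space \<Longrightarrow> norm (\<Psi> x) = norm x"
  using inner_\<Psi> by (simp add: inner_multi_analytic_def partial_isometry_def)

lemma initial_closed: "closed_csubspace initial_space"
  by (rule closed_csubspace_orthocomp_in[OF FL])

lemma initial_FL: "x \<in> initial_space \<Longrightarrow> x \<in> F L"
  by (simp add: orthocomp_in_def)

lemma bounded_W: "bounded_op UNIV (F L) W"
  by (rule bounded_op_cadjoint[OF bounded_\<Psi> FL])

text \<open>\<Psi> is isometric on the initial space, so \<open>W\<close> after \<Psi> has the form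
  of the identity there. The values of \<open>W\<close> are orthogonal to the kernel, so
  \<open>bounded_op_eq_zero\<close> can be applied inside \<open>initial_space\<close>.\<close>

lemma W_\<Psi>:
  assumes a: "a \<in> initial_space" shows "W (\<Psi> a) = a"
proof -
  have WN: "W (\<Psi> a) \<in> initial_space" if "a \<in> F L" for a
    using W_in by (simp add: orthocomp_in_def W_left[symmetric])
  let ?Z = "\<lambda>a. W (\<Psi> a) - a"
  have "bounded_op initial_space initial_space (\<lambda>a. W (\<Psi> a))"
    by (rule bounded_op_mono[OF bounded_op_comp[OF bounded_\<Psi> bounded_op_mono[OF bounded_W]]])
      (auto simp: initial_FL WN intro: W_in)
  then have Z: "bounded_op initial_space initial_space ?Z"
    by (rule bounded_op_diff_op[OF _ bounded_op_id closed_csubspaceD(1)[OF initial_closed]])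
  have "?Z a = 0"
  proof (rule bounded_op_eq_zero[OF Z closed_csubspaceD(1)[OF initial_closed] _ a])
    fix z assume z: "z \<in> initial_space"
    have "cinner (W (\<Psi> z)) z = cinner (\<Psi> z) (\<Psi> z)" by (rule W_left[OF initial_FL[OF z], symmetric])
    then show "cinner (W (\<Psi> z) - z) z = 0" by (simp add: cinner_diff_left cinner_self norm_initial[OF z])
  qed
  then show ?thesis by simp
qed

lemma ker_closed: "closed_csubspace ker_space"
  unfolding closed_csubspace_def
proof
  note sub = closed_csubspaceD(1)[OF FL]
  show "csubspace ker_space"
    using csubspaceD[OF sub] bounded_opD[OF bounded_\<Psi>] bounded_op_zero[OF bounded_\<Psi> csubspaceD(1)[OF sub]]
    by (auto simp: csubspace_def)
  show "closed ker_space" unfolding closed_sequential_limits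
  proof (intro allI impI, elim conjE)
    fix f l assume f: "\<forall>m. f m \<in> ker_space" "f \<longlonglongrightarrow> l"
    have fL: "f m \<in> F L" for m using f by simp
    have l: "l \<in> F L" by (rule closed_sequentially[OF closed_csubspaceD(2)[OF FL] fL f(2)])
    have "(\<lambda>m. \<Psi> (f m)) \<longlonglongrightarrow> \<Psi> l" by (rule bounded_op_tendsto[OF bounded_\<Psi> sub fL f(2) l])
    moreover have "(\<lambda>m. \<Psi> (f m)) \<longlonglongrightarrow> 0" using f by simp
    ultimately have "\<Psi> l = 0" by (rule LIMSEQ_unique)
    with l show "l \<in> ker_space" by simp
  qed
qed

lemma initial_decomp:
  assumes z: "z \<in> F L"
  shows "z - proj ker_space z \<in> initial_space" and "\<Psi> (z - proj ker_space z) = \<Psi> z"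
proof -
  have p: "proj ker_space z \<in> ker_space" by (rule proj_in[OF ker_closed])
  then show "z - proj ker_space z \<in> initial_space" using z
    by (auto simp: orthocomp_in_def proj_orth[OF ker_closed] intro: csubspaceD[OF closed_csubspaceD(1)[OF FL]])
  show "\<Psi> (z - proj ker_space z) = \<Psi> z"
    using p by (subst bounded_op_diff[OF bounded_\<Psi> closed_csubspaceD(1)[OF FL] z]) auto
qed

lemma range_initial:
  assumes "m \<in> \<Psi> ` F L" obtains a where "a \<in> initial_space" "m = \<Psi> a"
proof -
  obtain z where z: "z \<in> F L" "m = \<Psi> z" using assms by blast
  show ?thesis by (rule that[OF initial_decomp(1)[OF z(1)]]) (simp add: initial_decomp(2)[OF z(1)] z(2))
qed

lemma \<Psi>_W:
  assumes "m \<in> \<Psi> ` F L" shows "\<Psi> (W m) = m"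
proof -
  obtain a where "a \<in> initial_space" "m = \<Psi> a" by (rule range_initial[OF assms])
  then show ?thesis by (simp only: W_\<Psi>)
qed

text \<open>The range consists of the fixed points of the bounded operator \<open>\<Psi>\<close>
  after \<open>W\<close>.\<close>

lemma range_closed: "closed_csubspace (\<Psi> ` F L)"
  unfolding closed_csubspace_def
proof
  show "csubspace (\<Psi> ` F L)" by (rule csubspace_image[OF bounded_\<Psi> closed_csubspaceD(1)[OF FL]])
  show "closed (\<Psi> ` F L)" unfolding closed_sequential_limits
  proof (intro allI impI, elim conjE)
    fix f l assume f: "\<forall>m. f m \<in> \<Psi> ` F L" "f \<longlonglongrightarrow> l"
    have "(\<lambda>m. \<Psi> (W (f m))) \<longlonglongrightarrow> \<Psi> (W l)"
      by (rule bounded_op_tendsto[OF bounded_op_comp[OF bounded_W bounded_\<Psi>] _ _ f(2)]) auto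
    moreover have "\<Psi> (W (f m)) = f m" for m using f(1) \<Psi>_W by blast
    ultimately have "\<Psi> (W l) = l" using f(2) LIMSEQ_unique by simp
    then show "l \<in> \<Psi> ` F L" using W_in[of l] by (metis imageI)
  qed
qed

lemma range_FE: "m \<in> \<Psi> ` F L \<Longrightarrow> m \<in> F E"
  using bounded_opD(1)[OF bounded_\<Psi>] by blast

text \<open>The final projection of a partial isometry. It leads from Beurling type subspaces back
  to factorizations of \<open>X\<close>.\<close>

lemma inner_factorization: "\<Psi> (W f) = proj (\<Psi> ` F L) f"
proof (rule proj_eqI[OF range_closed, symmetric])
  show "\<Psi> (W f) \<in> \<Psi> ` F L" using W_in by blast
  fix m assume "m \<in> \<Psi> ` F L"
  then obtain a where a: "a \<in> initial_space" "m = \<Psi> a" by (rule range_initial)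
  have "cinner m (\<Psi> (W f)) = cinner (W m) (W f)" by (rule W_left[OF W_in])
  also have "\<dots> = cinner a (W f)" using W_\<Psi>[OF a(1)] a(2) by simp
  also have "\<dots> = cinner m f" unfolding a(2) by (rule W_right[OF initial_FL[OF a(1)], symmetric])
  finally show "cinner m (\<Psi> (W f)) = cinner m f" .
qed

text \<open>The initial space reduces the model: \<open>\<Psi>\<close> and the shifts are isometric on it, and a vector whose
  norm is preserved by \<open>\<Psi>\<close> is orthogonal to the kernel.\<close>

lemma initial_model:
  assumes l: "letter i s" and u: "u \<in> initial_space"
  shows "S i s u \<in> initial_space" "mstar i s u \<in> initial_space"
proof -
  note Lsub = closed_csubspaceD(1)[OF L]
  have uL: "u \<in> F L" by (rule initial_FL[OF u])
  have uU: "u \<in> F UNIV" "\<Psi> u \<in> F UNIV"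
    using fock_mono[OF uL] fock_mono[OF bounded_opD(1)[OF bounded_\<Psi> uL]] by auto
  define v where "v = S i s u"
  have v: "v \<in> F L" unfolding v_def by (rule model_fock[OF l Lsub uL])
  have "norm v = norm (\<Psi> v)"
    by (simp add: v_def \<Psi>_model[OF l uL] norm_model[OF l] uU norm_initial[OF u])
  also have "\<dots> = norm (v - proj ker_space v)"
    using norm_initial[OF initial_decomp(1)[OF v]] initial_decomp(2)[OF v] by simp
  finally have "proj ker_space v = 0" using norm_proj_split[OF ker_closed, of v] by simp
  then show "S i s u \<in> initial_space" using initial_decomp(1)[OF v] by (simp add: v_def)
  have "cinner (mstar i s u) z = 0" if z: "z \<in> ker_space" for z
  proof -
    have z': "z \<in> F L" "z \<in> F UNIV" using z fock_mono[of z k n L UNIV] by auto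
    have "\<Psi> (S i s z) = S i s 0" using z \<Psi>_model[OF l z'(1)] by simp
    moreover have "norm (S i s 0 :: (multiword, 'f) ell2) = 0" by (simp add: norm_model[OF l zero_fock])
    ultimately have "S i s z \<in> ker_space" using model_fock[OF l Lsub z'(1)] by simp
    then show ?thesis using u by (simp add: cinner_mstar[OF l z'(2)] orthocomp_in_def)
  qed
  then show "mstar i s u \<in> initial_space" using mstar_fock[OF l Lsub uL] by (simp add: orthocomp_in_def)
qed

text \<open>\<Psi> maps the reducing \<open>initial_space\<close> unitarily onto the range and
  intertwines the shifts, so the adjoint of the restricted shift is \<open>mstar\<close> carried
  over by \<Psi>.\<close>

lemma cadjoint_range_model:
  assumes l: "letter i s" and u: "u \<in> initial_space"
  shows "cadjoint (\<Psi> ` F L) (S i s) (\<Psi> u) = \<Psi> (mstar i s u)"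
proof (rule cadjoint_eqI[OF closed_csubspaceD(1)[OF range_closed]])
  note mu = initial_model(2)[OF l u]
  show "\<Psi> (mstar i s u) \<in> \<Psi> ` F L" using initial_FL[OF mu] by blast
  fix z assume "z \<in> \<Psi> ` F L"
  then obtain w where w: "w \<in> initial_space" "z = \<Psi> w" by (rule range_initial)
  note wL = initial_FL[OF w(1)] and Sw = initial_model(1)[OF l w(1)]
  have "cinner (S i s z) (\<Psi> u) = cinner (\<Psi> (S i s w)) (\<Psi> u)" using \<Psi>_model[OF l wL] w(2) by simp
  also have "\<dots> = cinner (S i s w) u"
    by (simp add: W_left[OF initial_FL[OF u]] W_\<Psi>[OF Sw])
  also have "\<dots> = cinner w (mstar i s u)" by (rule cinner_model[OF l]) (use fock_mono[OF wL] in simp)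
  also have "\<dots> = cinner z (\<Psi> (mstar i s u))"
    using W_left[OF initial_FL[OF mu], of z] W_\<Psi>[OF w(1)] w(2) by simp
  finally show "cinner (S i s z) (\<Psi> u) = cinner z (\<Psi> (mstar i s u))" .
qed

text \<open>The relation \<open>mstar_model_commute\<close> on the initial space, carried over by
  \<Psi>.\<close>

theorem beurling_doubly_commuting: "doubly_commuting k n lam (\<Psi> ` F L) S"
  unfolding doubly_commuting_def row_isometry_def
proof (intro conjI ballI allI impI)
  have mU: "m \<in> F UNIV" if "m \<in> \<Psi> ` F L" for m using fock_mono[OF range_FE[OF that]] by simp
  {
    fix i s assume l: "i \<in> {1..k}" "s \<in> {1..n i}"
    show "bounded_op (\<Psi> ` F L) (\<Psi> ` F L) (S i s)"
    proof (rule bounded_op_mono[OF bounded_op_model[OF _ closed_csubspaceD(1)[OF E]]])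
      show "\<Psi> ` F L \<subseteq> F E" using range_FE by blast
      fix m assume "m \<in> \<Psi> ` F L"
      then obtain a where "a \<in> F L" "m = \<Psi> a" by blast
      then show "S i s m \<in> \<Psi> ` F L"
        using \<Psi>_model[of i s a] model_fock[of i s L a] l closed_csubspaceD(1)[OF L] by (metis imageI)
    qed (use l in simp)
  }
  {
    fix i x assume "i \<in> {1..k}" "\<forall>s\<in>{1..n i}. x s \<in> \<Psi> ` F L"
    then show "norm2 (\<Sum>s=1..n i. S i s (x s)) = (\<Sum>s=1..n i. norm2 (x s))"
      by (intro norm_row_model) (use mU in auto)
  }
  fix i j s t x assume ij: "i \<in> {1..k}" "j \<in> {1..k}" "i \<noteq> j" and st: "s \<in> {1..n i}" "t \<in> {1..n j}"
    and "x \<in> \<Psi> ` F L"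
  then obtain u where u: "u \<in> initial_space" "x = \<Psi> u" by (elim range_initial)
  have li: "letter i s" and lj: "letter j t" using ij st by auto
  have uU: "u \<in> F UNIV" using fock_mono[OF initial_FL[OF u(1)]] by simp
  note mu = initial_model(2)[OF li u(1)]
  have "cadjoint (\<Psi> ` F L) (S i s) (S j t x) = \<Psi> (mstar i s (S j t u))"
    using cadjoint_range_model[OF li initial_model(1)[OF lj u(1)]]
    by (simp add: u(2) \<Psi>_model[OF lj initial_FL[OF u(1)]])
  also have "mstar i s (S j t u) = cnj (lam i j s t) *\<^sub>C S j t (mstar i s u)"
    by (rule mstar_model_commute[OF li lj ij(3) uU])
  also have "\<Psi> \<dots> = cnj (lam i j s t) *\<^sub>C S j t (\<Psi> (mstar i s u))"
    using bounded_opD(3)[OF bounded_\<Psi> initial_FL[OF initial_model(1)[OF lj mu]]] \<Psi>_model[OF lj initial_FL[OF mu]]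
    by simp
  also have "\<Psi> (mstar i s u) = cadjoint (\<Psi> ` F L) (S i s) x"
    using cadjoint_range_model[OF li u(1)] by (simp add: u(2))
  finally show "cadjoint (\<Psi> ` F L) (S i s) (S j t x)
      = cnj (lam i j s t) *\<^sub>C S j t (cadjoint (\<Psi> ` F L) (S i s) x)" .
qed

end

text \<open>For doubly commuting row isometries the defect form is \<open>\<parallel>(1 - Q\<^sub>j) \<cdots> (1 - Q\<^sub>1) x\<parallel>\<^sup>2\<close>
  with \<open>Q\<^sub>i = \<Sum>\<^sub>s V\<^sub>i\<^sub>,\<^sub>s V\<^sub>i\<^sub>,\<^sub>s\<^sup>*\<close>.\<close>

context
  fixes M :: "'a::chilbert_space set" and V :: "nat \<Rightarrow> nat \<Rightarrow> 'a \<Rightarrow> 'a"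
  assumes M: "closed_csubspace M" and V: "doubly_commuting k n lam M V"
    and V_commute: "\<lbrakk>letter i s; letter j t; i \<noteq> j; x \<in> M\<rbrakk> \<Longrightarrow> V i s (V j t x) = lam i j s t *\<^sub>C V j t (V i s x)"
begin

abbreviation "C i s \<equiv> cadjoint M (V i s)"

primrec wold :: "nat \<Rightarrow> 'a \<Rightarrow> 'a" where
  "wold 0 x = x"
| "wold (Suc j) x = wold j x - (\<Sum>s=1..n (Suc j). V (Suc j) s (C (Suc j) s (wold j x)))"

lemma bounded_V: "letter i s \<Longrightarrow> bounded_op M M (V i s)"
  using V by (simp add: doubly_commuting_def row_isometry_def)

lemma C_in: "letter i s \<Longrightarrow> C i s x \<in> M"
  by (rule cadjoint_in[OF bounded_V M])

lemma bounded_C: "letter i s \<Longrightarrow> bounded_op M M (C i s)"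
  by (rule bounded_op_mono[OF bounded_op_cadjoint[OF bounded_V M]]) (auto simp: C_in)

lemma V_in: "letter i s \<Longrightarrow> x \<in> M \<Longrightarrow> V i s x \<in> M"
  by (rule bounded_opD(1)[OF bounded_V])

lemma C_V: "letter i s \<Longrightarrow> letter j t \<Longrightarrow> i \<noteq> j \<Longrightarrow> x \<in> M \<Longrightarrow> C i s (V j t x) = cnj (lam i j s t) *\<^sub>C V j t (C i s x)"
  using V unfolding doubly_commuting_def by blast

lemma C_C:
  assumes l: "letter i s" "letter j t" "i \<noteq> j"
  shows "C i s (C j t x) = lam i j s t *\<^sub>C C j t (C i s x)"
proof (rule csubspace_eqI[OF closed_csubspaceD(1)[OF M]])
  show "C i s (C j t x) \<in> M" "lam i j s t *\<^sub>C C j t (C i s x) \<in> M"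
    by (intro csubspaceD[OF closed_csubspaceD(1)[OF M]] C_in l)+
  fix z assume z: "z \<in> M"
  note a = cadjoint_right[OF bounded_V M, symmetric]
  have "V j t (V i s z) = cnj (lam i j s t) *\<^sub>C V i s (V j t z)"
    using V_commute[OF l(2,1) _ z] lam_swap[of i j s t] l by simp
  then show "cinner z (C i s (C j t x)) = cinner z (lam i j s t *\<^sub>C C j t (C i s x))"
    using l z by (simp add: a V_in cinner_simps)
qed

lemma wold_in: "j \<le> k \<Longrightarrow> x \<in> M \<Longrightarrow> wold j x \<in> M"
proof (induction j)
  case (Suc j)
  have "V (Suc j) s (C (Suc j) s (wold j x)) \<in> M" if "s \<in> {1..n (Suc j)}" for s
    by (intro V_in C_in) (use that Suc.prems in simp_all)
  then have "(\<Sum>s=1..n (Suc j). V (Suc j) s (C (Suc j) s (wold j x))) \<in> M"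
    by (rule csubspace_sum[OF closed_csubspaceD(1)[OF M]])
  then show ?case unfolding wold.simps
    by (intro csubspaceD(5)[OF closed_csubspaceD(1)[OF M]] Suc.IH) (use Suc.prems in simp_all)
qed simp

text \<open>Passing \<open>C i s\<close> through \<open>V l t\<close> gives the conjugate phase and
  passing it through \<open>C l t\<close> the phase itself. They cancel, so \<open>C i s\<close>
  commutes with each factor 1 - Q_l for l < i.\<close>

lemma C_wold:
  assumes l: "letter i s"
  shows "j < i \<Longrightarrow> x \<in> M \<Longrightarrow> C i s (wold j x) = wold j (C i s x)"
proof (induction j)
  case (Suc j)
  note sub = closed_csubspaceD(1)[OF M]
  let ?y = "wold j x"
  have jk: "Suc j \<in> {1..k}" "i \<noteq> Suc j" using l Suc.prems by auto
  have y: "?y \<in> M" by (rule wold_in) (use l Suc.prems in auto)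
  have VC: "V (Suc j) t (C (Suc j) t ?y) \<in> M" if "t \<in> {1..n (Suc j)}" for t
    by (intro V_in C_in) (use that jk in simp_all)
  have step: "C i s (V (Suc j) t (C (Suc j) t ?y)) = V (Suc j) t (C (Suc j) t (C i s ?y))"
    if t: "t \<in> {1..n (Suc j)}" for t
  proof -
    have lt: "letter (Suc j) t" using t jk by simp
    have "C i s (V (Suc j) t (C (Suc j) t ?y)) = cnj (lam i (Suc j) s t) *\<^sub>C V (Suc j) t (C i s (C (Suc j) t ?y))"
      by (rule C_V[OF l lt jk(2) C_in[OF lt]])
    also have "C i s (C (Suc j) t ?y) = lam i (Suc j) s t *\<^sub>C C (Suc j) t (C i s ?y)"
      by (rule C_C[OF l lt jk(2)])
    finally show ?thesis
      using lam_cnj[of i "Suc j" s t] l lt jk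
      by (simp add: bounded_opD(3)[OF bounded_V[OF lt] C_in[OF lt]] scaleC_scaleC mult.commute)
  qed
  let ?Q = "\<Sum>t=1..n (Suc j). V (Suc j) t (C (Suc j) t ?y)"
  have "C i s (wold (Suc j) x) = C i s ?y - C i s ?Q"
    unfolding wold.simps by (rule bounded_op_diff[OF bounded_C[OF l] sub y csubspace_sum[OF sub VC]])
  also have "C i s ?Q = (\<Sum>t=1..n (Suc j). C i s (V (Suc j) t (C (Suc j) t ?y)))"
    by (rule bounded_op_sum[OF bounded_C[OF l] sub VC])
  finally show ?case using step Suc by simp
qed simp

text \<open>By the row isometry the squared norm of \<open>?Q\<close> equals
  \<open>cinner ?Q y\<close>, as for a projection, so subtracting \<open>?Q\<close> follows
  Pythagoras.\<close>

lemma norm_row_defect: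
  assumes i: "i \<in> {1..k}" and y: "y \<in> M"
  shows "norm2 (y - (\<Sum>s=1..n i. V i s (C i s y))) = norm2 y - (\<Sum>s=1..n i. norm2 (C i s y))"
proof -
  let ?Q = "\<Sum>s=1..n i. V i s (C i s y)"
  have "row_isometry M (n i) (V i)" using V i unfolding doubly_commuting_def by blast
  moreover have "\<forall>s\<in>{1..n i}. C i s y \<in> M" using C_in i by simp
  ultimately have QQ: "norm2 ?Q = (\<Sum>s=1..n i. norm2 (C i s y))"
    unfolding row_isometry_def by (elim conjE) (erule allE[of _ "\<lambda>s. C i s y"], simp)
  have Qy: "cinner ?Q y = of_real (\<Sum>s=1..n i. norm2 (C i s y))"
    using i by (simp add: cinner_sum_left cadjoint_right[OF bounded_V M C_in] cinner_self)
  have "cinner (y - ?Q) (y - ?Q) = cinner y y - cnj (cinner ?Q y) - cinner ?Q y + cinner ?Q ?Q"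
    by (simp only: cinner_diff_left cinner_diff_right cinner_commute[of y ?Q]) simp
  then have "complex_of_real (norm2 (y - ?Q)) = of_real (norm2 y - (\<Sum>s=1..n i. norm2 (C i s y)))"
    unfolding Qy by (simp only: cinner_self QQ complex_cnj_complex_of_real) simp
  then show ?thesis by (simp only: of_real_eq_iff)
qed

lemma defect_form_wold: "j \<le> k \<Longrightarrow> x \<in> M \<Longrightarrow> defect_form C (Suc 0) j norm2 x = norm2 (wold j x)"
proof (induction j arbitrary: x)
  case (Suc j)
  have "defect_form C (Suc 0) (Suc j) norm2 x = norm2 (wold j x) - (\<Sum>s=1..n (Suc j). norm2 (wold j (C (Suc j) s x)))"
    using Suc C_in by (simp add: dphi_1 phi_def)
  also have "\<dots> = norm2 (wold j x) - (\<Sum>s=1..n (Suc j). norm2 (C (Suc j) s (wold j x)))"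
    using Suc.prems by (simp add: C_wold)
  also have "\<dots> = norm2 (wold (Suc j) x)"
    using norm_row_defect[of "Suc j" "wold j x"] wold_in[of j x] Suc.prems by simp
  finally show ?case .
qed simp

end

text \<open>Converse of \<open>inner_factorization\<close>: if \<Psi> composed with its adjoint is a
  projection, then \<Psi> is a partial isometry with the same range.\<close>

lemma inner_multi_analyticI:
  fixes E :: "'e::chilbert_space set" and K :: "'f::chilbert_space set"
  assumes \<Psi>: "multi_analytic k n lam E K \<Psi>" and E: "closed_csubspace E" and M: "closed_csubspace M"
    and fac: "\<And>f. f \<in> F K \<Longrightarrow> \<Psi> (cadjoint (F E) \<Psi> f) = proj M f"
    and sub: "M \<subseteq> F K"
  shows "inner_multi_analytic k n lam E K \<Psi>" "M = \<Psi> ` F E"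
proof -
  note FE = closed_csubspace_fock[OF E, of k n] and b = multi_analyticD(1)[OF \<Psi>]
  let ?W = "cadjoint (F E) \<Psi>"
  have W_in: "?W f \<in> F E" for f by (rule cadjoint_in[OF b FE])
  have range: "\<Psi> z \<in> M" if z: "z \<in> F E" for z
  proof -
    have fac_z: "proj M (\<Psi> z) = \<Psi> (?W (\<Psi> z))" using fac[OF bounded_opD(1)[OF b z]] by simp
    \<comment> \<open>\<open>\<Psi> y\<close> is the part of \<open>\<Psi> z\<close> orthogonal to
      \<open>M\<close>. The factorization makes the adjoint vanish on it, and then
      \<open>\<Psi> y\<close> is orthogonal to itself.\<close>
    define y where "y = z - ?W (\<Psi> z)"
    have y: "y \<in> F E" unfolding y_def by (intro csubspaceD(5)[OF closed_csubspaceD(1)[OF FE]] z W_in)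
    have \<Psi>y: "\<Psi> y = \<Psi> z - proj M (\<Psi> z)"
      unfolding y_def fac_z by (rule bounded_op_diff[OF b closed_csubspaceD(1)[OF FE] z W_in])
    have "cinner (?W (\<Psi> y)) (?W (\<Psi> y)) = cinner (proj M (\<Psi> y)) (\<Psi> y)"
      using cadjoint_right[OF b FE W_in, of "\<Psi> y" "\<Psi> y"] fac[OF bounded_opD(1)[OF b y]] by simp
    also have "\<dots> = 0" unfolding \<Psi>y by (rule proj_orth2[OF M proj_in[OF M]])
    finally have "?W (\<Psi> y) = 0" by (simp add: cinner_self_eq_0)
    then have "cinner (\<Psi> y) (\<Psi> y) = 0" using cadjoint_right[OF b FE y, of "\<Psi> y"] by simp
    then have "\<Psi> z = proj M (\<Psi> z)" using \<Psi>y by (simp add: cinner_self_eq_0)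
    then show ?thesis using proj_in[OF M] by metis
  qed
  show "M = \<Psi> ` F E"
  proof
    show "M \<subseteq> \<Psi> ` F E"
    proof
      fix m assume "m \<in> M"
      then have "m = \<Psi> (?W m)" using fac[of m] sub by (simp add: proj_ident[OF M] subset_iff)
      then show "m \<in> \<Psi> ` F E" using W_in by blast
    qed
  qed (use range in blast)
  have "norm (\<Psi> x) = norm x" if x: "x \<in> orthocomp_in (F E) {z \<in> F E. \<Psi> z = 0}" for x
  proof -
    have xE: "x \<in> F E" using x by (simp add: orthocomp_in_def)
    \<comment> \<open>This vector lies in the kernel, while both of its terms are orthogonal to the
      kernel, so it is 0.\<close>
    define y where "y = x - ?W (\<Psi> x)"
    have y: "y \<in> F E" unfolding y_def by (intro csubspaceD(5)[OF closed_csubspaceD(1)[OF FE]] xE W_in)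
    have "\<Psi> y = \<Psi> x - \<Psi> (?W (\<Psi> x))"
      unfolding y_def by (rule bounded_op_diff[OF b closed_csubspaceD(1)[OF FE] xE W_in])
    also have "\<dots> = 0" using fac[OF bounded_opD(1)[OF b xE]] proj_ident[OF M range[OF xE]] by simp
    finally have \<Psi>y: "\<Psi> y = 0" .
    have "cinner x y = 0" using x y \<Psi>y by (simp add: orthocomp_in_def)
    moreover have "cinner (?W (\<Psi> x)) y = 0"
      using cadjoint_left[OF b FE y, of "\<Psi> x"] \<Psi>y by simp
    ultimately have "cinner y y = 0" unfolding y_def by (simp add: cinner_diff_left)
    then have "?W (\<Psi> x) = x" unfolding cinner_self_eq_0 by (simp add: y_def)
    then have "cinner (\<Psi> x) (\<Psi> x) = cinner x x" using cadjoint_right[OF b FE xE, of "\<Psi> x"] by simp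
    then have "complex_of_real (norm2 (\<Psi> x)) = of_real (norm2 x)" by (simp only: cinner_self)
    then show ?thesis by (simp only: of_real_eq_iff) (simp add: power2_eq_iff_nonneg)
  qed
  then show "inner_multi_analytic k n lam E K \<Psi>"
    using \<Psi> by (simp add: inner_multi_analytic_def partial_isometry_def)
qed

lemma cinner_amp:
  assumes J: "bounded_op E E' J" "csubspace E" and J': "bounded_op E' E J'" "csubspace E'"
    and adj: "\<And>x y. x \<in> E \<Longrightarrow> y \<in> E' \<Longrightarrow> cinner (J x) y = cinner x (J' y)"
    and f: "f \<in> F E" and h: "h \<in> F E'"
  shows "cinner (amp J f) h = cinner f (amp J' h)"
  unfolding cinner_ell2_def
  by (rule infsum_cong)
    (simp add: coord_amp[OF J f] coord_amp[OF J' h] adj fockD[OF f] fockD[OF h])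

lemma amp_amp:
  assumes J: "bounded_op E E' J" "csubspace E" and J': "bounded_op E' E J'" "csubspace E'"
    and inv: "\<And>x. x \<in> E \<Longrightarrow> J' (J x) = x" and f: "f \<in> F E"
  shows "amp J' (amp J f) = f"
  by (rule ell2_eqI)
    (simp add: coord_amp[OF J' bounded_opD(1)[OF bounded_op_amp[OF J] f]] coord_amp[OF J f] inv fockD[OF f])

lemma cinner_multi_model:
  fixes f y :: "(multiword, 'e::complex_inner) ell2"
  assumes \<alpha>: "\<alpha> \<in> mw" and E: "csubspace E"
  shows "f \<in> F E \<Longrightarrow> multi_model k lam \<alpha> f \<in> F E \<and> cinner (multi_model k lam \<alpha> f) y = cinner f (act mstar k \<alpha> y)"
proof -
  have word: "word_op (S i) w f \<in> F E \<and> cinner (word_op (S i) w f) y = cinner f (fold (mstar i) w y)"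
    if i: "i \<in> {1..k}" and "f \<in> F E" and w: "set w \<subseteq> {1..n i}" for i w y and f :: "(multiword, 'e) ell2"
    using w
  proof (induction w arbitrary: y)
    case (Cons s w)
    then have l: "letter i s" and IH: "word_op (S i) w f \<in> F E"
      "\<And>y. cinner (word_op (S i) w f) y = cinner f (fold (mstar i) w y)" using i by auto
    then show ?case using model_fock[OF l E IH(1)] cinner_model[OF l fock_mono[OF IH(1) subset_UNIV]]
      by (simp add: word_op_def)
  qed (simp add: word_op_def \<open>f \<in> F E\<close>)
  have "foldr (\<lambda>i. word_op (S i) (\<alpha> i)) [1..<Suc j] f \<in> F E \<and>
      cinner (foldr (\<lambda>i. word_op (S i) (\<alpha> i)) [1..<Suc j] f) y = cinner f (act mstar j \<alpha> y)"
    if "j \<le> k" "f \<in> F E" for j and f :: "(multiword, 'e) ell2"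
    using that
  proof (induction j arbitrary: f)
    case (Suc j)
    have w: "set (\<alpha> (Suc j)) \<subseteq> {1..n (Suc j)}" "Suc j \<in> {1..k}"
      using \<alpha> Suc.prems by (auto simp: multiwords_def)
    show ?case using Suc.IH[of "word_op (S (Suc j)) (\<alpha> (Suc j)) f"] word[OF w(2) Suc.prems(2) w(1)] Suc.prems
      by (simp add: act_Suc)
  qed simp
  then show "f \<in> F E \<Longrightarrow> ?thesis" by (simp add: multi_model_def)
qed

text \<open>Additivity across two invariant sets survives each factor of the defect. Started from
  Pythagoras for orthogonal sets, it yields a statement about vacuum coefficients.\<close>

lemma defect_form_orthogonal:
  assumes Y: "\<And>i s u. letter i s \<Longrightarrow> u \<in> Y \<Longrightarrow> A i s u \<in> Y" and Z: "\<And>i s u. letter i s \<Longrightarrow> u \<in> Z \<Longrightarrow> A i s u \<in> Z"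
    and add: "\<And>i s u v. letter i s \<Longrightarrow> A i s (u + v) = A i s u + A i s v"
    and q: "\<And>u v. u \<in> Y \<Longrightarrow> v \<in> Z \<Longrightarrow> q (u + v) = q u + q v"
  shows "j \<le> k \<Longrightarrow> u \<in> Y \<Longrightarrow> v \<in> Z \<Longrightarrow>
    defect_form A (Suc 0) j q (u + v) = defect_form A (Suc 0) j q u + defect_form A (Suc 0) j q v"
proof (induction j arbitrary: u v)
  case (Suc j)
  then have "phi A (Suc j) (defect_form A (Suc 0) j q) (u + v)
      = phi A (Suc j) (defect_form A (Suc 0) j q) u + phi A (Suc j) (defect_form A (Suc 0) j q) v"
    by (simp add: phi_def add Y Z sum.distrib)
  with Suc show ?case by (simp add: dphi_1)
qed (simp add: q)

end

section \<open>Isometries\<close>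

context
  fixes M :: "'a::chilbert_space set" and N :: "'b::chilbert_space set" and J :: "'a \<Rightarrow> 'b"
  assumes M: "closed_csubspace M" and J: "bounded_op M N J" and iso: "\<And>x. x \<in> M \<Longrightarrow> norm (J x) = norm x"
begin

lemma isometry_adjoint:
  assumes "x \<in> M" shows "cadjoint M J (J x) = x"
proof -
  have "bounded_op M M (\<lambda>x. cadjoint M J (J x))"
    by (rule bounded_op_mono[OF bounded_op_comp[OF J bounded_op_mono[OF bounded_op_cadjoint[OF J M]]]])
      (auto simp: cadjoint_in[OF J M])
  then have Z: "bounded_op M M (\<lambda>x. cadjoint M J (J x) - x)"
    by (rule bounded_op_diff_op[OF _ bounded_op_id closed_csubspaceD(1)[OF M]])
  have "cadjoint M J (J x) - x = 0"
  proof (rule bounded_op_eq_zero[OF Z closed_csubspaceD(1)[OF M] _ assms])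
    fix z assume z: "z \<in> M"
    have "cinner (cadjoint M J (J z)) z = cinner (J z) (J z)" by (rule cadjoint_left[OF J M z, symmetric])
    then show "cinner (cadjoint M J (J z) - z) z = 0" by (simp add: cinner_diff_left cinner_self iso[OF z])
  qed
  then show ?thesis by simp
qed

lemma closed_csubspace_isometry_image: "closed_csubspace (J ` M)"
  unfolding closed_csubspace_def
proof
  show "csubspace (J ` M)" by (rule csubspace_image[OF J closed_csubspaceD(1)[OF M]])
  show "closed (J ` M)" unfolding closed_sequential_limits
  proof (intro allI impI, elim conjE)
    fix f l assume f: "\<forall>m. f m \<in> J ` M" "f \<longlonglongrightarrow> l"
    have "(\<lambda>m. J (cadjoint M J (f m))) \<longlonglongrightarrow> J (cadjoint M J l)"
      by (rule bounded_op_tendsto[OF bounded_op_comp[OF bounded_op_cadjoint[OF J M] J] _ _ f(2)]) auto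
    moreover have "J (cadjoint M J (f m)) = f m" for m
    proof -
      obtain x where "x \<in> M" "f m = J x" using f(1) by blast
      then show ?thesis by (simp add: isometry_adjoint)
    qed
    ultimately have "J (cadjoint M J l) = l" using f(2) LIMSEQ_unique by simp
    then show "l \<in> J ` M" using cadjoint_in[OF J M, of l] by (metis imageI)
  qed
qed

end

text \<open>Equality of norms makes \<open>R h \<mapsto> B h\<close> well defined and isometric on
  the range of \<open>R\<close>, and it sends Cauchy sequences to Cauchy sequences, hence extends to
  the closure.\<close>

lemma isometric_extension:
  fixes R :: "'a::chilbert_space \<Rightarrow> 'b::chilbert_space" and B :: "'a \<Rightarrow> 'c::chilbert_space"
  assumes R: "bounded_op UNIV UNIV R" and B: "bounded_op UNIV N B" and N: "closed_csubspace N"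
    and nBR: "\<And>h. norm (B h) = norm (R h)"
  obtains J where "bounded_op (closure (range R)) N J" "\<And>x. x \<in> closure (range R) \<Longrightarrow> norm (J x) = norm x"
    "\<And>h. J (R h) = B h"
proof -
  \<comment> \<open>The closure of the graph of \<open>R h \<mapsto> B h\<close>, described by
    sequences of preimages.\<close>
  define rel where "rel x y \<longleftrightarrow> (\<exists>h::nat \<Rightarrow> 'a. (\<lambda>m. R (h m)) \<longlonglongrightarrow> x \<and> (\<lambda>m. B (h m)) \<longlonglongrightarrow> y)" for x y
  have relI: "rel x y" if "(\<lambda>m. R (h m)) \<longlonglongrightarrow> x" "(\<lambda>m. B (h m)) \<longlonglongrightarrow> y" for h x y
    unfolding rel_def using that by (intro exI[of _ h] conjI)
  note Bd = bounded_op_diff[OF B csubspace_UNIV UNIV_I UNIV_I, symmetric]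
    and Rd = bounded_op_diff[OF R csubspace_UNIV UNIV_I UNIV_I, symmetric]
  have ex: "\<exists>y. rel x y" if x: "x \<in> closure (range R)" for x
  proof -
    obtain f where f: "\<forall>m::nat. f m \<in> range R" "f \<longlonglongrightarrow> x" using x unfolding closure_sequential by blast
    then have "\<forall>m. \<exists>h. f m = R h" by blast
    then obtain h where h: "\<And>m. f m = R (h m)" by metis
    then have lim: "(\<lambda>m. R (h m)) \<longlonglongrightarrow> x" using f(2) by (simp add: fun_eq_iff[THEN iffD2, of f "\<lambda>m. R (h m)"])
    have "Cauchy (\<lambda>m. B (h m))"
    proof (rule CauchyI)
      fix e :: real assume "0 < e"
      then obtain M where "\<forall>m\<ge>M. \<forall>l\<ge>M. norm (R (h m) - R (h l)) < e"
        using CauchyD[OF LIMSEQ_imp_Cauchy[OF lim]] by blast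
      then show "\<exists>M. \<forall>m\<ge>M. \<forall>l\<ge>M. norm (B (h m) - B (h l)) < e" unfolding Bd nBR Rd by blast
    qed
    then obtain y where "(\<lambda>m. B (h m)) \<longlonglongrightarrow> y" using Cauchy_convergent convergent_def by blast
    with lim show ?thesis unfolding rel_def by blast
  qed
  have uniq: "y = y'" if xy: "rel x y" "rel x y'" for x y y'
  proof -
    obtain h where h: "(\<lambda>m. R (h m)) \<longlonglongrightarrow> x" "(\<lambda>m. B (h m)) \<longlonglongrightarrow> y" using xy(1) unfolding rel_def by blast
    obtain h' where h': "(\<lambda>m. R (h' m)) \<longlonglongrightarrow> x" "(\<lambda>m. B (h' m)) \<longlonglongrightarrow> y'" using xy(2) unfolding rel_def by blast
    have "(\<lambda>m. norm (R (h m) - R (h' m))) \<longlonglongrightarrow> norm (x - x)" by (intro tendsto_intros h h')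
    moreover have "(\<lambda>m. norm (B (h m) - B (h' m))) \<longlonglongrightarrow> norm (y - y')" by (intro tendsto_intros h h')
    ultimately have "norm (y - y') = norm (x - x)" unfolding Bd nBR Rd using LIMSEQ_unique by blast
    then show ?thesis by simp
  qed
  define J where "J x = (SOME y. rel x y)" for x
  have J: "rel x (J x)" if "x \<in> closure (range R)" for x
    unfolding J_def using ex[OF that] by (rule someI_ex)
  have Jeq: "J x = y" if "rel x y" for x y
    using uniq[OF someI[of "rel x", OF that] that] by (simp add: J_def)
  have nJ: "norm (J x) = norm x" if x: "x \<in> closure (range R)" for x
  proof -
    obtain h where h: "(\<lambda>m. R (h m)) \<longlonglongrightarrow> x" "(\<lambda>m. B (h m)) \<longlonglongrightarrow> J x"
      using J[OF x] unfolding rel_def by blast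
    show ?thesis using tendsto_norm[OF h(1)] tendsto_norm[OF h(2)] unfolding nBR by (rule LIMSEQ_unique[symmetric])
  qed
  have "bounded_op (closure (range R)) N J"
  proof (rule bounded_opI[of _ _ _ 1])
    fix x assume x: "x \<in> closure (range R)"
    obtain h where h: "(\<lambda>m. R (h m)) \<longlonglongrightarrow> x" "(\<lambda>m. B (h m)) \<longlonglongrightarrow> J x"
      using J[OF x] unfolding rel_def by blast
    show "J x \<in> N"
      by (rule closed_sequentially[OF closed_csubspaceD(2)[OF N] bounded_opD(1)[OF B UNIV_I] h(2)])
    show "norm (J x) \<le> 1 * norm x" using nJ[OF x] by simp
    show "J (c *\<^sub>C x) = c *\<^sub>C J x" for c
    proof (rule Jeq)
      have "(\<lambda>m. R (c *\<^sub>C h m)) \<longlonglongrightarrow> c *\<^sub>C x" "(\<lambda>m. B (c *\<^sub>C h m)) \<longlonglongrightarrow> c *\<^sub>C J x"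
        unfolding bounded_opD(3)[OF R UNIV_I] bounded_opD(3)[OF B UNIV_I]
        using continuous_on_tendsto_compose[OF continuous_scaleC h(1)]
          continuous_on_tendsto_compose[OF continuous_scaleC h(2)] by auto
      then show "rel (c *\<^sub>C x) (c *\<^sub>C J x)" by (rule relI)
    qed
    fix y assume y: "y \<in> closure (range R)"
    obtain h' where h': "(\<lambda>m. R (h' m)) \<longlonglongrightarrow> y" "(\<lambda>m. B (h' m)) \<longlonglongrightarrow> J y"
      using J[OF y] unfolding rel_def by blast
    show "J (x + y) = J x + J y"
    proof (rule Jeq)
      have "(\<lambda>m. R (h m + h' m)) \<longlonglongrightarrow> x + y" "(\<lambda>m. B (h m + h' m)) \<longlonglongrightarrow> J x + J y"
        unfolding bounded_opD(2)[OF R UNIV_I UNIV_I] bounded_opD(2)[OF B UNIV_I UNIV_I]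
        by (intro tendsto_intros h h')+
      then show "rel (x + y) (J x + J y)" by (rule relI)
    qed
  qed
  moreover have "J (R h) = B h" for h
    by (rule Jeq, rule relI[of "\<lambda>_. h"]) simp_all
  ultimately show ?thesis using that nJ by blast
qed

section \<open>Pure tuples\<close>

context polyball_tuple
begin

theorem characteristic_function_iff:
  fixes J :: "(multiword, 'h) ell2 \<Rightarrow> 'u::chilbert_space"
  assumes J: "bounded_op UNIV UNIV J" "\<And>x. norm (J x) = norm x"
  shows "admits_characteristic_function TYPE('u) k n lam T \<longleftrightarrow> (\<forall>f\<in>F D. 0 \<le> \<gamma> f)"
proof
  assume "admits_characteristic_function TYPE('u) k n lam T"
  then obtain E :: "'u set" and \<Psi> where E: "closed_csubspace E" "multi_analytic k n lam E D \<Psi>"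
    and fac: "\<forall>f\<in>F D. K (Kst f) + \<Psi> (cadjoint (F E) \<Psi> f) = f"
    unfolding admits_characteristic_function_def by blast
  show "\<forall>f\<in>F D. 0 \<le> \<gamma> f"
    using defect_positive_of_factorization[OF E] fac by blast
next
  assume pos: "\<forall>f\<in>F D. 0 \<le> \<gamma> f"
  obtain \<Psi> :: "(multiword, 'u) ell2 \<Rightarrow> (multiword, 'h) ell2" where "multi_analytic k n lam UNIV D \<Psi>"
    "\<And>f. f \<in> F D \<Longrightarrow> K (Kst f) + \<Psi> (cadjoint (F UNIV) \<Psi> f) = f"
    using factorization_of_defect_positive[OF _ J] pos by blast
  then show "admits_characteristic_function TYPE('u) k n lam T"
    unfolding admits_characteristic_function_def using closed_csubspace_UNIV by blast
qed

context
  assumes pure: "pure_tuple k n T"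
begin

lemmas norm_K = norm_K_pure[OF pure]

lemma Kst_K: "Kst (K h) = h"
  by (rule isometry_adjoint[OF closed_csubspace_UNIV bounded_op_K]) (auto simp: norm_K)

lemma range_K_closed: "closed_csubspace (range K)"
  by (rule closed_csubspace_isometry_image[OF closed_csubspace_UNIV bounded_op_K]) (simp add: norm_K)

lemma range_K_FD: "K h \<in> F D"
  by (rule bounded_opD(1)[OF bounded_op_K]) simp

abbreviation "M0 \<equiv> orthocomp_in (F D) (range K)"

lemma M0_closed: "closed_csubspace M0"
  by (rule closed_csubspace_orthocomp_in[OF FD_closed])

lemma M0_FD: "m \<in> M0 \<Longrightarrow> m \<in> F D" and M0_K: "m \<in> M0 \<Longrightarrow> cinner m (K h) = 0"
  by (auto simp: orthocomp_in_def)

text \<open>The adjoint of the isometry \<open>K\<close> is a left inverse, so \<open>K\<close>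
  after its adjoint projects onto the range of \<open>K\<close>, and \<open>X\<close> is the
  complementary projection in \<open>F D\<close>.\<close>

lemma X_proj:
  assumes f: "f \<in> F D" shows "X f = proj M0 f"
proof (rule proj_eqI[OF M0_closed, symmetric])
  have "cinner (X f) (K h) = 0" for h
    using cinner_K[of "Kst f" "K h"] cinner_K[of h f] cinner_commute[of f "K h"] cinner_commute[of h "Kst f"]
    by (simp add: cinner_diff_left Kst_K)
  then show "X f \<in> M0" using bounded_opD(1)[OF bounded_op_X f] by (auto simp: orthocomp_in_def)
  show "cinner m (X f) = cinner m f" if "m \<in> M0" for m
    by (simp add: cinner_diff_right M0_K[OF that])
qed

lemma M0_model:
  assumes l: "letter i s" and m: "m \<in> M0" shows "S i s m \<in> M0"
proof -
  have "cinner (S i s m) (K h) = 0" for h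
    using cinner_model[OF l fock_mono[OF M0_FD[OF m] subset_UNIV]] M0_K[OF m] by (simp add: K_Tst[OF l, symmetric])
  then show ?thesis using model_fock[OF l closed_csubspaceD(1)[OF D_closed] M0_FD[OF m]]
    by (auto simp: orthocomp_in_def)
qed

text \<open>Both sides say that some multi-analytic \<Psi> composed with its adjoint is the
  projection onto \<open>M0\<close>.\<close>

theorem characteristic_function_iff_beurling:
  "admits_characteristic_function TYPE('u::chilbert_space) k n lam T \<longleftrightarrow> beurling_type TYPE('u) k n lam D M0"
proof
  assume "admits_characteristic_function TYPE('u) k n lam T"
  then obtain E :: "'u set" and \<Psi> where E: "closed_csubspace E" and \<Psi>: "multi_analytic k n lam E D \<Psi>"
    and fac: "\<forall>f\<in>F D. K (Kst f) + \<Psi> (cadjoint (F E) \<Psi> f) = f"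
    unfolding admits_characteristic_function_def by blast
  have "\<Psi> (cadjoint (F E) \<Psi> f) = proj M0 f" if "f \<in> F D" for f
    using fac that by (simp add: X_proj[OF that, symmetric] algebra_simps)
  then have "inner_multi_analytic k n lam E D \<Psi>" "M0 = \<Psi> ` F E"
    using inner_multi_analyticI[OF \<Psi> E M0_closed] M0_FD by blast+
  then show "beurling_type TYPE('u) k n lam D M0" unfolding beurling_type_def using E by blast
next
  assume "beurling_type TYPE('u) k n lam D M0"
  then obtain L :: "'u set" and \<Psi> where L: "closed_csubspace L" and \<Psi>: "inner_multi_analytic k n lam L D \<Psi>"
    and M0: "M0 = \<Psi> ` F L" unfolding beurling_type_def by blast
  have "K (Kst f) + \<Psi> (cadjoint (F L) \<Psi> f) = f" if "f \<in> F D" for f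
    unfolding inner_factorization[OF L D_closed \<Psi>] M0[symmetric] X_proj[OF that, symmetric] by simp
  then show "admits_characteristic_function TYPE('u) k n lam T"
    unfolding admits_characteristic_function_def using L \<Psi> inner_multi_analytic_def by blast
qed

lemma beurling_imp_doubly_commuting:
  assumes "beurling_type TYPE('u::chilbert_space) k n lam D M0"
  shows "doubly_commuting k n lam M0 S"
proof -
  obtain L :: "'u set" and \<Psi> where "closed_csubspace L" "inner_multi_analytic k n lam L D \<Psi>" "M0 = \<Psi> ` F L"
    using assms unfolding beurling_type_def by blast
  then show ?thesis using beurling_doubly_commuting[OF _ D_closed] by metis
qed

text \<open>\<open>M0\<close> is invariant under the shifts, so the adjoint of a restricted shift
  sends \<open>proj M0 f\<close> to the projection of \<open>mstar i s f\<close>. Thus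
  \<open>\<gamma> f\<close> is the defect form of the restricted tuple at \<open>proj M0 f\<close>,
  a squared norm by \<open>defect_form_wold\<close>.\<close>

lemma doubly_commuting_imp_defect_positive:
  assumes dc: "doubly_commuting k n lam M0 S" and f: "f \<in> F D"
  shows "0 \<le> \<gamma> f"
proof -
  let ?P = "proj M0" and ?C = "\<lambda>i s. cadjoint M0 (S i s)"
  have b: "bounded_op M0 M0 (S i s)" if "letter i s" for i s
    using dc that by (simp add: doubly_commuting_def row_isometry_def)
  have g: "g f = norm2 (?P f)" if "f \<in> F D" for f
  proof -
    have "complex_of_real (g f) = cinner (?P f) f" using cinner_X[of f] X_proj[OF that] by simp
    also have "\<dots> = of_real (norm2 (?P f))"
      using proj_cinner2[OF M0_closed proj_in[OF M0_closed], of f f] by (simp only: cinner_self)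
    finally show ?thesis by (simp only: of_real_eq_iff)
  qed
  have int: "?C i s (?P f) = ?P (mstar i s f)" if l: "letter i s" for i s f
  proof (rule csubspace_eqI[OF closed_csubspaceD(1)[OF M0_closed] cadjoint_in[OF b[OF l] M0_closed] proj_in[OF M0_closed]])
    fix z assume z: "z \<in> M0"
    have "cinner z (?C i s (?P f)) = cinner (S i s z) (?P f)" by (rule cadjoint_right[OF b[OF l] M0_closed z, symmetric])
    also have "\<dots> = cinner (S i s z) f" by (rule proj_cinner2[OF M0_closed M0_model[OF l z]])
    also have "\<dots> = cinner z (mstar i s f)" by (rule cinner_model[OF l fock_mono[OF M0_FD[OF z] subset_UNIV]])
    also have "\<dots> = cinner z (?P (mstar i s f))" by (rule proj_cinner2[OF M0_closed z, symmetric])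
    finally show "cinner z (?C i s (?P f)) = cinner z (?P (mstar i s f))" .
  qed
  have mF: "mstar i s f \<in> F D" if "letter i s" "f \<in> F D" for i s f
    by (rule mstar_fock[OF that(1) closed_csubspaceD(1)[OF D_closed] that(2)])
  have "\<gamma> f = defect_form ?C (Suc 0) k norm2 (?P f)"
    by (rule defect_form_intertwine[where M = "F D"]) (use int mF g f in simp_all)
  also have "\<dots> = norm2 (wold M0 S k (?P f))"
    by (rule defect_form_wold[OF M0_closed dc _ order_refl proj_in[OF M0_closed]])
      (rule model_commute; use M0_FD fock_mono in blast)
  finally show ?thesis by simp
qed

lemma span_K:
  assumes y: "y \<in> F D" and orth: "\<And>\<beta> h. \<beta> \<in> mw \<Longrightarrow> cinner (act mstar k \<beta> y) (K h) = 0"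
  shows "y = 0"
proof -
  interpret m: star_family k n lam "mstar :: nat \<Rightarrow> nat \<Rightarrow> (multiword, 'h) ell2 \<Rightarrow> _"
    by (rule star_family_mstar)
  have mF: "mstar i s f \<in> F D" if "letter i s" "f \<in> F D" for i s f
    by (rule mstar_fock[OF that(1) closed_csubspaceD(1)[OF D_closed] that(2)])
  have aF: "act mstar k \<beta> f \<in> F D" if "\<beta> \<in> mw" "f \<in> F D" for \<beta> f
    by (rule act_closed[OF _ that(1) order_refl that(2)]) (rule mF)
  \<comment> \<open>Collecting all vectors whose orbit is orthogonal to the range of
    \<open>K\<close> gives a set invariant under the adjoint shifts, as
    \<open>defect_form_orthogonal\<close> requires.\<close>
  define Y where "Y = {u \<in> F D. \<forall>\<beta>\<in>mw. \<forall>h. cinner (act mstar k \<beta> u) (K h) = 0}"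
  have Y: "mstar i s u \<in> Y" if l: "letter i s" and u: "u \<in> Y" for i s u
  proof -
    have "cinner (act mstar k \<beta> (mstar i s u)) (K h) = 0" if \<beta>: "\<beta> \<in> mw" for \<beta> h
    proof -
      have "act mstar k (push i s \<beta>) u = c i s \<beta> *\<^sub>C act mstar k \<beta> (mstar i s u)"
        using l by (intro m.act_push \<beta>) auto
      moreover have "cinner (act mstar k (push i s \<beta>) u) (K h) = 0"
        using u l \<beta> by (simp add: Y_def push_multiwords)
      moreover have "c i s \<beta> \<noteq> 0" using cmod_shift_coeff[OF l \<beta>] by auto
      ultimately show ?thesis by (simp add: cinner_scaleC_left)
    qed
    then show ?thesis using u mF[OF l] by (simp add: Y_def)
  qed
  have vac0: "cinner u (K h) = 0" if "u \<in> Y" for u h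
  proof -
    have "act mstar j vacuum u = u" for j
      by (induction j) (simp_all add: act_Suc)
    then show ?thesis using that vacuum_mw by (auto simp: Y_def)
  qed
  have coord0: "coord u vacuum = 0" if u: "u \<in> Y" for u
  proof -
    have uF: "u \<in> F D" "u \<in> F UNIV" using u fock_mono[of u k n D UNIV] by (auto simp: Y_def)
    \<comment> \<open>\<open>Y\<close> and the range of \<open>K\<close> are orthogonal and both
      invariant, so the defect form is additive on them, and it reads off vacuum coefficients.
      Additivity forces the real part of the inner product of these coefficients to vanish.\<close>
    have add: "norm2 (coord (u + K h) vacuum) = norm2 (coord u vacuum) + norm2 (coord (K h) vacuum)" for h
    proof -
      have KF: "K h \<in> F UNIV" for h using fock_mono[OF range_K_FD] by simp
      have "defect_form mstar (Suc 0) k norm2 (u + K h)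
          = defect_form mstar (Suc 0) k norm2 u + defect_form mstar (Suc 0) k norm2 (K h)"
      proof (rule defect_form_orthogonal[where Y = Y and Z = "range K"])
        show "mstar i s v \<in> range K" if l: "letter i s" and "v \<in> range K" for i s v
        proof -
          obtain h' where "v = K h'" using \<open>v \<in> range K\<close> by blast
          then show ?thesis using K_Tst[OF l, of h', symmetric] by simp
        qed
        show "norm2 (a + b) = norm2 a + norm2 b" if ab: "a \<in> Y" "b \<in> range K" for a b
        proof -
          obtain h' where "b = K h'" using ab(2) by blast
          then show ?thesis using pythagoras[OF vac0[OF ab(1), of h']] by simp
        qed
      qed (simp_all add: Y mstar_linear(1) u)
      then show ?thesis
        unfolding defect_form_mstar[OF uF(2)] defect_form_mstar[OF KF]
          defect_form_mstar[OF csubspaceD(2)[OF csubspace_F[OF csubspace_UNIV] uF(2) KF]] .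
    qed
    have RK: "coord (K h) vacuum = R h" for h
    proof -
      have "act Tst j vacuum h = h" for j by (induction j) (simp_all add: act_Suc)
      then show ?thesis by (simp add: coord_K vacuum_mw)
    qed
    have re: "Re (cinner (coord u vacuum) (R h)) = 0" for h
    proof -
      have "norm2 (coord u vacuum + R h) = norm2 (coord u vacuum) + norm2 (R h)"
        using add[of h] by (simp add: coord_simps RK)
      then have "inner (coord u vacuum) (R h) = 0"
        by (simp add: power2_norm_eq_inner inner_add_left inner_add_right inner_commute[of "R h" "coord u vacuum"])
      then show ?thesis by (simp only: inner_eq_Re_cinner)
    qed
    \<comment> \<open>Replacing \<open>h\<close> by \<open>?a *\<^sub>C h\<close> turns the real
      part into the squared modulus of \<open>?a\<close>.\<close>
    have "cinner (coord u vacuum) (R h) = 0" for h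
    proof -
      let ?a = "cinner (coord u vacuum) (R h)"
      have "Re (cinner (coord u vacuum) (R (?a *\<^sub>C h))) = 0" by (rule re)
      then have "Re (cnj ?a * ?a) = 0" by (simp add: bounded_opD(3)[OF R_bounded] cinner_scaleC_right)
      then show ?thesis by (simp add: complex_eq_iff sum_power2_eq_zero_iff flip: power2_eq_square)
    qed
    then have "coord u vacuum \<in> orthocomp_in UNIV (range R)" by (auto simp: orthocomp_in_def)
    then have "coord u vacuum \<in> orthocomp_in UNIV D" by (simp only: D_eq orthocomp_in_closure)
    moreover have "coord u vacuum \<in> D" by (rule fockD(1)[OF uF(1) vacuum_mw])
    ultimately have "cinner (coord u vacuum) (coord u vacuum) = 0" by (simp add: orthocomp_in_def)
    then show ?thesis by (simp add: cinner_self_eq_0)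
  qed
  have yY: "y \<in> Y" using y orth by (simp add: Y_def)
  have "coord y \<beta> = 0" for \<beta>
  proof (cases "\<beta> \<in> mw")
    case True
    have "act mstar k \<beta> y \<in> Y" by (rule act_closed[OF _ True order_refl yY]) (rule Y)
    then show ?thesis using coord0 coord_act_vacuum[OF True, of y] by metis
  qed (use fockD(2)[OF y] in blast)
  then show ?thesis by (intro ell2_eqI) (simp add: coord_simps)
qed

text \<open>The space asked for is the copy \<open>E\<close> of D(T) under \<open>J\<close>. The
  ampliation of \<open>J\<close> carries \<open>M0\<close> to \<open>M\<close> and the Berezin
  kernel to \<open>U\<close>, and the span condition reduces to \<open>span_K\<close> by testing
  orthogonal vectors.\<close>

lemma beurling_imp_dilation:
  fixes J :: "'h \<Rightarrow> 'u::chilbert_space"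
  assumes J: "bounded_op UNIV UNIV J" "\<And>x. norm (J x) = norm x"
    and beurling: "beurling_type TYPE('u) k n lam D M0"
  shows "\<exists>(E :: 'u set) M U. closed_csubspace E \<and> beurling_type TYPE('u) k n lam E M \<and>
    unitary_op UNIV (orthocomp_in (F E) M) U \<and>
    (\<forall>i\<in>{1..k}. \<forall>s\<in>{1..n i}. \<forall>h. U (cadjoint UNIV (T i s) h) = cadjoint (F E) (S i s) (U h)) \<and>
    F E = closed_cspan (\<Union>\<alpha>\<in>mw. multi_model k lam \<alpha> ` orthocomp_in (F E) M)"
proof -
  obtain L :: "'u set" and \<Psi> where L: "closed_csubspace L" and inner: "inner_multi_analytic k n lam L D \<Psi>"
    and M0: "M0 = \<Psi> ` F L" using beurling unfolding beurling_type_def by blast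
  define E where "E = J ` D"
  note Dsub = closed_csubspaceD(1)[OF D_closed]
  have bJ: "bounded_op D E J" unfolding E_def by (rule bounded_op_mono[OF J(1)]) auto
  have E: "closed_csubspace E" unfolding E_def by (rule closed_csubspace_isometry_image[OF D_closed bJ J(2)])
  note Esub = closed_csubspaceD(1)[OF E]
  define J' where "J' = cadjoint D J"
  have bJ': "bounded_op E D J'" unfolding J'_def
    by (rule bounded_op_mono[OF bounded_op_cadjoint[OF bJ D_closed]]) (auto simp: cadjoint_in[OF bJ D_closed])
  have J'J: "J' (J x) = x" if "x \<in> D" for x
    unfolding J'_def by (rule isometry_adjoint[OF D_closed bJ J(2) that])
  have JJ': "J (J' y) = y" if "y \<in> E" for y using that J'J by (auto simp: E_def)
  have adj: "cinner (J x) y = cinner x (J' y)" if "x \<in> D" for x y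
    unfolding J'_def by (rule cadjoint_right[OF bJ D_closed that])
  let ?a = "amp J" and ?b = "amp J'"
  note ba = bounded_op_amp[OF bJ Dsub] and bb = bounded_op_amp[OF bJ' Esub]
  have ba_id: "?b (?a f) = f" if "f \<in> F D" for f by (rule amp_amp[OF bJ Dsub bJ' Esub J'J that])
  have ab_id: "?a (?b f) = f" if "f \<in> F E" for f by (rule amp_amp[OF bJ' Esub bJ Dsub JJ' that])
  have na: "norm (?a f) = norm f" if "f \<in> F D" for f by (rule norm_amp[OF bJ Dsub J(2) that])
  have cab: "cinner (?a f) h = cinner f (?b h)" if "f \<in> F D" "h \<in> F E" for f h
    by (rule cinner_amp[OF bJ Dsub bJ' Esub adj that])
  define M where "M = ?a ` M0"
  define U where "U h = ?a (K h)" for h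
  have FE: "closed_csubspace (F E)" by (rule closed_csubspace_fock[OF E])
  have UE: "U h \<in> F E" for h unfolding U_def by (rule bounded_opD(1)[OF ba range_K_FD])
  have inner2: "inner_multi_analytic k n lam L E (\<lambda>z. ?a (\<Psi> z))"
  proof -
    note \<Psi> = multi_analytic_inner[OF L D_closed inner]
    have \<Psi>D: "\<Psi> z \<in> F D" if "z \<in> F L" for z by (rule bounded_opD(1)[OF multi_analyticD(1)[OF \<Psi>] that])
    have "multi_analytic k n lam L E (\<lambda>z. ?a (\<Psi> z))"
      unfolding multi_analytic_def
    proof (intro conjI ballI)
      show "bounded_op (F L) (F E) (\<lambda>z. ?a (\<Psi> z))" by (rule bounded_op_comp[OF multi_analyticD(1)[OF \<Psi>] ba])
      fix i s z assume l: "i \<in> {1..k}" "s \<in> {1..n i}" and z: "z \<in> F L"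
      then show "?a (\<Psi> (S i s z)) = S i s (?a (\<Psi> z))"
        using multi_analyticD(2)[OF \<Psi> _ z, of i s] amp_model[OF bJ Dsub _ \<Psi>D[OF z] Esub, of i s] by simp
    qed
    moreover have "{z \<in> F L. ?a (\<Psi> z) = 0} = {z \<in> F L. \<Psi> z = 0}"
      using na[OF \<Psi>D] by (metis (no_types, lifting) norm_eq_zero)
    moreover have "norm (?a (\<Psi> x)) = norm x" if x: "x \<in> orthocomp_in (F L) {z \<in> F L. \<Psi> z = 0}" for x
      using na[OF \<Psi>D[OF initial_FL[OF L D_closed inner x]]] norm_initial[OF L D_closed inner x] by simp
    ultimately show ?thesis by (simp add: inner_multi_analytic_def partial_isometry_def)
  qed
  have "M = (\<lambda>z. ?a (\<Psi> z)) ` F L" by (simp add: M_def M0 image_image)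
  then have bt: "beurling_type TYPE('u) k n lam E M"
    unfolding beurling_type_def using L inner2 by blast
  have orth: "orthocomp_in (F E) M = range U"
  proof
    show "range U \<subseteq> orthocomp_in (F E) M"
    proof
      fix u assume "u \<in> range U"
      then obtain h where u: "u = U h" by blast
      have "cinner u (?a m) = 0" if "m \<in> M0" for m
        using cab[OF range_K_FD bounded_opD(1)[OF ba M0_FD[OF that]], of h] M0_K[OF that, of h]
        by (simp add: u U_def ba_id M0_FD[OF that] cinner_zero_comm)
      then show "u \<in> orthocomp_in (F E) M" using UE by (auto simp: u orthocomp_in_def M_def)
    qed
    show "orthocomp_in (F E) M \<subseteq> range U"
    proof
      fix y assume y: "y \<in> orthocomp_in (F E) M"
      then have yE: "y \<in> F E" by (simp add: orthocomp_in_def)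
      have bD: "?b y \<in> F D" by (rule bounded_opD(1)[OF bb yE])
      have "cinner (?b y) m = 0" if m: "m \<in> M0" for m
      proof -
        have "cinner y (?a m) = 0" using y m by (simp add: orthocomp_in_def M_def)
        then have "cinner m (?b y) = 0" using cab[OF M0_FD[OF m] yE] cinner_zero_comm by metis
        then show ?thesis by (simp add: cinner_zero_comm)
      qed
      then have "?b y \<in> orthocomp_in (F D) M0" using bD by (simp add: orthocomp_in_def)
      moreover have "orthocomp_in (F D) M0 = range K"
        by (rule orthocomp_in_orthocomp_in[OF range_K_closed FD_closed]) (use range_K_FD in blast)
      ultimately obtain h where "?b y = K h" by blast
      then have "y = U h" using ab_id[OF yE] by (simp add: U_def)
      then show "y \<in> range U" by blast
    qed
  qed
  have unitary: "unitary_op UNIV (orthocomp_in (F E) M) U"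
    unfolding unitary_op_def orth
  proof (intro conjI ballI)
    show "bounded_op UNIV (range U) U"
      by (rule bounded_op_mono[OF bounded_op_comp[OF bounded_op_K ba, folded U_def]]) auto
  qed (simp_all add: U_def na range_K_FD norm_K)
  have int: "U (cadjoint UNIV (T i s) h) = cadjoint (F E) (S i s) (U h)" if l: "letter i s" for i s h
    using amp_mstar[OF bJ Dsub l range_K_FD, of h] K_Tst[OF l, of h] cadjoint_model[OF l E UE, of h]
    by (simp add: U_def Tst_def)
  let ?G = "\<Union>\<alpha>\<in>mw. multi_model k lam \<alpha> ` range U"
  have span: "closed_cspan ?G = F E"
  proof (rule closed_csubspace_eqI[OF _ FE])
    have hull: "csubspace (csubspace hull ?G)" by (rule hull_in) (auto simp: csubspace_def)
    then show "closed_csubspace (closed_cspan ?G)"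
      unfolding closed_cspan_def by (rule closed_csubspace_closure)
    have "?G \<subseteq> F E" using cinner_multi_model[OF _ Esub UE] by blast
    then have "csubspace hull ?G \<subseteq> F E" by (rule hull_minimal) (rule closed_csubspaceD(1)[OF FE])
    then show "closed_cspan ?G \<subseteq> F E"
      unfolding closed_cspan_def by (rule closure_minimal) (rule closed_csubspaceD(2)[OF FE])
    fix y assume y: "y \<in> F E" and 0: "\<And>m. m \<in> closed_cspan ?G \<Longrightarrow> cinner y m = 0"
    have "cinner (act mstar k \<beta> (?b y)) (K h) = 0" if \<beta>: "\<beta> \<in> mw" for \<beta> h
    proof -
      have mE: "mstar i s f \<in> F E" if "letter i s" "f \<in> F E" for i s f by (rule mstar_fock[OF that(1) Esub that(2)])
      have ay: "act mstar k \<beta> y \<in> F E" by (rule act_closed[OF _ \<beta> order_refl y]) (rule mE)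
      have "multi_model k lam \<beta> (U h) \<in> csubspace hull ?G" by (rule hull_inc) (use \<beta> in blast)
      then have "cinner y (multi_model k lam \<beta> (U h)) = 0"
        using 0 closure_subset unfolding closed_cspan_def by blast
      then have "cinner (U h) (act mstar k \<beta> y) = 0"
        using cinner_multi_model[OF \<beta> Esub UE, of h y] cinner_zero_comm by metis
      then have "cinner (K h) (?b (act mstar k \<beta> y)) = 0"
        using cab[OF range_K_FD ay] by (simp add: U_def)
      moreover have "act mstar k \<beta> (?b y) = ?b (act mstar k \<beta> y)"
        by (rule act_intertwine[where M = "F E", OF _ \<beta> order_refl y])
          (simp add: mE amp_mstar[OF bJ' Esub])
      ultimately show ?thesis by (simp add: cinner_zero_comm)
    qed
    then have "?b y = 0" by (rule span_K[OF bounded_opD(1)[OF bb y]])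
    then show "y = 0"
      using ab_id[OF y] bounded_op_zero[OF ba csubspaceD(1)[OF closed_csubspaceD(1)[OF FD_closed]]] by simp
  qed
  show ?thesis
    by (intro exI[of _ E] exI[of _ M] exI[of _ U] conjI ballI allI E bt unitary int)
      (simp_all add: orth span)
qed

end

text \<open>\<open>U\<close> acts as a Berezin kernel with a possibly larger coefficient space. An
  isometry \<open>J\<close> from D(T) into that space accounts for the difference, and the adjoint
  of its ampliation cuts \<Psi> down to D(T).\<close>

lemma dilation_imp_characteristic_function:
  fixes E :: "'u::chilbert_space set"
  assumes E: "closed_csubspace E" and beurling: "beurling_type TYPE('u) k n lam E M"
    and U: "unitary_op UNIV (orthocomp_in (F E) M) U"
    and int: "\<And>i s h. letter i s \<Longrightarrow> U (cadjoint UNIV (T i s) h) = cadjoint (F E) (S i s) (U h)"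
  shows "admits_characteristic_function TYPE('u) k n lam T"
proof -
  obtain L :: "'u set" and \<Psi> where L: "closed_csubspace L" and inner: "inner_multi_analytic k n lam L E \<Psi>"
    and M: "M = \<Psi> ` F L" using beurling unfolding beurling_type_def by blast
  note FE = closed_csubspace_fock[OF E, of k n]
  note Dsub = closed_csubspaceD(1)[OF D_closed] and Esub = closed_csubspaceD(1)[OF E]
  have Mc: "closed_csubspace M" unfolding M by (rule range_closed[OF L E inner])
  have ME: "M \<subseteq> F E" using range_FE[OF L E inner] unfolding M by blast
  have bU0: "bounded_op UNIV (orthocomp_in (F E) M) U" and nU: "norm (U h) = norm h"
    and rU: "range U = orthocomp_in (F E) M" for h using U by (auto simp: unitary_op_def)
  have UE: "U h \<in> F E" for h using rU by (auto simp: orthocomp_in_def)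
  have UU: "U h \<in> F UNIV" for h using fock_mono[OF UE] by simp
  have bU: "bounded_op UNIV (F E) U" by (rule bounded_op_mono[OF bU0]) (use UE in auto)
  let ?Ust = "cadjoint UNIV U"
  have UstU: "?Ust (U h) = h" for h by (rule isometry_adjoint[OF closed_csubspace_UNIV bU]) (auto simp: nU)
  have cU: "cinner (U h) f = cinner h (?Ust f)" for h f by (rule cadjoint_right[OF bU]) auto
  have UT: "U (Tst i s h) = mstar i s (U h)" if "letter i s" for i s h
    using int[OF that, of h] cadjoint_model[OF that E UE, of h] by (simp add: Tst_def)
  define B where "B h = coord (U h) vacuum" for h
  have BE: "B h \<in> E" for h unfolding B_def by (rule fockD(1)[OF UE vacuum_mw])
  \<comment> \<open>\<open>U\<close> intertwines the adjoints, so the defect of \<open>T\<close> at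
    \<open>h\<close> is that of the model at \<open>U h\<close>. This equality of norms is what
    defines the isometry \<open>J\<close>.\<close>
  have nB: "norm (B h) = norm (R h)" for h
  proof -
    have "norm2 (R h) = defect_form mstar (Suc 0) k norm2 (U h)"
      unfolding norm_R by (rule defect_form_intertwine[where M = UNIV]) (simp_all add: UT nU)
    also have "\<dots> = norm2 (B h)" unfolding B_def by (rule defect_form_mstar[OF UU])
    finally show ?thesis by (simp add: power2_eq_iff_nonneg)
  qed
  have bB: "bounded_op UNIV E B"
  proof (rule bounded_opI[of _ _ _ 1])
    show "norm (B h) \<le> 1 * norm h" for h using norm_coord_le[of "U h" vacuum] by (simp add: B_def nU)
  qed (simp_all add: BE, simp_all add: B_def bounded_opD(2,3)[OF bU] coord_simps)
  obtain J where J: "bounded_op (closure (range R)) E J"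
    "\<And>x. x \<in> closure (range R) \<Longrightarrow> norm (J x) = norm x" "\<And>h. J (R h) = B h"
    using isometric_extension[OF R_bounded bB E nB] by blast
  note bJ = J(1)[folded D_eq] and nJ = J(2)[folded D_eq]
  define J' where "J' = cadjoint D J"
  have bJ': "bounded_op E D J'" unfolding J'_def
    by (rule bounded_op_mono[OF bounded_op_cadjoint[OF bJ D_closed]]) (auto simp: cadjoint_in[OF bJ D_closed])
  have J'J: "J' (J x) = x" if "x \<in> D" for x
    unfolding J'_def by (rule isometry_adjoint[OF D_closed bJ nJ that])
  have adj: "cinner (J x) y = cinner x (J' y)" if "x \<in> D" for x y
    unfolding J'_def by (rule cadjoint_right[OF bJ D_closed that])
  let ?a = "amp J" and ?b = "amp J'"
  note ba = bounded_op_amp[OF bJ Dsub] and bb = bounded_op_amp[OF bJ' Esub]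
  have ba_id: "?b (?a f) = f" if "f \<in> F D" for f by (rule amp_amp[OF bJ Dsub bJ' Esub J'J that])
  have cab: "cinner (?a f) h = cinner f (?b h)" if "f \<in> F D" "h \<in> F E" for f h
    by (rule cinner_amp[OF bJ Dsub bJ' Esub adj that])
  have KD: "K h \<in> F D" for h by (rule bounded_opD(1)[OF bounded_op_K]) simp
  \<comment> \<open>The coefficient of \<open>U h\<close> at \<alpha> is the vacuum coefficient of
    its orbit vector at \<alpha>, which is \<open>B\<close> at the orbit vector of \<open>h\<close>,
    and \<open>J\<close> turns \<open>R\<close> into \<open>B\<close>.\<close>
  have aK: "?a (K h) = U h" for h
  proof (rule ell2_eqI)
    fix \<alpha>
    show "coord (?a (K h)) \<alpha> = coord (U h) \<alpha>"
    proof (cases "\<alpha> \<in> mw")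
      case True
      have "act mstar k \<alpha> (U h) = U (act Tst k \<alpha> h)"
        by (rule act_intertwine[where M = UNIV, OF _ True order_refl]) (simp_all add: UT)
      then have "B (act Tst k \<alpha> h) = coord (U h) \<alpha>"
        using coord_act_vacuum[OF True, of "U h"] by (simp add: B_def)
      then show ?thesis using True by (simp add: coord_amp[OF bJ Dsub KD] coord_K J(3))
    qed (simp add: coord_amp[OF bJ Dsub KD] fockD(2)[OF UE])
  qed
  \<comment> \<open>\<open>U\<close> is an isometry onto the complement of \<open>M\<close>, so
    removing the projection onto its range leaves the projection onto \<open>M\<close>.\<close>
  have proj: "f - U (?Ust f) = proj M f" if f: "f \<in> F E" for f
  proof (rule proj_eqI[OF Mc, symmetric])
    have "cinner (f - U (?Ust f)) (U h) = 0" for h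
      using cU[of "?Ust f" "U h"] cU[of h f] cinner_commute[of f "U h"] cinner_commute[of h "?Ust f"]
      by (simp add: cinner_diff_left UstU)
    then have "f - U (?Ust f) \<in> orthocomp_in (F E) (orthocomp_in (F E) M)"
      unfolding rU[symmetric] using csubspaceD(5)[OF closed_csubspaceD(1)[OF FE] f UE]
      by (auto simp: orthocomp_in_def)
    then show "f - U (?Ust f) \<in> M" by (simp only: orthocomp_in_orthocomp_in[OF Mc FE ME])
    show "cinner m (f - U (?Ust f)) = cinner m f" if m: "m \<in> M" for m
    proof -
      have "U (?Ust f) \<in> orthocomp_in (F E) M" unfolding rU[symmetric] by simp
      then have "cinner (U (?Ust f)) m = 0" using m by (simp add: orthocomp_in_def)
      then have "cinner m (U (?Ust f)) = 0" by (simp only: cinner_zero_comm)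
      then show ?thesis by (simp add: cinner_diff_right)
    qed
  qed
  note \<Psi> = multi_analytic_inner[OF L E inner]
  note b\<Psi> = multi_analyticD(1)[OF \<Psi>] and FL = closed_csubspace_fock[OF L, of k n]
  have \<Psi>E: "\<Psi> z \<in> F E" if "z \<in> F L" for z by (rule bounded_opD(1)[OF b\<Psi> that])
  let ?P = "\<lambda>z. ?b (\<Psi> z)"
  have bP: "bounded_op (F L) (F D) ?P" by (rule bounded_op_comp[OF b\<Psi> bb])
  have P: "multi_analytic k n lam L D ?P"
    unfolding multi_analytic_def
  proof (intro conjI ballI bP)
    fix i s z assume l: "i \<in> {1..k}" "s \<in> {1..n i}" and z: "z \<in> F L"
    then show "?b (\<Psi> (S i s z)) = S i s (?b (\<Psi> z))"
      using multi_analyticD(2)[OF \<Psi> _ z, of i s] amp_model[OF bJ' Esub _ \<Psi>E[OF z] Dsub, of i s] by simp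
  qed
  have fac: "K (Kst f) + ?P (cadjoint (F L) ?P f) = f" if f: "f \<in> F D" for f
  proof -
    have af: "?a f \<in> F E" by (rule bounded_opD(1)[OF ba f])
    have W: "cadjoint (F L) ?P f = cadjoint (F L) \<Psi> (?a f)"
    proof (rule cadjoint_eqI[OF closed_csubspaceD(1)[OF FL] cadjoint_in[OF b\<Psi> FL]])
      fix z assume z: "z \<in> F L"
      have "cinner (?b (\<Psi> z)) f = cinner (\<Psi> z) (?a f)"
        using cab[OF f \<Psi>E[OF z]] cinner_commute by metis
      also have "\<dots> = cinner z (cadjoint (F L) \<Psi> (?a f))" by (rule cadjoint_right[OF b\<Psi> FL z])
      finally show "cinner (?b (\<Psi> z)) f = cinner z (cadjoint (F L) \<Psi> (?a f))" .
    qed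
    have Kst: "Kst f = ?Ust (?a f)"
    proof (rule cadjoint_eqI[OF csubspace_UNIV UNIV_I])
      fix z
      have "cinner (K z) f = cinner (K z) (?b (?a f))" by (simp add: ba_id[OF f])
      also have "\<dots> = cinner (U z) (?a f)" using cab[OF KD af, of z] by (simp add: aK)
      finally show "cinner (K z) f = cinner z (?Ust (?a f))" by (simp add: cU)
    qed
    \<comment> \<open>The projection identity at \<open>?a f\<close> is pulled back to
      \<open>F D\<close> by \<open>?b\<close>, which inverts \<open>?a\<close> there.\<close>
    have "\<Psi> (cadjoint (F L) \<Psi> (?a f)) = ?a f - ?a (K (Kst f))"
      unfolding inner_factorization[OF L E inner] M[symmetric] proj[OF af, symmetric] aK Kst ..
    also have "?b \<dots> = f - K (Kst f)"
      unfolding bounded_op_diff[OF bb closed_csubspaceD(1)[OF FE] af bounded_opD(1)[OF ba KD]]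
      by (simp add: ba_id f KD)
    finally show ?thesis unfolding W by simp
  qed
  show ?thesis unfolding admits_characteristic_function_def using L P fac by blast
qed

end

section \<open>Embeddings into the universe and assembly of the equivalences\<close>

lemma single_linear:
  shows "norm (single i x) = norm x" and "single i (x + y) = single i x + single i y"
    and "single i (a *\<^sub>C x) = a *\<^sub>C single i x"
proof -
  have "(norm (single i x))\<^sup>2 = (\<Sum>\<^sub>\<infinity>j\<in>{i}. (norm (coord (single i x) j))\<^sup>2)"
    by (rule norm_ell2_support) (simp add: single.rep_eq)
  then show "norm (single i x) = norm x" by (simp add: single.rep_eq power2_eq_iff_nonneg)
qed (rule ell2_eqI; simp add: single.rep_eq coord_simps)+

lemma universe_embedding:
  shows "bounded_op UNIV UNIV (\<lambda>y. (0, y) :: ('x::chilbert_space, 'h::chilbert_space) universe)"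
    and "norm ((0, y) :: ('x, 'h) universe) = norm y"
  by (auto intro!: bounded_opI[of _ _ _ 1] simp: norm_Pair scaleC_prod_def)

theorem theorem5p4:
  fixes k :: nat and n :: "nat \<Rightarrow> nat" and lam :: "nat \<Rightarrow> nat \<Rightarrow> nat \<Rightarrow> nat \<Rightarrow> complex"
    and T :: "nat \<Rightarrow> nat \<Rightarrow> 'h \<Rightarrow> 'h::chilbert_space"
  assumes "k \<ge> 1" and "\<forall>i\<in>{1..k}. n i \<ge> 1"
    and "\<forall>i\<in>{1..k}. \<forall>j\<in>{1..k}. i \<noteq> j \<longrightarrow> (\<forall>s\<in>{1..n i}. \<forall>t\<in>{1..n j}.
           cmod (lam i j s t) = 1 \<and> lam j i t s = cnj (lam i j s t))"
    and "T \<in> polyball k n lam"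
  shows
    "(admits_characteristic_function TYPE(('x::chilbert_space, 'h) universe) k n lam T \<longleftrightarrow>
       positive_op (fock k n (defect_space k n T))
         (model_defect k n lam (defect_space k n T)
           (\<lambda>f. f - berezin k n T (cadjoint UNIV (berezin k n T) f)))) \<and>
     (pure_tuple k n T \<longrightarrow>
       (admits_characteristic_function TYPE(('x, 'h) universe) k n lam T \<longleftrightarrow>
          beurling_type TYPE(('x, 'h) universe) k n lam (defect_space k n T)
            (orthocomp_in (fock k n (defect_space k n T)) (range (berezin k n T)))) \<and>
       (admits_characteristic_function TYPE(('x, 'h) universe) k n lam T \<longleftrightarrow>
          doubly_commuting k n lam
            (orthocomp_in (fock k n (defect_space k n T)) (range (berezin k n T))) (model lam)) \<and>
       (admits_characteristic_function TYPE(('x, 'h) universe) k n lam T \<longleftrightarrow>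
          (\<exists>(D :: ('x, 'h) universe set) M U.
             closed_csubspace D \<and>
             beurling_type TYPE(('x, 'h) universe) k n lam D M \<and>
             unitary_op UNIV (orthocomp_in (fock k n D) M) U \<and>
             (\<forall>i\<in>{1..k}. \<forall>s\<in>{1..n i}. \<forall>h.
                U (cadjoint UNIV (T i s) h) = cadjoint (fock k n D) (model lam i s) (U h)) \<and>
             fock k n D = closed_cspan (\<Union>\<alpha>\<in>multiwords k n.
               multi_model k lam \<alpha> ` orthocomp_in (fock k n D) M))))"
proof (intro conjI impI)
  interpret polyball_tuple k n lam T
  proof
    show "cmod (lam i j s t) = 1" "lam j i t s = cnj (lam i j s t)"
      if "i \<in> {1..k}" "j \<in> {1..k}" "i \<noteq> j" "s \<in> {1..n i}" "t \<in> {1..n j}" for i j s t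
      using assms(3) that by blast+
  qed (rule assms(4))
  let ?u = "TYPE(('x, 'h) universe)"
  \<comment> \<open>A copy of the space of \<open>T\<close>, placed at the vacuum of the Fock
    component; it hosts D(T) in (iv). The characteristic function uses the whole Fock component
    through \<open>universe_embedding\<close>.\<close>
  let ?J = "\<lambda>h. (0, single (\<lambda>_. []) h) :: ('x, 'h) universe"
  have "bounded_op UNIV UNIV (\<lambda>h::'h. single (\<lambda>_. []) h :: (multiword, 'h) ell2)"
    by (rule bounded_opI[of _ _ _ 1]) (simp_all add: single_linear)
  then have J: "bounded_op UNIV UNIV ?J" "norm (?J x) = norm x" for x
    using bounded_op_comp[OF _ universe_embedding(1)] by (auto simp: universe_embedding(2) single_linear(1))
  have pos_iff: "admits_characteristic_function ?u k n lam T \<longleftrightarrow> (\<forall>f\<in>F D. 0 \<le> \<gamma> f)"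
    by (rule characteristic_function_iff[OF universe_embedding])
  show "admits_characteristic_function ?u k n lam T \<longleftrightarrow> positive_op (F D) (model_defect k n lam D X)"
    unfolding pos_iff positive_model_defect_iff ..
  assume pure: "pure_tuple k n T"
  show beurling: "admits_characteristic_function ?u k n lam T
      \<longleftrightarrow> beurling_type ?u k n lam D (orthocomp_in (F D) (range K))"
    by (rule characteristic_function_iff_beurling[OF pure])
  \<comment> \<open>The circle closes through positivity: Beurling type gives double commutation,
    this gives a nonnegative defect, and that gives a characteristic function.\<close>
  show "admits_characteristic_function ?u k n lam T
      \<longleftrightarrow> doubly_commuting k n lam (orthocomp_in (F D) (range K)) S"
    using beurling beurling_imp_doubly_commuting[OF pure]
      doubly_commuting_imp_defect_positive[OF pure] pos_iff by blast
  show "admits_characteristic_function ?u k n lam T \<longleftrightarrow>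
      (\<exists>(E :: ('x, 'h) universe set) M U. closed_csubspace E \<and> beurling_type ?u k n lam E M \<and>
        unitary_op UNIV (orthocomp_in (F E) M) U \<and>
        (\<forall>i\<in>{1..k}. \<forall>s\<in>{1..n i}. \<forall>h. U (cadjoint UNIV (T i s) h) = cadjoint (F E) (S i s) (U h)) \<and>
        F E = closed_cspan (\<Union>\<alpha>\<in>mw. multi_model k lam \<alpha> ` orthocomp_in (F E) M))" (is "?A \<longleftrightarrow> ?B")
  proof
    assume ?A
    then show ?B using beurling beurling_imp_dilation[OF pure J] by blast
  next
    assume ?B
    then obtain E :: "('x, 'h) universe set" and M U where "closed_csubspace E" "beurling_type ?u k n lam E M"
      "unitary_op UNIV (orthocomp_in (F E) M) U"
      and "\<forall>i\<in>{1..k}. \<forall>s\<in>{1..n i}. \<forall>h. U (cadjoint UNIV (T i s) h) = cadjoint (F E) (S i s) (U h)"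
      by blast
    then show ?A by (intro dilation_imp_characteristic_function) auto
  qed
qed

end
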